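(* Let $\mathcal{C}$ be a pseudo-triangulated category satisfying conditions (AC1) and (AC2), let $\mathcal{Z}\subseteq\mathcal{C}$ be an extension-closed subcategory, and let $\mathcal{D}\subseteq\mathcal{Z}$ be a full additive replete subcategory closed under finite direct summands in $\mathcal{Z}$. If $(\mathcal{C},\mathcal{Z},\mathcal{D})$ is Frobenius, then the quotient category $\mathcal{Z}/\mathcal{I}_{\mathcal{D}}$, equipped with the shift functor $S$ and the class $\triangle$ of distinguished triangles, is a triangulated category. In particular (case $\mathcal{D}=\mathcal{Z}$), if $\mathcal{Z}$ is Frobenius, then the stable category $\mathcal{Z}/\mathcal{I}$ is a triangulated category.
   Context: Conventions. Subcategories of $\mathcal{C}$ are full, additive and replete (closed under isomorphisms). Right triangulation. Let $\mathcal{C}$ be an additive category and $\Sigma\colon\mathcal{C}\to\mathcal{C}$ an additive endofunctor (not necessarily an equivalence). Consider the category of diagrams $A\xrightarrow{f}B\xrightarrow{g}C\xrightarrow{h}\Sigma A$; a morphism to $A'\xrightarrow{f'}B'\xrightarrow{g'}C'\xrightarrow{h'}\Sigma A'$ is a triple $(a,b,c)$ with $bf=f'a$, $cg=g'b$, $(\Sigma a)h=h'c$. A right triangulation $(\Sigma,\triangleright)$ consists of $\Sigma$ and a full isomorphism-closed subcategory $\triangleright$ of it such that: (RTR1) $0\to A\xrightarrow{\mathrm{id}}A\to\Sigma 0=0$ is in $\triangleright$ for all $A$, and every $f\colon A\to B$ is the first morphism of some object $A\xrightarrow{f}B\to C\to\Sigma A$ of $\triangleright$. (RTR2) If $A\xrightarrow{f}B\xrightarrow{g}C\xrightarrow{h}\Sigma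 A$ is in $\triangleright$, so is $B\xrightarrow{g}C\xrightarrow{h}\Sigma A\xrightarrow{-\Sigma f}\Sigma B$. (RTR3) Given two objects $A\xrightarrow{f}B\xrightarrow{g}C\xrightarrow{h}\Sigma A$ and $A'\xrightarrow{f'}B'\xrightarrow{g'}C'\xrightarrow{h'}\Sigma A'$ of $\triangleright$ and morphisms $a\colon A\to A'$, $b\colon B\to B'$ with $bf=f'a$, there is $c\colon C\to C'$ making $(a,b,c)$ a morphism. (RTR4) Given objects $A\xrightarrow{f}B\xrightarrow{g}C\xrightarrow{h}\Sigma A$, $A\xrightarrow{\ell}M\xrightarrow{m}B'\xrightarrow{n}\Sigma A$, $A'\xrightarrow{\ell'}M\xrightarrow{m'}B\xrightarrow{n'}\Sigma A'$ of $\triangleright$ with $m'\ell=f$, there are $g'\colon B'\to C$, $h'\colon C\to\Sigma A'$ with $h'g=n'$, $hg'=n$, $g'm=gm'$, $(\Sigma\ell)h+(\Sigma\ell')h'=0$ and $A'\xrightarrow{m\ell'}B'\xrightarrow{g'}C\xrightarrow{h'}\Sigma A'$ in $\triangleright$. Left triangulation $(\Omega,\triangleleft)$: the dual notion, for an additive endofunctor $\Omega$ and diagrams $\Omega C\xrightarrow{e}A\xrightarrow{f}B\xrightarrow{g}C$ (morphisms: triples $(a,b,c)$ with $ae=e'(\Omega c)$, $bf=f'a$, $cg=g'b$): (LTR1) $\Omega0=0\to A\xrightarrow{\mathrm{id}}A\to0$ is in $\triangleleft$, and every $g\colon B\to C$ is the last morphism of some object $\Omega C\to A\to B\xrightarrow{g}C$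 of $\triangleleft$. (LTR2) If $\Omega C\xrightarrow{e}A\xrightarrow{f}B\xrightarrow{g}C$ is in $\triangleleft$, so is $\Omega B\xrightarrow{-\Omega g}\Omega C\xrightarrow{e}A\xrightarrow{f}B$. (LTR3) Given two objects of $\triangleleft$ and $b,c$ with $cg=g'b$, there is $a$ making $(a,b,c)$ a morphism. (LTR4) Given $\Omega A\xrightarrow{h}C\xrightarrow{g}B\xrightarrow{f}A$, $\Omega A\xrightarrow{n}B'\xrightarrow{m}M\xrightarrow{\ell}A$, $\Omega A'\xrightarrow{n'}B\xrightarrow{m'}M\xrightarrow{\ell'}A'$ in $\triangleleft$ with $\ell m'=f$, there are $g'\colon C\to B'$, $h'\colon\Omega A'\to C$ with $gh'=n'$, $g'h=n$, $mg'=m'g$, $h(\Omega\ell)+h'(\Omega\ell')=0$ and $\Omega A'\xrightarrow{h'}C\xrightarrow{g'}B'\xrightarrow{\ell'm}A'$ in $\triangleleft$. A morphism is $\Sigma$-null if it factors through an object of the form $\Sigma X$; $f\colon A\to B$ is $\Sigma$-epic if every $b\colon B\to B'$ with $bf=0$ is $\Sigma$-null. Dually, a morphism is $\Omega$-null if it factors through some $\Omega X$; $f\colon A\to B$ is $\Omega$-monic if every $a\colon A'\to A$ with $fa=0$ is $\Omega$-null. Pseudo-triangulated category: an additive category $\mathcal{C}$ with a right triangulation $(\Sigma,\triangleright)$, a left triangulation $(\Omega,\triangleleft)$ and an adjunction isomorphism $\psi_{A,B}\colon\mathcal{C}(\Omega A,B)\cong\mathcal{C}(A,\Sigma B)$ natural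 in $A,B$, such that: (G1) if $g\colon B\to C$ is $\Sigma$-epic, then for any $\Omega C\xrightarrow{e}A\xrightarrow{f}B\xrightarrow{g}C$ in $\triangleleft$ and $A\xrightarrow{f}B\xrightarrow{g'}C'\xrightarrow{h'}\Sigma A$ in $\triangleright$ there is an isomorphism $c\colon C'\to C$ with $cg'=g$ and $-\psi(e)c=h'$; (G2) if $f\colon A\to B$ is $\Omega$-monic, then for any $A\xrightarrow{f}B\xrightarrow{g}C\xrightarrow{h}\Sigma A$ in $\triangleright$ and $\Omega C\xrightarrow{e'}A'\xrightarrow{f'}B\xrightarrow{g}C$ in $\triangleleft$ there is an isomorphism $a\colon A\to A'$ with $f'a=f$ and $-a\psi^{-1}(h)=e'$. Extension: a sequence $\Omega C\xrightarrow{e}A\xrightarrow{f}B\xrightarrow{g}C\xrightarrow{h}\Sigma A$ whose last four terms form an object of $\triangleright$, whose first four terms form an object of $\triangleleft$, and with $h=-\psi_{C,A}(e)$. A morphism of extensions is a triple $(a,b,c)$ with $bf=f'a$, $cg=g'b$, $(\Sigma a)h=h'c$ (the last is equivalent to $ae=e'(\Omega c)$). Conditions (AC1), (AC2): for all extensions $\Omega C\xrightarrow{e}A\xrightarrow{f}B\xrightarrow{g}C\xrightarrow{h}\Sigma A$ and $\Omega C'\xrightarrow{e'}A'\xrightarrow{f'}B'\xrightarrow{g'}C'\xrightarrow{h'}\Sigma A'$: (AC1) if $c\colon C\to C'$ satisfies $h'c=0$ and $cg=0$, then $c=g'c'$ for some $c'\colon C\to B'$; (AC2) if $a\colon A\to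 A'$ satisfies $f'a=0$ and $ae=0$, then $a=a'f$ for some $a'\colon B\to A'$. $\mathcal{Z}\subseteq\mathcal{C}$ is extension-closed if for each extension $\Omega Z\to X\to Y\to Z\to\Sigma X$, $X,Z\in\mathcal{Z}$ implies $Y\in\mathcal{Z}$. A conflation is an extension $\Omega Z\to X\xrightarrow{f}Y\xrightarrow{g}Z\to\Sigma X$ with $X,Y,Z\in\mathcal{Z}$; then $f$ is called an inflation and $g$ a deflation. Morphisms of conflations are morphisms of extensions. $\mathcal{D}\subseteq\mathcal{Z}$ is closed under finite direct summands in $\mathcal{Z}$ if $D\cong Z_1\oplus Z_2$ with $D\in\mathcal{D}$, $Z_1,Z_2\in\mathcal{Z}$ implies $Z_1,Z_2\in\mathcal{D}$. $\mathcal{I}_{\mathcal{D}}$: full subcategory of the $I\in\mathcal{D}$ such that $-\circ f\colon\mathcal{Z}(Y,I)\to\mathcal{Z}(X,I)$ is surjective for every inflation $f\colon X\to Y$. $\mathcal{P}_{\mathcal{D}}$: full subcategory of the $P\in\mathcal{D}$ such that $g\circ-\colon\mathcal{Z}(P,Y)\to\mathcal{Z}(P,Z)$ is surjective for every deflation $g\colon Y\to Z$. Put $\mathcal{I}=\mathcal{I}_{\mathcal{Z}}$. $(\mathcal{C},\mathcal{Z},\mathcal{D})$ has enough injectives if every $X\in\mathcal{Z}$ admits an inflation $X\to I$ with $I\in\mathcal{I}_{\mathcal{D}}$; it has enough projectives if every $Z\in\mathcal{Z}$ admits a deflation $P\to Z$ with $P\in\mathcal{P}_{\mathcal{D}}$;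 it is Frobenius if it has enough injectives and enough projectives and $\mathcal{I}_{\mathcal{D}}=\mathcal{P}_{\mathcal{D}}$. "$\mathcal{Z}$ is Frobenius" means $(\mathcal{C},\mathcal{Z},\mathcal{Z})$ is Frobenius. $\mathcal{Z}/\mathcal{I}_{\mathcal{D}}$ is the quotient of $\mathcal{Z}$ by the ideal of morphisms factoring through objects of $\mathcal{I}_{\mathcal{D}}$; $\underline{f}$ is the class of $f$. Shift $S$: for each $X\in\mathcal{Z}$ fix a conflation $\Omega S_X\xrightarrow{\delta_X}X\xrightarrow{\alpha_X}I_X\xrightarrow{\beta_X}S_X\xrightarrow{\gamma_X}\Sigma X$ with $I_X\in\mathcal{I}_{\mathcal{D}}$ and let $SX$ be $S_X$ in $\mathcal{Z}/\mathcal{I}_{\mathcal{D}}$. For $f\in\mathcal{Z}(X,Y)$ choose $I_f\colon I_X\to I_Y$ and $S_f\colon S_X\to S_Y$ such that $(f,I_f,S_f)$ is a morphism of conflations, and put $S\underline{f}=\underline{S_f}$ (well defined). Distinguished triangles: for a conflation $\Omega Z\xrightarrow{e}X\xrightarrow{f}Y\xrightarrow{g}Z\xrightarrow{h}\Sigma X$ and $p\in\mathcal{Z}(Y,I_X)$, $q\in\mathcal{Z}(Z,S_X)$ with $pf=\alpha_X$, $qg=\beta_Xp$, $\gamma_Xq=h$, the sequence $X\xrightarrow{\underline f}Y\xrightarrow{\underline g}Z\xrightarrow{\underline q}SX$ is a standard triangle. $\triangle$ is the class of sequences $X\to Y\to Z\to SX$ in $\mathcal{Z}/\mathcal{I}_{\mathcal{D}}$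 isomorphic to standard triangles. *)

theory Defs
  imports "HOL-Algebra.Group"
begin

section \<open>Additive categories\<close>

text \<open>Arrows carry their source and target, so hom-sets between different pairs of objects are
  disjoint. \<open>g \<cdot> f\<close> is the composite ``first \<open>f\<close>, then \<open>g\<close>''.\<close>

record ('o, 'm) cat =
  Obj :: "'o set"
  Arr :: "'m set"
  Src :: "'m \<Rightarrow> 'o"
  Tgt :: "'m \<Rightarrow> 'o"
  Idn :: "'o \<Rightarrow> 'm"
  Comp :: "'m \<Rightarrow> 'm \<Rightarrow> 'm" (infixr "\<cdot>\<index>" 70)
  Plus :: "'m \<Rightarrow> 'm \<Rightarrow> 'm" (infixl "\<boxplus>\<index>" 65)
  Zer :: "'o \<Rightarrow> 'o \<Rightarrow> 'm"

definition Hom :: "('o, 'm, 'b) cat_scheme \<Rightarrow> 'o \<Rightarrow> 'o \<Rightarrow> 'm set" where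
  "Hom C A B = {f \<in> Arr C. Src C f = A \<and> Tgt C f = B}"

definition hom_group :: "('o, 'm, 'b) cat_scheme \<Rightarrow> 'o \<Rightarrow> 'o \<Rightarrow> 'm monoid" where
  "hom_group C A B = \<lparr>carrier = Hom C A B, mult = Plus C, one = Zer C A B\<rparr>"

definition Neg :: "('o, 'm, 'b) cat_scheme \<Rightarrow> 'm \<Rightarrow> 'm" ("\<boxminus>\<index> _" [81] 80) where
  "Neg C f = m_inv (hom_group C (Src C f) (Tgt C f)) f"

definition iso_arrow :: "('o, 'm, 'b) cat_scheme \<Rightarrow> 'm \<Rightarrow> bool" where
  "iso_arrow C f \<longleftrightarrow> f \<in> Arr C \<and>
     (\<exists>g \<in> Hom C (Tgt C f) (Src C f).
        g \<cdot>\<^bsub>C\<^esub> f = Idn C (Src C f) \<and> f \<cdot>\<^bsub>C\<^esub> g = Idn C (Tgt C f))"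

definition isomorphic :: "('o, 'm, 'b) cat_scheme \<Rightarrow> 'o \<Rightarrow> 'o \<Rightarrow> bool" where
  "isomorphic C A B \<longleftrightarrow> (\<exists>f \<in> Hom C A B. iso_arrow C f)"

definition zero_object :: "('o, 'm, 'b) cat_scheme \<Rightarrow> 'o \<Rightarrow> bool" where
  "zero_object C N \<longleftrightarrow> N \<in> Obj C \<and>
     (\<forall>A \<in> Obj C. (\<exists>!f. f \<in> Hom C N A) \<and> (\<exists>!f. f \<in> Hom C A N))"

definition biproduct :: "('o, 'm, 'b) cat_scheme \<Rightarrow> 'o \<Rightarrow> 'o \<Rightarrow> 'o \<Rightarrow> bool" where
  "biproduct C A B P \<longleftrightarrow> A \<in> Obj C \<and> B \<in> Obj C \<and> P \<in> Obj C \<and>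
     (\<exists>i \<in> Hom C A P. \<exists>j \<in> Hom C B P. \<exists>p \<in> Hom C P A. \<exists>q \<in> Hom C P B.
        p \<cdot>\<^bsub>C\<^esub> i = Idn C A \<and> q \<cdot>\<^bsub>C\<^esub> j = Idn C B \<and>
        q \<cdot>\<^bsub>C\<^esub> i = Zer C A B \<and> p \<cdot>\<^bsub>C\<^esub> j = Zer C B A \<and>
        i \<cdot>\<^bsub>C\<^esub> p \<boxplus>\<^bsub>C\<^esub> j \<cdot>\<^bsub>C\<^esub> q = Idn C P)"

locale category =
  fixes C :: "('o, 'm, 'b) cat_scheme" (structure)
  assumes src_obj: "f \<in> Arr C \<Longrightarrow> Src C f \<in> Obj C"
    and tgt_obj: "f \<in> Arr C \<Longrightarrow> Tgt C f \<in> Obj C"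
    and id_hom: "A \<in> Obj C \<Longrightarrow> Idn C A \<in> Hom C A A"
    and comp_hom: "f \<in> Hom C A B \<Longrightarrow> g \<in> Hom C B D \<Longrightarrow> g \<cdot> f \<in> Hom C A D"
    and comp_id_right: "f \<in> Hom C A B \<Longrightarrow> f \<cdot> Idn C A = f"
    and comp_id_left: "f \<in> Hom C A B \<Longrightarrow> Idn C B \<cdot> f = f"
    and comp_assoc: "f \<in> Hom C A B \<Longrightarrow> g \<in> Hom C B D \<Longrightarrow> h \<in> Hom C D E \<Longrightarrow>
      (h \<cdot> g) \<cdot> f = h \<cdot> (g \<cdot> f)"

locale preadditive_category = category +
  assumes hom_comm_group: "A \<in> Obj C \<Longrightarrow> B \<in> Obj C \<Longrightarrow> comm_group (hom_group C A B)"
    and comp_plus_right: "f \<in> Hom C A B \<Longrightarrow> f' \<in> Hom C A B \<Longrightarrow> g \<in> Hom C B D \<Longrightarrow>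
      g \<cdot> (f \<boxplus> f') = g \<cdot> f \<boxplus> g \<cdot> f'"
    and comp_plus_left: "f \<in> Hom C A B \<Longrightarrow> g \<in> Hom C B D \<Longrightarrow> g' \<in> Hom C B D \<Longrightarrow>
      (g \<boxplus> g') \<cdot> f = g \<cdot> f \<boxplus> g' \<cdot> f"

locale additive_category = preadditive_category +
  assumes ex_zero_object: "\<exists>N. zero_object C N"
    and ex_biproduct: "A \<in> Obj C \<Longrightarrow> B \<in> Obj C \<Longrightarrow> \<exists>P. biproduct C A B P"

section \<open>Endofunctors\<close>

record ('o, 'm) endofun =
  FOb :: "'o \<Rightarrow> 'o"
  FAr :: "'m \<Rightarrow> 'm"

definition endofunctor :: "('o, 'm, 'b) cat_scheme \<Rightarrow> ('o, 'm) endofun \<Rightarrow> bool" where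
  "endofunctor C F \<longleftrightarrow>
     (\<forall>A \<in> Obj C. FOb F A \<in> Obj C) \<and>
     (\<forall>f \<in> Arr C. FAr F f \<in> Hom C (FOb F (Src C f)) (FOb F (Tgt C f))) \<and>
     (\<forall>A \<in> Obj C. FAr F (Idn C A) = Idn C (FOb F A)) \<and>
     (\<forall>f \<in> Arr C. \<forall>g \<in> Arr C. Src C g = Tgt C f \<longrightarrow>
        FAr F (g \<cdot>\<^bsub>C\<^esub> f) = FAr F g \<cdot>\<^bsub>C\<^esub> FAr F f)"

definition additive_endofunctor :: "('o, 'm, 'b) cat_scheme \<Rightarrow> ('o, 'm) endofun \<Rightarrow> bool" where
  "additive_endofunctor C F \<longleftrightarrow> endofunctor C F \<and>
     (\<forall>A \<in> Obj C. \<forall>B \<in> Obj C. \<forall>f \<in> Hom C A B. \<forall>g \<in> Hom C A B.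
        FAr F (f \<boxplus>\<^bsub>C\<^esub> g) = FAr F f \<boxplus>\<^bsub>C\<^esub> FAr F g)"

definition id_fun :: "('o, 'm) endofun" where
  "id_fun = \<lparr>FOb = (\<lambda>A. A), FAr = (\<lambda>f. f)\<rparr>"

definition comp_fun :: "('o, 'm) endofun \<Rightarrow> ('o, 'm) endofun \<Rightarrow> ('o, 'm) endofun" where
  "comp_fun F G = \<lparr>FOb = FOb F \<circ> FOb G, FAr = FAr F \<circ> FAr G\<rparr>"

definition naturally_isomorphic ::
    "('o, 'm, 'b) cat_scheme \<Rightarrow> ('o, 'm) endofun \<Rightarrow> ('o, 'm) endofun \<Rightarrow> bool" where
  "naturally_isomorphic C F G \<longleftrightarrow>
     (\<exists>\<eta>. (\<forall>A \<in> Obj C. \<eta> A \<in> Hom C (FOb F A) (FOb G A) \<and> iso_arrow C (\<eta> A)) \<and>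
          (\<forall>f \<in> Arr C. \<eta> (Tgt C f) \<cdot>\<^bsub>C\<^esub> FAr F f = FAr G f \<cdot>\<^bsub>C\<^esub> \<eta> (Src C f)))"

definition autoequivalence :: "('o, 'm, 'b) cat_scheme \<Rightarrow> ('o, 'm) endofun \<Rightarrow> bool" where
  "autoequivalence C F \<longleftrightarrow> endofunctor C F \<and>
     (\<exists>G. endofunctor C G \<and> naturally_isomorphic C (comp_fun F G) id_fun \<and>
          naturally_isomorphic C (comp_fun G F) id_fun)"

section \<open>Right and left triangulations\<close>

text \<open>A diagram \<open>A \<rightarrow> B \<rightarrow> C \<rightarrow> \<Sigma>A\<close> is the triple \<open>(f, g, h)\<close> of its arrows, and a diagram
  \<open>\<Omega>C \<rightarrow> A \<rightarrow> B \<rightarrow> C\<close> is the triple \<open>(e, f, g)\<close>; the objects are recovered as sources and targets,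
  except that the argument of \<open>\<Sigma>\<close> (resp. \<open>\<Omega>\<close>) is the source of the first (resp. the target of
  the last) arrow.\<close>

definition rdiagram :: "('o, 'm, 'b) cat_scheme \<Rightarrow> ('o, 'm) endofun \<Rightarrow> 'm \<Rightarrow> 'm \<Rightarrow> 'm \<Rightarrow> bool" where
  "rdiagram C F f g h \<longleftrightarrow> f \<in> Arr C \<and> g \<in> Arr C \<and> h \<in> Arr C \<and>
     Src C g = Tgt C f \<and> Src C h = Tgt C g \<and> Tgt C h = FOb F (Src C f)"

definition rmorphism :: "('o, 'm, 'b) cat_scheme \<Rightarrow> ('o, 'm) endofun \<Rightarrow>
    'm \<times> 'm \<times> 'm \<Rightarrow> 'm \<times> 'm \<times> 'm \<Rightarrow> 'm \<times> 'm \<times> 'm \<Rightarrow> bool" where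
  "rmorphism C F = (\<lambda>(a, b, c) (f, g, h) (f', g', h').
     a \<in> Hom C (Src C f) (Src C f') \<and> b \<in> Hom C (Tgt C f) (Tgt C f') \<and>
     c \<in> Hom C (Tgt C g) (Tgt C g') \<and>
     b \<cdot>\<^bsub>C\<^esub> f = f' \<cdot>\<^bsub>C\<^esub> a \<and> c \<cdot>\<^bsub>C\<^esub> g = g' \<cdot>\<^bsub>C\<^esub> b \<and> FAr F a \<cdot>\<^bsub>C\<^esub> h = h' \<cdot>\<^bsub>C\<^esub> c)"

definition risomorphic :: "('o, 'm, 'b) cat_scheme \<Rightarrow> ('o, 'm) endofun \<Rightarrow>
    'm \<times> 'm \<times> 'm \<Rightarrow> 'm \<times> 'm \<times> 'm \<Rightarrow> bool" where
  "risomorphic C F t t' \<longleftrightarrow> (\<exists>a b c. rmorphism C F (a, b, c) t t' \<and>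
     iso_arrow C a \<and> iso_arrow C b \<and> iso_arrow C c)"

definition ldiagram :: "('o, 'm, 'b) cat_scheme \<Rightarrow> ('o, 'm) endofun \<Rightarrow> 'm \<Rightarrow> 'm \<Rightarrow> 'm \<Rightarrow> bool" where
  "ldiagram C F e f g \<longleftrightarrow> e \<in> Arr C \<and> f \<in> Arr C \<and> g \<in> Arr C \<and>
     Src C f = Tgt C e \<and> Src C g = Tgt C f \<and> Src C e = FOb F (Tgt C g)"

definition lmorphism :: "('o, 'm, 'b) cat_scheme \<Rightarrow> ('o, 'm) endofun \<Rightarrow>
    'm \<times> 'm \<times> 'm \<Rightarrow> 'm \<times> 'm \<times> 'm \<Rightarrow> 'm \<times> 'm \<times> 'm \<Rightarrow> bool" where
  "lmorphism C F = (\<lambda>(a, b, c) (e, f, g) (e', f', g').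
     a \<in> Hom C (Src C f) (Src C f') \<and> b \<in> Hom C (Tgt C f) (Tgt C f') \<and>
     c \<in> Hom C (Tgt C g) (Tgt C g') \<and>
     a \<cdot>\<^bsub>C\<^esub> e = e' \<cdot>\<^bsub>C\<^esub> FAr F c \<and> b \<cdot>\<^bsub>C\<^esub> f = f' \<cdot>\<^bsub>C\<^esub> a \<and> c \<cdot>\<^bsub>C\<^esub> g = g' \<cdot>\<^bsub>C\<^esub> b)"

definition lisomorphic :: "('o, 'm, 'b) cat_scheme \<Rightarrow> ('o, 'm) endofun \<Rightarrow>
    'm \<times> 'm \<times> 'm \<Rightarrow> 'm \<times> 'm \<times> 'm \<Rightarrow> bool" where
  "lisomorphic C F t t' \<longleftrightarrow> (\<exists>a b c. lmorphism C F (a, b, c) t t' \<and>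
     iso_arrow C a \<and> iso_arrow C b \<and> iso_arrow C c)"

locale right_triangulation = additive_category C
  for C :: "('o, 'm, 'b) cat_scheme" (structure) +
  fixes \<Sigma> :: "('o, 'm) endofun" and RT :: "('m \<times> 'm \<times> 'm) set"
  assumes Sigma_additive: "additive_endofunctor C \<Sigma>"
    and RT_diagram: "(f, g, h) \<in> RT \<Longrightarrow> rdiagram C \<Sigma> f g h"
    and RT_iso_closed: "(f, g, h) \<in> RT \<Longrightarrow> rdiagram C \<Sigma> f' g' h' \<Longrightarrow>
      risomorphic C \<Sigma> (f, g, h) (f', g', h') \<Longrightarrow> (f', g', h') \<in> RT"
    and RTR1_id: "zero_object C N \<Longrightarrow> A \<in> Obj C \<Longrightarrow>
      (Zer C N A, Idn C A, Zer C A (FOb \<Sigma> N)) \<in> RT"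
    and RTR1_ex: "f \<in> Arr C \<Longrightarrow> \<exists>g h. (f, g, h) \<in> RT"
    and RTR2: "(f, g, h) \<in> RT \<Longrightarrow> (g, h, \<boxminus> FAr \<Sigma> f) \<in> RT"
    and RTR3: "(f, g, h) \<in> RT \<Longrightarrow> (f', g', h') \<in> RT \<Longrightarrow>
      a \<in> Hom C (Src C f) (Src C f') \<Longrightarrow> b \<in> Hom C (Tgt C f) (Tgt C f') \<Longrightarrow>
      b \<cdot> f = f' \<cdot> a \<Longrightarrow> \<exists>c. rmorphism C \<Sigma> (a, b, c) (f, g, h) (f', g', h')"
    and RTR4: "(f, g, h) \<in> RT \<Longrightarrow> (l, m, n) \<in> RT \<Longrightarrow> (l', m', n') \<in> RT \<Longrightarrow>
      Src C l = Src C f \<Longrightarrow> Tgt C l' = Tgt C l \<Longrightarrow> Tgt C m' = Tgt C f \<Longrightarrow> m' \<cdot> l = f \<Longrightarrow>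
      \<exists>g' \<in> Hom C (Tgt C m) (Tgt C g). \<exists>h' \<in> Hom C (Tgt C g) (FOb \<Sigma> (Src C l')).
        h' \<cdot> g = n' \<and> h \<cdot> g' = n \<and> g' \<cdot> m = g \<cdot> m' \<and>
        FAr \<Sigma> l \<cdot> h \<boxplus> FAr \<Sigma> l' \<cdot> h' = Zer C (Tgt C g) (FOb \<Sigma> (Tgt C l)) \<and>
        (m \<cdot> l', g', h') \<in> RT"

locale left_triangulation = additive_category C
  for C :: "('o, 'm, 'b) cat_scheme" (structure) +
  fixes \<Omega> :: "('o, 'm) endofun" and LT :: "('m \<times> 'm \<times> 'm) set"
  assumes Omega_additive: "additive_endofunctor C \<Omega>"
    and LT_diagram: "(e, f, g) \<in> LT \<Longrightarrow> ldiagram C \<Omega> e f g"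
    and LT_iso_closed: "(e, f, g) \<in> LT \<Longrightarrow> ldiagram C \<Omega> e' f' g' \<Longrightarrow>
      lisomorphic C \<Omega> (e, f, g) (e', f', g') \<Longrightarrow> (e', f', g') \<in> LT"
    and LTR1_id: "zero_object C N \<Longrightarrow> A \<in> Obj C \<Longrightarrow>
      (Zer C (FOb \<Omega> N) A, Idn C A, Zer C A N) \<in> LT"
    and LTR1_ex: "g \<in> Arr C \<Longrightarrow> \<exists>e f. (e, f, g) \<in> LT"
    and LTR2: "(e, f, g) \<in> LT \<Longrightarrow> (\<boxminus> FAr \<Omega> g, e, f) \<in> LT"
    and LTR3: "(e, f, g) \<in> LT \<Longrightarrow> (e', f', g') \<in> LT \<Longrightarrow>
      b \<in> Hom C (Src C g) (Src C g') \<Longrightarrow> c \<in> Hom C (Tgt C g) (Tgt C g') \<Longrightarrow>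
      c \<cdot> g = g' \<cdot> b \<Longrightarrow> \<exists>a. lmorphism C \<Omega> (a, b, c) (e, f, g) (e', f', g')"
    and LTR4: "(h, g, f) \<in> LT \<Longrightarrow> (n, m, l) \<in> LT \<Longrightarrow> (n', m', l') \<in> LT \<Longrightarrow>
      Tgt C l = Tgt C f \<Longrightarrow> Src C l' = Src C l \<Longrightarrow> Src C m' = Src C f \<Longrightarrow> l \<cdot> m' = f \<Longrightarrow>
      \<exists>g' \<in> Hom C (Src C g) (Src C m). \<exists>h' \<in> Hom C (FOb \<Omega> (Tgt C l')) (Src C g).
        g \<cdot> h' = n' \<and> g' \<cdot> h = n \<and> m \<cdot> g' = m' \<cdot> g \<and>
        h \<cdot> FAr \<Omega> l \<boxplus> h' \<cdot> FAr \<Omega> l' = Zer C (FOb \<Omega> (Src C l)) (Src C g) \<and>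
        (h', g', l' \<cdot> m) \<in> LT"

section \<open>Pseudo-triangulated categories\<close>

definition factors_through :: "('o, 'm, 'b) cat_scheme \<Rightarrow> 'o set \<Rightarrow> 'm \<Rightarrow> bool" where
  "factors_through C J f \<longleftrightarrow> f \<in> Arr C \<and>
     (\<exists>X \<in> J. \<exists>u \<in> Hom C (Src C f) X. \<exists>v \<in> Hom C X (Tgt C f). f = v \<cdot>\<^bsub>C\<^esub> u)"

text \<open>For \<open>F = \<Sigma>\<close> (resp. \<open>F = \<Omega>\<close>) this is the notion of a \<open>\<Sigma>\<close>-null (resp. \<open>\<Omega>\<close>-null) morphism.\<close>

definition null_arrow :: "('o, 'm, 'b) cat_scheme \<Rightarrow> ('o, 'm) endofun \<Rightarrow> 'm \<Rightarrow> bool" where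
  "null_arrow C F f \<longleftrightarrow> factors_through C (FOb F ` Obj C) f"

definition Sigma_epic :: "('o, 'm, 'b) cat_scheme \<Rightarrow> ('o, 'm) endofun \<Rightarrow> 'm \<Rightarrow> bool" where
  "Sigma_epic C \<Sigma> f \<longleftrightarrow> f \<in> Arr C \<and>
     (\<forall>B' \<in> Obj C. \<forall>b \<in> Hom C (Tgt C f) B'.
        b \<cdot>\<^bsub>C\<^esub> f = Zer C (Src C f) B' \<longrightarrow> null_arrow C \<Sigma> b)"

definition Omega_monic :: "('o, 'm, 'b) cat_scheme \<Rightarrow> ('o, 'm) endofun \<Rightarrow> 'm \<Rightarrow> bool" where
  "Omega_monic C \<Omega> f \<longleftrightarrow> f \<in> Arr C \<and>
     (\<forall>A' \<in> Obj C. \<forall>a \<in> Hom C A' (Src C f).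
        f \<cdot>\<^bsub>C\<^esub> a = Zer C A' (Tgt C f) \<longrightarrow> null_arrow C \<Omega> a)"

text \<open>\<open>Psi A B\<close> is the adjunction bijection from \<open>Hom (\<Omega>A) B\<close> to \<open>Hom A (\<Sigma>B)\<close>; note that
  \<open>\<Omega>\<close> is the left adjoint.\<close>

record ('o, 'm) pt_cat = "('o, 'm) cat" +
  Sig :: "('o, 'm) endofun"
  RTri :: "('m \<times> 'm \<times> 'm) set"
  Ome :: "('o, 'm) endofun"
  LTri :: "('m \<times> 'm \<times> 'm) set"
  Psi :: "'o \<Rightarrow> 'o \<Rightarrow> 'm \<Rightarrow> 'm"

definition Psi_inv :: "('o, 'm, 'b) pt_cat_scheme \<Rightarrow> 'o \<Rightarrow> 'o \<Rightarrow> 'm \<Rightarrow> 'm" where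
  "Psi_inv C A B = inv_into (Hom C (FOb (Ome C) A) B) (Psi C A B)"

locale pseudo_triangulated =
  right_triangulation C "Sig C" "RTri C" + left_triangulation C "Ome C" "LTri C"
  for C :: "('o, 'm, 'b) pt_cat_scheme" (structure) +
  assumes Psi_bij: "A \<in> Obj C \<Longrightarrow> B \<in> Obj C \<Longrightarrow>
      bij_betw (Psi C A B) (Hom C (FOb (Ome C) A) B) (Hom C A (FOb (Sig C) B))"
    and Psi_natural: "A \<in> Obj C \<Longrightarrow> B \<in> Obj C \<Longrightarrow> A' \<in> Obj C \<Longrightarrow> B' \<in> Obj C \<Longrightarrow>
      x \<in> Hom C (FOb (Ome C) A) B \<Longrightarrow> a \<in> Hom C A' A \<Longrightarrow> b \<in> Hom C B B' \<Longrightarrow>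
      Psi C A' B' (b \<cdot> x \<cdot> FAr (Ome C) a) = FAr (Sig C) b \<cdot> Psi C A B x \<cdot> a"
    and G1: "Sigma_epic C (Sig C) g \<Longrightarrow> (e, f, g) \<in> LTri C \<Longrightarrow> (f, g', h') \<in> RTri C \<Longrightarrow>
      \<exists>c \<in> Hom C (Tgt C g') (Tgt C g). iso_arrow C c \<and> c \<cdot> g' = g \<and>
        (\<boxminus> Psi C (Tgt C g) (Src C f) e) \<cdot> c = h'"
    and G2: "Omega_monic C (Ome C) f \<Longrightarrow> (f, g, h) \<in> RTri C \<Longrightarrow> (e', f', g) \<in> LTri C \<Longrightarrow>
      \<exists>a \<in> Hom C (Src C f) (Src C f'). iso_arrow C a \<and> f' \<cdot> a = f \<and>
        \<boxminus> (a \<cdot> Psi_inv C (Tgt C g) (Src C f) h) = e'"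

text \<open>\<open>extension C e f g h\<close>: the arrows \<open>e, f, g, h\<close> form an extension
  \<open>\<Omega>C \<rightarrow> A \<rightarrow> B \<rightarrow> C \<rightarrow> \<Sigma>A\<close>.\<close>

definition extension :: "('o, 'm, 'b) pt_cat_scheme \<Rightarrow> 'm \<Rightarrow> 'm \<Rightarrow> 'm \<Rightarrow> 'm \<Rightarrow> bool" where
  "extension C e f g h \<longleftrightarrow> (f, g, h) \<in> RTri C \<and> (e, f, g) \<in> LTri C \<and>
     h = \<boxminus>\<^bsub>C\<^esub> Psi C (Tgt C g) (Src C f) e"

definition AC1 :: "('o, 'm, 'b) pt_cat_scheme \<Rightarrow> bool" where
  "AC1 C \<longleftrightarrow> (\<forall>e f g h e' f' g' h' c.
     extension C e f g h \<and> extension C e' f' g' h' \<and> c \<in> Hom C (Tgt C g) (Tgt C g') \<and>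
     h' \<cdot>\<^bsub>C\<^esub> c = Zer C (Tgt C g) (Tgt C h') \<and> c \<cdot>\<^bsub>C\<^esub> g = Zer C (Src C g) (Tgt C g') \<longrightarrow>
     (\<exists>c' \<in> Hom C (Tgt C g) (Src C g'). c = g' \<cdot>\<^bsub>C\<^esub> c'))"

definition AC2 :: "('o, 'm, 'b) pt_cat_scheme \<Rightarrow> bool" where
  "AC2 C \<longleftrightarrow> (\<forall>e f g h e' f' g' h' a.
     extension C e f g h \<and> extension C e' f' g' h' \<and> a \<in> Hom C (Src C f) (Src C f') \<and>
     f' \<cdot>\<^bsub>C\<^esub> a = Zer C (Src C f) (Tgt C f') \<and> a \<cdot>\<^bsub>C\<^esub> e = Zer C (Src C e) (Src C f') \<longrightarrow>
     (\<exists>a' \<in> Hom C (Tgt C f) (Src C f'). a = a' \<cdot>\<^bsub>C\<^esub> f))"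

section \<open>Subcategories, conflations, injectives and projectives\<close>

text \<open>Full subcategories are given by their sets of objects.\<close>

definition additive_subcategory :: "('o, 'm, 'b) cat_scheme \<Rightarrow> 'o set \<Rightarrow> bool" where
  "additive_subcategory C Z \<longleftrightarrow> Z \<subseteq> Obj C \<and>
     (\<exists>N \<in> Z. zero_object C N) \<and>
     (\<forall>A \<in> Z. \<forall>B \<in> Z. \<exists>P \<in> Z. biproduct C A B P) \<and>
     (\<forall>A \<in> Z. \<forall>B \<in> Obj C. isomorphic C A B \<longrightarrow> B \<in> Z)"

definition summand_closed :: "('o, 'm, 'b) cat_scheme \<Rightarrow> 'o set \<Rightarrow> 'o set \<Rightarrow> bool" where
  "summand_closed C Z D \<longleftrightarrow>
     (\<forall>X \<in> D. \<forall>Z1 \<in> Z. \<forall>Z2 \<in> Z. \<forall>P.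
        biproduct C Z1 Z2 P \<and> isomorphic C X P \<longrightarrow> Z1 \<in> D \<and> Z2 \<in> D)"

definition extension_closed :: "('o, 'm, 'b) pt_cat_scheme \<Rightarrow> 'o set \<Rightarrow> bool" where
  "extension_closed C Z \<longleftrightarrow> (\<forall>e f g h.
     extension C e f g h \<and> Src C f \<in> Z \<and> Tgt C g \<in> Z \<longrightarrow> Tgt C f \<in> Z)"

definition conflation :: "('o, 'm, 'b) pt_cat_scheme \<Rightarrow> 'o set \<Rightarrow> 'm \<Rightarrow> 'm \<Rightarrow> 'm \<Rightarrow> 'm \<Rightarrow> bool" where
  "conflation C Z e f g h \<longleftrightarrow>
     extension C e f g h \<and> Src C f \<in> Z \<and> Tgt C f \<in> Z \<and> Tgt C g \<in> Z"

definition inflation :: "('o, 'm, 'b) pt_cat_scheme \<Rightarrow> 'o set \<Rightarrow> 'm \<Rightarrow> bool" where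
  "inflation C Z f \<longleftrightarrow> (\<exists>e g h. conflation C Z e f g h)"

definition deflation :: "('o, 'm, 'b) pt_cat_scheme \<Rightarrow> 'o set \<Rightarrow> 'm \<Rightarrow> bool" where
  "deflation C Z g \<longleftrightarrow> (\<exists>e f h. conflation C Z e f g h)"

definition injectives :: "('o, 'm, 'b) pt_cat_scheme \<Rightarrow> 'o set \<Rightarrow> 'o set \<Rightarrow> 'o set" where
  "injectives C Z D = {I \<in> D. \<forall>f. inflation C Z f \<longrightarrow>
     (\<lambda>y. y \<cdot>\<^bsub>C\<^esub> f) ` Hom C (Tgt C f) I = Hom C (Src C f) I}"

definition projectives :: "('o, 'm, 'b) pt_cat_scheme \<Rightarrow> 'o set \<Rightarrow> 'o set \<Rightarrow> 'o set" where
  "projectives C Z D = {P \<in> D. \<forall>g. deflation C Z g \<longrightarrow>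
     (\<lambda>y. g \<cdot>\<^bsub>C\<^esub> y) ` Hom C P (Src C g) = Hom C P (Tgt C g)}"

definition enough_injectives :: "('o, 'm, 'b) pt_cat_scheme \<Rightarrow> 'o set \<Rightarrow> 'o set \<Rightarrow> bool" where
  "enough_injectives C Z D \<longleftrightarrow>
     (\<forall>X \<in> Z. \<exists>f. inflation C Z f \<and> Src C f = X \<and> Tgt C f \<in> injectives C Z D)"

definition enough_projectives :: "('o, 'm, 'b) pt_cat_scheme \<Rightarrow> 'o set \<Rightarrow> 'o set \<Rightarrow> bool" where
  "enough_projectives C Z D \<longleftrightarrow>
     (\<forall>X \<in> Z. \<exists>g. deflation C Z g \<and> Tgt C g = X \<and> Src C g \<in> projectives C Z D)"

definition frobenius :: "('o, 'm, 'b) pt_cat_scheme \<Rightarrow> 'o set \<Rightarrow> 'o set \<Rightarrow> bool" where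
  "frobenius C Z D \<longleftrightarrow> enough_injectives C Z D \<and> enough_projectives C Z D \<and>
     injectives C Z D = projectives C Z D"

section \<open>The quotient category, its shift functor and its distinguished triangles\<close>

definition arrow_class :: "('o, 'm, 'b) cat_scheme \<Rightarrow> 'o set \<Rightarrow> 'm \<Rightarrow> 'm set" where
  "arrow_class C J f =
     {f' \<in> Hom C (Src C f) (Tgt C f). factors_through C J (f' \<boxplus>\<^bsub>C\<^esub> \<boxminus>\<^bsub>C\<^esub> f)}"

text \<open>The quotient of the full subcategory \<open>Z\<close> by the arrows factoring through objects of \<open>J\<close>.
  Operations on classes are unions over all representatives; such a union is again a single class
  exactly if the operation does not depend on the representatives.\<close>

definition quotient_category ::
    "('o, 'm, 'b) cat_scheme \<Rightarrow> 'o set \<Rightarrow> 'o set \<Rightarrow> ('o, 'm set) cat" where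
  "quotient_category C Z J =
     \<lparr>Obj = Z,
      Arr = arrow_class C J ` {f \<in> Arr C. Src C f \<in> Z \<and> Tgt C f \<in> Z},
      Src = (\<lambda>F. the_elem (Src C ` F)),
      Tgt = (\<lambda>F. the_elem (Tgt C ` F)),
      Idn = (\<lambda>A. arrow_class C J (Idn C A)),
      Comp = (\<lambda>G F. \<Union>g \<in> G. \<Union>f \<in> F. arrow_class C J (g \<cdot>\<^bsub>C\<^esub> f)),
      Plus = (\<lambda>F G. \<Union>f \<in> F. \<Union>g \<in> G. arrow_class C J (f \<boxplus>\<^bsub>C\<^esub> g)),
      Zer = (\<lambda>A B. arrow_class C J (Zer C A B))\<rparr>"

text \<open>The choices entering the construction of the shift: the conflations
  \<open>\<Omega>S\<^sub>X \<rightarrow> X \<rightarrow> I\<^sub>X \<rightarrow> S\<^sub>X \<rightarrow> \<Sigma>X\<close> with arrows \<open>sh_delta X\<close>, \<open>sh_alpha X\<close>, \<open>sh_beta X\<close>,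
  \<open>sh_gamma X\<close>, and the lifts \<open>I\<^sub>f = sh_I f\<close> and \<open>S\<^sub>f = sh_S f\<close>.\<close>

record ('o, 'm) shift_data =
  sh_delta :: "'o \<Rightarrow> 'm"
  sh_alpha :: "'o \<Rightarrow> 'm"
  sh_beta :: "'o \<Rightarrow> 'm"
  sh_gamma :: "'o \<Rightarrow> 'm"
  sh_I :: "'m \<Rightarrow> 'm"
  sh_S :: "'m \<Rightarrow> 'm"

definition shift_choice ::
    "('o, 'm, 'b) pt_cat_scheme \<Rightarrow> 'o set \<Rightarrow> 'o set \<Rightarrow> ('o, 'm) shift_data \<Rightarrow> bool" where
  "shift_choice C Z D s \<longleftrightarrow>
     (\<forall>X \<in> Z. conflation C Z (sh_delta s X) (sh_alpha s X) (sh_beta s X) (sh_gamma s X) \<and>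
        Src C (sh_alpha s X) = X \<and> Tgt C (sh_alpha s X) \<in> injectives C Z D) \<and>
     (\<forall>X \<in> Z. \<forall>Y \<in> Z. \<forall>f \<in> Hom C X Y.
        rmorphism C (Sig C) (f, sh_I s f, sh_S s f)
          (sh_alpha s X, sh_beta s X, sh_gamma s X)
          (sh_alpha s Y, sh_beta s Y, sh_gamma s Y))"

definition shift_functor ::
    "('o, 'm, 'b) pt_cat_scheme \<Rightarrow> 'o set \<Rightarrow> 'o set \<Rightarrow> ('o, 'm) shift_data \<Rightarrow> ('o, 'm set) endofun" where
  "shift_functor C Z D s =
     \<lparr>FOb = (\<lambda>X. Tgt C (sh_beta s X)),
      FAr = (\<lambda>F. \<Union>f \<in> F. arrow_class C (injectives C Z D) (sh_S s f))\<rparr>"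

definition standard_triangles ::
    "('o, 'm, 'b) pt_cat_scheme \<Rightarrow> 'o set \<Rightarrow> 'o set \<Rightarrow> ('o, 'm) shift_data \<Rightarrow>
      ('m set \<times> 'm set \<times> 'm set) set" where
  "standard_triangles C Z D s =
     {(arrow_class C (injectives C Z D) f, arrow_class C (injectives C Z D) g,
       arrow_class C (injectives C Z D) q) | e f g h p q X.
       conflation C Z e f g h \<and> X = Src C f \<and>
       p \<in> Hom C (Tgt C f) (Tgt C (sh_alpha s X)) \<and>
       q \<in> Hom C (Tgt C g) (Tgt C (sh_beta s X)) \<and>
       p \<cdot>\<^bsub>C\<^esub> f = sh_alpha s X \<and> q \<cdot>\<^bsub>C\<^esub> g = sh_beta s X \<cdot>\<^bsub>C\<^esub> p \<and>
       sh_gamma s X \<cdot>\<^bsub>C\<^esub> q = h}"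

definition distinguished_triangles ::
    "('o, 'm, 'b) pt_cat_scheme \<Rightarrow> 'o set \<Rightarrow> 'o set \<Rightarrow> ('o, 'm) shift_data \<Rightarrow>
      ('m set \<times> 'm set \<times> 'm set) set" where
  "distinguished_triangles C Z D s =
     {(u, v, w). rdiagram (quotient_category C Z (injectives C Z D)) (shift_functor C Z D s) u v w \<and>
       (\<exists>t \<in> standard_triangles C Z D s.
          risomorphic (quotient_category C Z (injectives C Z D)) (shift_functor C Z D s) (u, v, w) t)}"

section \<open>Triangulated categories\<close>

locale triangulated_category = additive_category C
  for C :: "('o, 'm, 'b) cat_scheme" (structure) +
  fixes S :: "('o, 'm) endofun" and T :: "('m \<times> 'm \<times> 'm) set"
  assumes shift_additive: "additive_endofunctor C S"
    and shift_equivalence: "autoequivalence C S"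
    and T_diagram: "(f, g, h) \<in> T \<Longrightarrow> rdiagram C S f g h"
    and TR1_iso: "(f, g, h) \<in> T \<Longrightarrow> rdiagram C S f' g' h' \<Longrightarrow>
      risomorphic C S (f, g, h) (f', g', h') \<Longrightarrow> (f', g', h') \<in> T"
    and TR1_id: "zero_object C N \<Longrightarrow> A \<in> Obj C \<Longrightarrow>
      (Idn C A, Zer C A N, Zer C N (FOb S A)) \<in> T"
    and TR1_ex: "f \<in> Arr C \<Longrightarrow> \<exists>g h. (f, g, h) \<in> T"
    and TR2: "rdiagram C S f g h \<Longrightarrow> (f, g, h) \<in> T \<longleftrightarrow> (g, h, \<boxminus> FAr S f) \<in> T"
    and TR3: "(f, g, h) \<in> T \<Longrightarrow> (f', g', h') \<in> T \<Longrightarrow>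
      a \<in> Hom C (Src C f) (Src C f') \<Longrightarrow> b \<in> Hom C (Tgt C f) (Tgt C f') \<Longrightarrow>
      b \<cdot> f = f' \<cdot> a \<Longrightarrow> \<exists>c. rmorphism C S (a, b, c) (f, g, h) (f', g', h')"
    and TR4: "(f, f1, f2) \<in> T \<Longrightarrow> (g, g1, g2) \<in> T \<Longrightarrow> Src C g = Tgt C f \<Longrightarrow>
      (g \<cdot> f, k1, k2) \<in> T \<Longrightarrow>
      \<exists>u \<in> Hom C (Tgt C f1) (Tgt C k1). \<exists>v \<in> Hom C (Tgt C k1) (Tgt C g1).
        (u, v, FAr S f1 \<cdot> g2) \<in> T \<and>
        u \<cdot> f1 = k1 \<cdot> g \<and> k2 \<cdot> u = f2 \<and> v \<cdot> k1 = g1 \<and> g2 \<cdot> v = FAr S f \<cdot> k2"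

end

theory Submission
  imports Defs
begin

text \<open>The octahedral axiom (RTR4), applied to extensions, yields extensions again, because the first
  arrow of the new triangle is \<open>\<Omega>\<close>-monic. It replaces push-outs: for a conflation
  \<open>X \<rightarrow> I\<^sub>X \<rightarrow> S\<^sub>X\<close> and \<open>f : X \<rightarrow> Y\<close>, the arrow \<open>X \<rightarrow> Y \<oplus> I\<^sub>X\<close> is an inflation, which gives cones in
  the quotient, and for a conflation \<open>X \<rightarrow> Y \<rightarrow> W\<close> it produces a conflation
  \<open>Y \<rightarrow> W \<oplus> I\<^sub>X \<rightarrow> S\<^sub>X\<close>, which rotates triangles. By (AC1), a morphism of conflations into one with
  injective middle term is determined by its first component up to arrows through injectives, so the
  quotient is right triangulated. By the dual statement, which rests on (AC2) and enough projectives,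
  the shift is an equivalence, and a right triangulation whose suspension is an equivalence is a
  triangulation.\<close>

section \<open>Additive categories\<close>

context category
begin

lemma Hom_iff [simp]: "f \<in> Hom C A B \<longleftrightarrow> f \<in> Arr C \<and> Src C f = A \<and> Tgt C f = B"
  by (simp add: Hom_def)

lemma Hom_objD:
  assumes "f \<in> Hom C A B"
  shows "A \<in> Obj C" and "B \<in> Obj C"
  using assms src_obj tgt_obj by auto

lemma arr_obj [simp]: "f \<in> Arr C \<Longrightarrow> Src C f \<in> Obj C" "f \<in> Arr C \<Longrightarrow> Tgt C f \<in> Obj C"
  by (rule src_obj tgt_obj; assumption)+

lemma comp_arr [simp]:
  assumes "f \<in> Arr C" "g \<in> Arr C" "Src C g = Tgt C f"
  shows "g \<cdot> f \<in> Arr C" "Src C (g \<cdot> f) = Src C f" "Tgt C (g \<cdot> f) = Tgt C g"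
  using comp_hom[of f "Src C f" "Tgt C f" g "Tgt C g"] assms by auto

lemma comp_assoc_arr [simp]:
  assumes "f \<in> Arr C" "g \<in> Arr C" "h \<in> Arr C" "Src C g = Tgt C f" "Src C h = Tgt C g"
  shows "(h \<cdot> g) \<cdot> f = h \<cdot> (g \<cdot> f)"
  using comp_assoc[of f "Src C f" "Tgt C f" g "Tgt C g" h "Tgt C h"] assms by auto

lemma comp_reassoc:
  assumes "g \<cdot> f = k" "x \<in> Arr C" "f \<in> Arr C" "g \<in> Arr C" "Src C f = Tgt C x" "Src C g = Tgt C f"
  shows "g \<cdot> (f \<cdot> x) = k \<cdot> x"
  using assms comp_assoc_arr[of x f g] by simp

lemma Idn_arr [simp]:
  assumes "A \<in> Obj C"
  shows "Idn C A \<in> Arr C" "Src C (Idn C A) = A" "Tgt C (Idn C A) = A"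
  using id_hom[OF assms] by auto

lemma comp_Idn [simp]:
  "f \<in> Arr C \<Longrightarrow> Src C f = A \<Longrightarrow> f \<cdot> Idn C A = f"
  "f \<in> Arr C \<Longrightarrow> Tgt C f = A \<Longrightarrow> Idn C A \<cdot> f = f"
  using comp_id_right[of f A "Tgt C f"] comp_id_left[of f "Src C f" A] by auto

lemma iso_arrowI:
  assumes "f \<in> Hom C A B" "g \<in> Hom C B A" "g \<cdot> f = Idn C A" "f \<cdot> g = Idn C B"
  shows "iso_arrow C f"
  using assms unfolding iso_arrow_def by auto

lemma iso_arrowE:
  assumes "iso_arrow C f" "f \<in> Hom C A B"
  obtains g where "g \<in> Hom C B A" "g \<cdot> f = Idn C A" "f \<cdot> g = Idn C B" "iso_arrow C g"
proof -
  obtain g where g_inverse: "g \<in> Hom C B A" "g \<cdot> f = Idn C A" "f \<cdot> g = Idn C B"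
    using assms unfolding iso_arrow_def by auto
  with assms(2) have "iso_arrow C g" by (intro iso_arrowI[of g B A f])
  with g_inverse that show thesis by blast
qed

lemma iso_arrow_Idn [simp]: "A \<in> Obj C \<Longrightarrow> iso_arrow C (Idn C A)"
  by (rule iso_arrowI[of _ A A "Idn C A"]) auto

lemma iso_arrow_comp:
  assumes f_iso: "f \<in> Hom C A B" "iso_arrow C f" and g_iso: "g \<in> Hom C B D" "iso_arrow C g"
  shows "iso_arrow C (g \<cdot> f)"
proof -
  obtain f' where f'_inverse: "f' \<in> Hom C B A" "f' \<cdot> f = Idn C A" "f \<cdot> f' = Idn C B"
    using iso_arrowE[OF f_iso(2,1)] by blast
  obtain g' where g'_inverse: "g' \<in> Hom C D B" "g' \<cdot> g = Idn C B" "g \<cdot> g' = Idn C D"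
    using iso_arrowE[OF g_iso(2,1)] by blast
  have "f' \<cdot> g' \<cdot> g \<cdot> f = Idn C A"
    using f_iso g_iso f'_inverse g'_inverse by (simp add: comp_reassoc[OF g'_inverse(2)])
  moreover have "g \<cdot> f \<cdot> f' \<cdot> g' = Idn C D"
    using f_iso g_iso f'_inverse g'_inverse by (simp add: comp_reassoc[OF f'_inverse(3)])
  ultimately show ?thesis
    using f_iso g_iso f'_inverse g'_inverse by (intro iso_arrowI[of _ A D "f' \<cdot> g'"]) auto
qed

lemma iso_arrow_of_one_sided_inverses:
  assumes "f \<in> Hom C A B" "g \<in> Hom C B A" "k \<in> Hom C B A"
    and "g \<cdot> f = Idn C A" "f \<cdot> k = Idn C B"
  shows "iso_arrow C f"
proof -
  have "g = g \<cdot> (f \<cdot> k)" using assms by simp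
  also have "\<dots> = (g \<cdot> f) \<cdot> k" using assms(1-3) by simp
  also have "\<dots> = k" using assms by simp
  finally show ?thesis using assms by (intro iso_arrowI[of f A B g]) auto
qed

lemma iso_arrow_of_iso_comps:
  assumes f_hom: "f \<in> Hom C A B" and g_hom: "g \<in> Hom C B A"
    and "iso_arrow C (g \<cdot> f)" "iso_arrow C (f \<cdot> g)"
  shows "iso_arrow C f"
proof -
  obtain u where u_left_inverse: "u \<in> Hom C A A" "u \<cdot> (g \<cdot> f) = Idn C A"
    using iso_arrowE[OF assms(3), of A A] f_hom g_hom by auto
  obtain v where v_right_inverse: "v \<in> Hom C B B" "(f \<cdot> g) \<cdot> v = Idn C B"
    using iso_arrowE[OF assms(4), of B B] f_hom g_hom by auto
  show ?thesis
    using f_hom g_hom u_left_inverse v_right_inverse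
    by (intro iso_arrow_of_one_sided_inverses[of f A B "u \<cdot> g" "g \<cdot> v"]) auto
qed

lemma iso_arrow_cancel_left:
  assumes f_iso: "iso_arrow C f" "f \<in> Hom C B D"
    and "x \<in> Hom C A B" "y \<in> Hom C A B" and comp_eq: "f \<cdot> x = f \<cdot> y"
  shows "x = y"
proof -
  obtain f' where f'_left_inverse: "f' \<in> Hom C D B" "f' \<cdot> f = Idn C B"
    using iso_arrowE[OF f_iso] by blast
  have "x = f' \<cdot> (f \<cdot> x)" using f'_left_inverse f_iso(2) assms(3)
    by (simp add: comp_reassoc[OF f'_left_inverse(2)])
  also have "\<dots> = y" using f'_left_inverse f_iso(2) assms(4)
    by (simp add: comp_eq comp_reassoc[OF f'_left_inverse(2)])
  finally show ?thesis .
qed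

lemma iso_arrow_lift:
  assumes f_iso: "iso_arrow C f" "f \<in> Hom C B D" and x_hom: "x \<in> Hom C A D"
  obtains y where "y \<in> Hom C A B" "f \<cdot> y = x"
proof -
  obtain f' where f'_right_inverse: "f' \<in> Hom C D B" "f \<cdot> f' = Idn C D"
    using iso_arrowE[OF f_iso] by blast
  then show thesis
    using that[of "f' \<cdot> x"] f_iso(2) x_hom by (simp add: comp_reassoc[OF f'_right_inverse(2)])
qed

lemma commuting_triangle_transfer:
  assumes "f \<in> Hom C A B" "g \<in> Hom C B D" "k \<in> Hom C A D"
    and "f' \<in> Hom C A' B'" "g' \<in> Hom C B' D'" "k' \<in> Hom C A' D'"
    and "a \<in> Hom C A A'" "b \<in> Hom C B B'" and d_iso: "d \<in> Hom C D D'" "iso_arrow C d"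
    and squares: "b \<cdot> f = f' \<cdot> a" "d \<cdot> g = g' \<cdot> b" "d \<cdot> k = k' \<cdot> a" and triangle: "g' \<cdot> f' = k'"
  shows "g \<cdot> f = k"
proof (rule iso_arrow_cancel_left[OF d_iso(2,1)])
  show "d \<cdot> (g \<cdot> f) = d \<cdot> k"
    using assms(1-9) by (simp add: squares squares(2)[THEN comp_reassoc]
        triangle[THEN comp_reassoc])
qed (use assms in auto)

lemma commuting_square_inverse:
  assumes "f \<in> Hom C A B" "f' \<in> Hom C A' B'" "a \<in> Hom C A A'" "a' \<in> Hom C A' A"
    "b \<in> Hom C B B'" "b' \<in> Hom C B' B"
    and square: "b \<cdot> f = f' \<cdot> a" and inverses: "a \<cdot> a' = Idn C A'" "b' \<cdot> b = Idn C B"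
  shows "b' \<cdot> f' = f \<cdot> a'"
proof -
  have "b' \<cdot> f' = b' \<cdot> f' \<cdot> a \<cdot> a'" using assms(1-6) by (simp add: inverses(1))
  also have "\<dots> = b' \<cdot> b \<cdot> f \<cdot> a'"
    using assms(1-6) by (simp add: square[symmetric, THEN comp_reassoc])
  also have "\<dots> = f \<cdot> a'" using assms(1-6) by (simp add: inverses(2)[THEN comp_reassoc])
  finally show ?thesis .
qed

end

context preadditive_category
begin

lemma comm_group_hom: "f \<in> Arr C \<Longrightarrow> comm_group (hom_group C (Src C f) (Tgt C f))"
  by (simp add: hom_comm_group)

lemma Zer_arr [simp]:
  assumes "A \<in> Obj C" "B \<in> Obj C"
  shows "Zer C A B \<in> Arr C" "Src C (Zer C A B) = A" "Tgt C (Zer C A B) = B"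
proof -
  interpret comm_group "hom_group C A B" using hom_comm_group assms .
  show "Zer C A B \<in> Arr C" "Src C (Zer C A B) = A" "Tgt C (Zer C A B) = B"
    using one_closed by (auto simp: hom_group_def)
qed

lemma Plus_arr [simp]:
  assumes "f \<in> Arr C" "g \<in> Arr C" "Src C g = Src C f" "Tgt C g = Tgt C f"
  shows "f \<boxplus> g \<in> Arr C" "Src C (f \<boxplus> g) = Src C f" "Tgt C (f \<boxplus> g) = Tgt C f"
proof -
  interpret comm_group "hom_group C (Src C f) (Tgt C f)" using comm_group_hom assms(1) .
  show "f \<boxplus> g \<in> Arr C" "Src C (f \<boxplus> g) = Src C f" "Tgt C (f \<boxplus> g) = Tgt C f"
    using m_closed[of f g] assms by (auto simp: hom_group_def)
qed

lemma Neg_arr [simp]: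
  assumes "f \<in> Arr C"
  shows "\<boxminus> f \<in> Arr C" "Src C (\<boxminus> f) = Src C f" "Tgt C (\<boxminus> f) = Tgt C f"
proof -
  interpret comm_group "hom_group C (Src C f) (Tgt C f)" using comm_group_hom assms(1) .
  show "\<boxminus> f \<in> Arr C" "Src C (\<boxminus> f) = Src C f" "Tgt C (\<boxminus> f) = Tgt C f"
    using inv_closed[of f] assms by (auto simp: hom_group_def Neg_def)
qed

lemma Plus_assoc [simp]:
  assumes "f \<in> Arr C" "g \<in> Arr C" "h \<in> Arr C" "Src C g = Src C f" "Tgt C g = Tgt C f"
    "Src C h = Src C f" "Tgt C h = Tgt C f"
  shows "(f \<boxplus> g) \<boxplus> h = f \<boxplus> (g \<boxplus> h)"
proof -
  interpret comm_group "hom_group C (Src C f) (Tgt C f)" using comm_group_hom assms(1) .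
  show ?thesis using m_assoc[of f g h] assms by (auto simp: hom_group_def)
qed

lemma Plus_comm:
  assumes "f \<in> Arr C" "g \<in> Arr C" "Src C g = Src C f" "Tgt C g = Tgt C f"
  shows "f \<boxplus> g = g \<boxplus> f"
proof -
  interpret comm_group "hom_group C (Src C f) (Tgt C f)" using comm_group_hom assms(1) .
  show ?thesis using m_comm[of f g] assms by (auto simp: hom_group_def)
qed

lemma Plus_left_comm:
  assumes "f \<in> Arr C" "g \<in> Arr C" "h \<in> Arr C" "Src C g = Src C f" "Tgt C g = Tgt C f"
    "Src C h = Src C f" "Tgt C h = Tgt C f"
  shows "f \<boxplus> (g \<boxplus> h) = g \<boxplus> (f \<boxplus> h)"
  using assms Plus_comm[of f g] Plus_assoc[of f g h] Plus_assoc[of g f h] by simp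

lemma Plus_Zer [simp]:
  assumes "f \<in> Arr C" "Src C f = A" "Tgt C f = B"
  shows "f \<boxplus> Zer C A B = f" "Zer C A B \<boxplus> f = f"
proof -
  interpret comm_group "hom_group C (Src C f) (Tgt C f)" using comm_group_hom assms(1) .
  show "f \<boxplus> Zer C A B = f" "Zer C A B \<boxplus> f = f"
    using r_one[of f] l_one[of f] assms by (auto simp: hom_group_def)
qed

lemma Plus_Neg [simp]:
  assumes "f \<in> Arr C"
  shows "f \<boxplus> \<boxminus> f = Zer C (Src C f) (Tgt C f)" "\<boxminus> f \<boxplus> f = Zer C (Src C f) (Tgt C f)"
proof -
  interpret comm_group "hom_group C (Src C f) (Tgt C f)" using comm_group_hom assms(1) .
  show "f \<boxplus> \<boxminus> f = Zer C (Src C f) (Tgt C f)" "\<boxminus> f \<boxplus> f = Zer C (Src C f) (Tgt C f)"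
    using r_inv[of f] l_inv[of f] assms by (auto simp: hom_group_def Neg_def)
qed

lemma Plus_Neg_left [simp]:
  assumes "f \<in> Arr C" "g \<in> Arr C" "Src C g = Src C f" "Tgt C g = Tgt C f"
  shows "f \<boxplus> (\<boxminus> f \<boxplus> g) = g" "\<boxminus> f \<boxplus> (f \<boxplus> g) = g"
  using assms Plus_assoc[of f "\<boxminus> f" g] Plus_assoc[of "\<boxminus> f" f g] by auto

lemma Neg_unique:
  assumes "f \<in> Arr C" "g \<in> Arr C" "Src C g = Src C f" "Tgt C g = Tgt C f"
    and "f \<boxplus> g = Zer C (Src C f) (Tgt C f)"
  shows "g = \<boxminus> f"
proof -
  have "g = \<boxminus> f \<boxplus> (f \<boxplus> g)" using assms(1-4) by simp
  also have "\<dots> = \<boxminus> f" using assms by simp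
  finally show ?thesis .
qed

lemma Neg_Neg [simp]: "f \<in> Arr C \<Longrightarrow> \<boxminus> (\<boxminus> f) = f"
  by (rule Neg_unique[symmetric]) auto

lemma Neg_Zer [simp]: "A \<in> Obj C \<Longrightarrow> B \<in> Obj C \<Longrightarrow> \<boxminus> Zer C A B = Zer C A B"
  by (rule Neg_unique[symmetric]) auto

lemma Neg_Plus [simp]:
  assumes "f \<in> Arr C" "g \<in> Arr C" "Src C g = Src C f" "Tgt C g = Tgt C f"
  shows "\<boxminus> (f \<boxplus> g) = \<boxminus> f \<boxplus> \<boxminus> g"
proof (rule Neg_unique[symmetric])
  have "(f \<boxplus> g) \<boxplus> (\<boxminus> f \<boxplus> \<boxminus> g) = g \<boxplus> (f \<boxplus> (\<boxminus> f \<boxplus> \<boxminus> g))"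
    using assms by (simp add: Plus_left_comm[of f g])
  then show "(f \<boxplus> g) \<boxplus> (\<boxminus> f \<boxplus> \<boxminus> g) = Zer C (Src C (f \<boxplus> g)) (Tgt C (f \<boxplus> g))"
    using assms by simp
qed (use assms in auto)

lemma Neg_eq_iff: "f \<in> Arr C \<Longrightarrow> g \<in> Arr C \<Longrightarrow> \<boxminus> f = \<boxminus> g \<longleftrightarrow> f = g"
  by (metis Neg_Neg)

lemma eq_if_diff_Zer:
  assumes "f \<in> Hom C A B" "g \<in> Hom C A B" "f \<boxplus> \<boxminus> g = Zer C A B"
  shows "f = g"
  using Neg_unique[of f "\<boxminus> g"] assms by (simp add: Neg_eq_iff)

lemma eq_Plus_if_diff_eq:
  assumes "f \<in> Hom C A B" "g \<in> Hom C A B" "h \<in> Hom C A B" and diff: "f \<boxplus> \<boxminus> g = h"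
  shows "f = g \<boxplus> h"
proof -
  have "g \<boxplus> h = f \<boxplus> (g \<boxplus> \<boxminus> g)"
    using assms(1-3) Plus_left_comm[of f g "\<boxminus> g"] by (simp add: diff[symmetric])
  then show ?thesis using assms by simp
qed

lemma comp_Plus [simp]:
  assumes "f \<in> Arr C" "g \<in> Arr C" "Src C g = Src C f" "Tgt C g = Tgt C f"
  shows "h \<in> Arr C \<Longrightarrow> Src C h = Tgt C f \<Longrightarrow> h \<cdot> (f \<boxplus> g) = h \<cdot> f \<boxplus> h \<cdot> g"
    "k \<in> Arr C \<Longrightarrow> Tgt C k = Src C f \<Longrightarrow> (f \<boxplus> g) \<cdot> k = f \<cdot> k \<boxplus> g \<cdot> k"
  using comp_plus_right[of f "Src C f" "Tgt C f" g h "Tgt C h"]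
    comp_plus_left[of k "Src C k" "Tgt C k" f "Tgt C f" g] assms by auto

lemma Zer_if_Plus_idem:
  assumes "f \<in> Arr C" "f \<boxplus> f = f"
  shows "f = Zer C (Src C f) (Tgt C f)"
  using assms Plus_Neg_left(2)[of f f] by simp

lemma comp_Zer [simp]:
  assumes "A \<in> Obj C" "B \<in> Obj C" "f \<in> Arr C"
  shows "Src C f = B \<Longrightarrow> f \<cdot> Zer C A B = Zer C A (Tgt C f)"
    "Tgt C f = A \<Longrightarrow> Zer C A B \<cdot> f = Zer C (Src C f) B"
proof -
  show "f \<cdot> Zer C A B = Zer C A (Tgt C f)" if "Src C f = B"
    using Zer_if_Plus_idem[of "f \<cdot> Zer C A B"] comp_Plus(1)[of "Zer C A B" "Zer C A B" f] that assms
    by simp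
  show "Zer C A B \<cdot> f = Zer C (Src C f) B" if "Tgt C f = A"
    using Zer_if_Plus_idem[of "Zer C A B \<cdot> f"] comp_Plus(2)[of "Zer C A B" "Zer C A B" f] that assms
    by simp
qed

lemma comp_Neg [simp]:
  assumes "f \<in> Arr C" "g \<in> Arr C" "Src C g = Tgt C f"
  shows "g \<cdot> \<boxminus> f = \<boxminus> (g \<cdot> f)" "\<boxminus> g \<cdot> f = \<boxminus> (g \<cdot> f)"
proof -
  show "g \<cdot> \<boxminus> f = \<boxminus> (g \<cdot> f)"
    using assms comp_Plus(1)[of f "\<boxminus> f" g] by (intro Neg_unique) auto
  show "\<boxminus> g \<cdot> f = \<boxminus> (g \<cdot> f)"
  proof (rule Neg_unique)
    have "g \<cdot> f \<boxplus> \<boxminus> g \<cdot> f = (g \<boxplus> \<boxminus> g) \<cdot> f"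
      using assms by (intro comp_Plus(2)[symmetric]) auto
    also have "\<dots> = Zer C (Src C (g \<cdot> f)) (Tgt C (g \<cdot> f))"
      using assms(1,2) by (simp only: Plus_Neg) (simp add: assms(3))
    finally show "g \<cdot> f \<boxplus> \<boxminus> g \<cdot> f = Zer C (Src C (g \<cdot> f)) (Tgt C (g \<cdot> f))" .
  qed (use assms in auto)
qed

lemma iso_arrow_Idn_Plus_nilpotent:
  assumes n_hom: "n \<in> Hom C A A" and nilpotent: "n \<cdot> n = Zer C A A"
  shows "iso_arrow C (Idn C A \<boxplus> n)"
proof (rule iso_arrowI)
  have A_obj: "A \<in> Obj C" using Hom_objD n_hom by blast
  show "Idn C A \<boxplus> n \<in> Hom C A A" "Idn C A \<boxplus> \<boxminus> n \<in> Hom C A A" using n_hom A_obj by auto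
  show "(Idn C A \<boxplus> \<boxminus> n) \<cdot> (Idn C A \<boxplus> n) = Idn C A" "(Idn C A \<boxplus> n) \<cdot> (Idn C A \<boxplus> \<boxminus> n) = Idn C A"
    using n_hom nilpotent A_obj by auto
qed

lemma zero_object_iff: "zero_object C N \<longleftrightarrow> N \<in> Obj C \<and> Idn C N = Zer C N N"
proof
  assume N_zero: "zero_object C N"
  then have "N \<in> Obj C" "\<exists>!f. f \<in> Hom C N N" by (auto simp: zero_object_def)
  moreover have "Idn C N \<in> Hom C N N" "Zer C N N \<in> Hom C N N" using \<open>N \<in> Obj C\<close> by auto
  ultimately show "N \<in> Obj C \<and> Idn C N = Zer C N N" by blast
next
  assume N_zero: "N \<in> Obj C \<and> Idn C N = Zer C N N"
  have "f = Zer C N A" if "f \<in> Hom C N A" for f A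
    using comp_id_right[OF that] N_zero that Hom_objD[OF that] by simp
  moreover have "f = Zer C A N" if "f \<in> Hom C A N" for f A
    using comp_id_left[OF that] N_zero that Hom_objD[OF that] by simp
  moreover have "Zer C N A \<in> Hom C N A" "Zer C A N \<in> Hom C A N" if "A \<in> Obj C" for A
    using N_zero that by auto
  ultimately show "zero_object C N" unfolding zero_object_def using N_zero by blast
qed

lemma arrow_to_zero_object:
  "zero_object C N \<Longrightarrow> f \<in> Arr C \<Longrightarrow> Tgt C f = N \<Longrightarrow> f = Zer C (Src C f) N"
  using comp_id_left[of f "Src C f" N] comp_Zer(2)[of N N f] by (auto simp: zero_object_iff)

lemma iso_arrow_zero_objects:
  assumes "zero_object C N" "zero_object C N'"
  shows "iso_arrow C (Zer C N N')"
  using assms by (intro iso_arrowI[of _ N N' "Zer C N' N"]) (auto simp: zero_object_iff)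

end

definition biproduct_arrows ::
    "('o, 'm, 'b) cat_scheme \<Rightarrow> 'o \<Rightarrow> 'o \<Rightarrow> 'o \<Rightarrow> 'm \<Rightarrow> 'm \<Rightarrow> 'm \<Rightarrow> 'm \<Rightarrow> bool" where
  "biproduct_arrows C A B P i j p q \<longleftrightarrow>
     i \<in> Hom C A P \<and> j \<in> Hom C B P \<and> p \<in> Hom C P A \<and> q \<in> Hom C P B \<and>
     p \<cdot>\<^bsub>C\<^esub> i = Idn C A \<and> q \<cdot>\<^bsub>C\<^esub> j = Idn C B \<and>
     q \<cdot>\<^bsub>C\<^esub> i = Zer C A B \<and> p \<cdot>\<^bsub>C\<^esub> j = Zer C B A \<and>
     i \<cdot>\<^bsub>C\<^esub> p \<boxplus>\<^bsub>C\<^esub> j \<cdot>\<^bsub>C\<^esub> q = Idn C P"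

context preadditive_category
begin

lemma biproduct_iff: "biproduct C A B P \<longleftrightarrow> (\<exists>i j p q. biproduct_arrows C A B P i j p q)"
proof
  assume "biproduct C A B P"
  then show "\<exists>i j p q. biproduct_arrows C A B P i j p q"
    unfolding biproduct_def biproduct_arrows_def by blast
next
  assume "\<exists>i j p q. biproduct_arrows C A B P i j p q"
  then obtain i j p q where P_biproduct: "biproduct_arrows C A B P i j p q" by blast
  then have "A \<in> Obj C" "B \<in> Obj C" "P \<in> Obj C"
    using Hom_objD[of i A P] Hom_objD[of j B P] unfolding biproduct_arrows_def by blast+
  then show "biproduct C A B P"
    using P_biproduct unfolding biproduct_arrows_def biproduct_def by blast
qed

lemma biproduct_arrows_arr:
  assumes "biproduct_arrows C A B P i j p q"
  shows "i \<in> Arr C" "Src C i = A" "Tgt C i = P" "j \<in> Arr C" "Src C j = B" "Tgt C j = P"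
    "p \<in> Arr C" "Src C p = P" "Tgt C p = A" "q \<in> Arr C" "Src C q = P" "Tgt C q = B"
    "A \<in> Obj C" "B \<in> Obj C" "P \<in> Obj C"
  using assms arr_obj unfolding biproduct_arrows_def by auto

lemma biproduct_arrows_sum: "biproduct_arrows C A B P i j p q \<Longrightarrow> i \<cdot> p \<boxplus> j \<cdot> q = Idn C P"
  by (simp add: biproduct_arrows_def)

lemma biproduct_arrows_comp:
  assumes P_biproduct: "biproduct_arrows C A B P i j p q"
  shows "p \<cdot> i = Idn C A" "q \<cdot> j = Idn C B" "q \<cdot> i = Zer C A B" "p \<cdot> j = Zer C B A"
    and "x \<in> Arr C \<Longrightarrow> Tgt C x = A \<Longrightarrow> p \<cdot> i \<cdot> x = x"
    and "x \<in> Arr C \<Longrightarrow> Tgt C x = B \<Longrightarrow> q \<cdot> j \<cdot> x = x"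
    and "x \<in> Arr C \<Longrightarrow> Tgt C x = A \<Longrightarrow> q \<cdot> i \<cdot> x = Zer C (Src C x) B"
    and "x \<in> Arr C \<Longrightarrow> Tgt C x = B \<Longrightarrow> p \<cdot> j \<cdot> x = Zer C (Src C x) A"
proof -
  show comps: "p \<cdot> i = Idn C A" "q \<cdot> j = Idn C B" "q \<cdot> i = Zer C A B" "p \<cdot> j = Zer C B A"
    using P_biproduct by (auto simp: biproduct_arrows_def)
  note ij_arr = biproduct_arrows_arr[OF P_biproduct]
  show "x \<in> Arr C \<Longrightarrow> Tgt C x = A \<Longrightarrow> p \<cdot> i \<cdot> x = x"
    "x \<in> Arr C \<Longrightarrow> Tgt C x = B \<Longrightarrow> q \<cdot> j \<cdot> x = x"
    "x \<in> Arr C \<Longrightarrow> Tgt C x = A \<Longrightarrow> q \<cdot> i \<cdot> x = Zer C (Src C x) B"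
    "x \<in> Arr C \<Longrightarrow> Tgt C x = B \<Longrightarrow> p \<cdot> j \<cdot> x = Zer C (Src C x) A"
    using ij_arr by (simp_all add: comps[THEN comp_reassoc])
qed

lemma biproduct_arrows_swap:
  assumes P_biproduct: "biproduct_arrows C A B P i j p q"
  shows "biproduct_arrows C B A P j i q p"
  using biproduct_arrows_arr[OF P_biproduct] biproduct_arrows_sum[OF P_biproduct]
    biproduct_arrows_comp[OF P_biproduct]
    Plus_comm[of "i \<cdot> p" "j \<cdot> q"]
  by (simp add: biproduct_arrows_def)

lemma biproduct_iso:
  assumes P_biproduct: "biproduct_arrows C A B P i j p q"
    and P'_biproduct: "biproduct_arrows C A B P' i' j' p' q'"
  shows "iso_arrow C (i' \<cdot> p \<boxplus> j' \<cdot> q)"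
proof -
  note arr = biproduct_arrows_arr[OF P_biproduct] biproduct_arrows_arr[OF P'_biproduct]
  show ?thesis
  proof (rule iso_arrowI[of _ P P' "i \<cdot> p' \<boxplus> j \<cdot> q'"])
    show "(i \<cdot> p' \<boxplus> j \<cdot> q') \<cdot> (i' \<cdot> p \<boxplus> j' \<cdot> q) = Idn C P"
      using arr by (simp add: biproduct_arrows_comp[OF P'_biproduct]
          biproduct_arrows_sum[OF P_biproduct])
    show "(i' \<cdot> p \<boxplus> j' \<cdot> q) \<cdot> (i \<cdot> p' \<boxplus> j \<cdot> q') = Idn C P'"
      using arr by (simp add: biproduct_arrows_comp[OF P_biproduct]
          biproduct_arrows_sum[OF P'_biproduct])
  qed (use arr in auto)
qed

lemma biproduct_complement_comp:
  assumes P_biproduct: "biproduct_arrows C A B P i j p q"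
    and complement_biproduct: "biproduct_arrows C A D P i k p g"
  shows "(q \<cdot> k) \<cdot> g = q"
proof -
  note arr = biproduct_arrows_arr[OF P_biproduct] biproduct_arrows_arr[OF complement_biproduct]
  have "q = q \<cdot> (i \<cdot> p \<boxplus> k \<cdot> g)"
    using arr by (simp add: biproduct_arrows_sum[OF complement_biproduct])
  also have "\<dots> = (q \<cdot> k) \<cdot> g" using arr by (simp add: biproduct_arrows_comp[OF P_biproduct])
  finally show ?thesis by simp
qed

lemma biproduct_complement_iso:
  assumes P_biproduct: "biproduct_arrows C A B P i j p q"
    and complement_biproduct: "biproduct_arrows C A D P i k p g"
  shows "iso_arrow C (q \<cdot> k)"
proof (rule iso_arrowI[of _ D B "g \<cdot> j"])
  note arr = biproduct_arrows_arr[OF P_biproduct] biproduct_arrows_arr[OF complement_biproduct]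
  show "(g \<cdot> j) \<cdot> (q \<cdot> k) = Idn C D"
    using arr arg_cong[OF biproduct_complement_comp[OF complement_biproduct P_biproduct],
        of "\<lambda>x. x \<cdot> k"]
    by (simp add: biproduct_arrows_comp[OF complement_biproduct])
  show "(q \<cdot> k) \<cdot> (g \<cdot> j) = Idn C B"
    using arr arg_cong[OF biproduct_complement_comp[OF P_biproduct complement_biproduct],
        of "\<lambda>x. x \<cdot> j"]
    by (simp add: biproduct_arrows_comp[OF P_biproduct])
  show "q \<cdot> k \<in> Hom C D B" "g \<cdot> j \<in> Hom C B D" using arr by auto
qed

lemma factors_throughI:
  assumes "X \<in> J" "u \<in> Hom C A X" "v \<in> Hom C X B" "f = v \<cdot> u"
  shows "factors_through C J f"
proof -
  have f_hom: "f \<in> Arr C" "Src C f = A" "Tgt C f = B" using assms by auto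
  show ?thesis unfolding factors_through_def f_hom(2,3) using assms f_hom(1) by blast
qed

lemma factors_throughE:
  assumes "factors_through C J f" "f \<in> Hom C A B"
  obtains X u v where "X \<in> J" "u \<in> Hom C A X" "v \<in> Hom C X B" "f = v \<cdot> u"
proof -
  have f_hom: "Src C f = A" "Tgt C f = B" using assms(2) by auto
  show thesis using assms(1) that unfolding factors_through_def f_hom by blast
qed

lemma factors_through_comp:
  assumes "factors_through C J f"
  shows "g \<in> Arr C \<Longrightarrow> Src C g = Tgt C f \<Longrightarrow> factors_through C J (g \<cdot> f)"
    and "k \<in> Arr C \<Longrightarrow> Tgt C k = Src C f \<Longrightarrow> factors_through C J (f \<cdot> k)"
proof -
  obtain X u v where X_in_J: "X \<in> J" and u_hom: "u \<in> Hom C (Src C f) X"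
    and v_hom: "v \<in> Hom C X (Tgt C f)"
    and f_eq: "f = v \<cdot> u"
    using assms unfolding factors_through_def by blast
  show "factors_through C J (g \<cdot> f)" if "g \<in> Arr C" "Src C g = Tgt C f"
    using u_hom v_hom that
    by (intro factors_throughI[OF X_in_J u_hom, of "g \<cdot> v" "Tgt C g"])
      (simp_all add: f_eq[symmetric])
  show "factors_through C J (f \<cdot> k)" if "k \<in> Arr C" "Tgt C k = Src C f"
    using u_hom v_hom that by (intro factors_throughI[OF X_in_J _ v_hom, of "u \<cdot> k" "Src C k"])
      (simp_all add: f_eq[symmetric, THEN comp_reassoc])
qed

lemma factors_through_Neg:
  assumes f_factors: "factors_through C J f"
  shows "factors_through C J (\<boxminus> f)"
proof -
  have f_arr: "f \<in> Arr C" using f_factors by (simp add: factors_through_def)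
  then have "\<boxminus> f = \<boxminus> Idn C (Tgt C f) \<cdot> f" by simp
  then show ?thesis using factors_through_comp(1)[OF f_factors, of "\<boxminus> Idn C (Tgt C f)"] f_arr
    by simp
qed

lemma factors_through_Plus:
  assumes closed: "\<And>X Y. X \<in> J \<Longrightarrow> Y \<in> J \<Longrightarrow> \<exists>P \<in> J. biproduct C X Y P"
    and f_factors: "factors_through C J f" and g_factors: "factors_through C J g"
    and parallel: "Src C g = Src C f" "Tgt C g = Tgt C f"
  shows "factors_through C J (f \<boxplus> g)"
proof -
  obtain X u v where f_eq: "X \<in> J" "u \<in> Hom C (Src C f) X" "v \<in> Hom C X (Tgt C f)" "f = v \<cdot> u"
    using f_factors unfolding factors_through_def by blast
  obtain Y u' v' where g_eq: "Y \<in> J" "u' \<in> Hom C (Src C f) Y" "v' \<in> Hom C Y (Tgt C f)" "g = v' \<cdot> u'"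
    using g_factors unfolding factors_through_def parallel by blast
  obtain P i j p q where P_in_J: "P \<in> J" and P_biproduct: "biproduct_arrows C X Y P i j p q"
    using closed f_eq(1) g_eq(1) unfolding biproduct_iff by blast
  note arr = biproduct_arrows_arr[OF P_biproduct] f_eq(2,3) g_eq(2,3)
  show ?thesis
  proof (rule factors_throughI[OF P_in_J])
    show "i \<cdot> u \<boxplus> j \<cdot> u' \<in> Hom C (Src C f) P" "v \<cdot> p \<boxplus> v' \<cdot> q \<in> Hom C P (Tgt C f)"
      using arr by auto
    have "(v \<cdot> p \<boxplus> v' \<cdot> q) \<cdot> (i \<cdot> u \<boxplus> j \<cdot> u') = v \<cdot> u \<boxplus> v' \<cdot> u'"
      using arr Hom_objD[OF f_eq(2)] Hom_objD[OF f_eq(3)]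
      by (simp add: biproduct_arrows_comp[OF P_biproduct])
    then show "f \<boxplus> g = (v \<cdot> p \<boxplus> v' \<cdot> q) \<cdot> (i \<cdot> u \<boxplus> j \<cdot> u')" using f_eq(4) g_eq(4) by simp
  qed
qed

end

section \<open>Endofunctors and morphisms of triangles\<close>

lemma naturally_isomorphicI:
  assumes "\<And>A. A \<in> Obj C \<Longrightarrow> \<eta> A \<in> Hom C (FOb F A) (FOb G A)"
    and "\<And>A. A \<in> Obj C \<Longrightarrow> iso_arrow C (\<eta> A)"
    and "\<And>f. f \<in> Arr C \<Longrightarrow> \<eta> (Tgt C f) \<cdot>\<^bsub>C\<^esub> FAr F f = FAr G f \<cdot>\<^bsub>C\<^esub> \<eta> (Src C f)"
  shows "naturally_isomorphic C F G"
  using assms unfolding naturally_isomorphic_def by blast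

locale fully_faithful_essentially_surjective = category C
  for C :: "('o, 'm, 'b) cat_scheme" (structure) +
  fixes F :: "('o, 'm) endofun"
  assumes functorial: "endofunctor C F"
    and full: "A \<in> Obj C \<Longrightarrow> B \<in> Obj C \<Longrightarrow> k \<in> Hom C (FOb F A) (FOb F B) \<Longrightarrow>
      \<exists>f \<in> Hom C A B. FAr F f = k"
    and faithful: "f \<in> Hom C A B \<Longrightarrow> g \<in> Hom C A B \<Longrightarrow> FAr F f = FAr F g \<Longrightarrow> f = g"
    and essentially_surjective: "B \<in> Obj C \<Longrightarrow> \<exists>A \<in> Obj C. isomorphic C (FOb F A) B"
begin

lemma functor_simps [simp]:
  "A \<in> Obj C \<Longrightarrow> FOb F A \<in> Obj C"
  "f \<in> Arr C \<Longrightarrow> FAr F f \<in> Arr C"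
  "f \<in> Arr C \<Longrightarrow> Src C (FAr F f) = FOb F (Src C f)"
  "f \<in> Arr C \<Longrightarrow> Tgt C (FAr F f) = FOb F (Tgt C f)"
  "A \<in> Obj C \<Longrightarrow> FAr F (Idn C A) = Idn C (FOb F A)"
  "f \<in> Arr C \<Longrightarrow> g \<in> Arr C \<Longrightarrow> Src C g = Tgt C f \<Longrightarrow> FAr F (g \<cdot> f) = FAr F g \<cdot> FAr F f"
  using functorial by (auto simp: endofunctor_def)

lemma reflects_iso:
  assumes f_hom: "f \<in> Hom C A B" and iso: "iso_arrow C (FAr F f)"
  shows "iso_arrow C f"
proof -
  have objs: "A \<in> Obj C" "B \<in> Obj C" using Hom_objD[OF f_hom] by auto
  obtain k where k_inverse: "k \<in> Hom C (FOb F B) (FOb F A)" "k \<cdot> FAr F f = Idn C (FOb F A)"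
    "FAr F f \<cdot> k = Idn C (FOb F B)"
    using iso_arrowE[OF iso, of "FOb F A" "FOb F B"] f_hom by auto
  obtain g where g_spec: "g \<in> Hom C B A" "FAr F g = k"
    using full[OF objs(2,1) k_inverse(1)] by blast
  have "g \<cdot> f = Idn C A" using f_hom g_spec k_inverse objs by - (rule faithful[of _ A A], auto)
  moreover have "f \<cdot> g = Idn C B"
    using f_hom g_spec k_inverse objs by - (rule faithful[of _ B B], auto)
  ultimately show ?thesis using f_hom g_spec by (intro iso_arrowI[of f A B g]) auto
qed

lemma ex_preimages:
  obtains G \<epsilon> where "\<And>B. B \<in> Obj C \<Longrightarrow> G B \<in> Obj C"
    and "\<And>B. B \<in> Obj C \<Longrightarrow> \<epsilon> B \<in> Hom C (FOb F (G B)) B"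
    and "\<And>B. B \<in> Obj C \<Longrightarrow> iso_arrow C (\<epsilon> B)"
proof -
  have "\<forall>B. \<exists>A k. B \<in> Obj C \<longrightarrow> A \<in> Obj C \<and> k \<in> Hom C (FOb F A) B \<and> iso_arrow C k"
    using essentially_surjective unfolding isomorphic_def by blast
  then obtain G \<epsilon> where
    "\<forall>B. B \<in> Obj C \<longrightarrow> G B \<in> Obj C \<and> \<epsilon> B \<in> Hom C (FOb F (G B)) B \<and> iso_arrow C (\<epsilon> B)"
    by metis
  then show thesis using that by blast
qed

lemma eq_if_counit_comp_eq:
  assumes "k \<in> Hom C A A'" "k' \<in> Hom C A A'" "\<epsilon> \<in> Hom C (FOb F A') B" "iso_arrow C \<epsilon>"
    and "\<epsilon> \<cdot> FAr F k = \<epsilon> \<cdot> FAr F k'"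
  shows "k = k'"
  using assms
  by - (rule faithful[OF assms(1,2)], rule iso_arrow_cancel_left[OF assms(4,3), of _ "FOb F A"],
      auto)

lemma ex_lift_of_square:
  assumes f_hom: "f \<in> Hom C A B" and "A' \<in> Obj C" "B' \<in> Obj C"
    and a_hom: "a \<in> Hom C (FOb F A') A" and b_iso: "b \<in> Hom C (FOb F B') B" "iso_arrow C b"
  shows "\<exists>k \<in> Hom C A' B'. b \<cdot> FAr F k = f \<cdot> a"
proof -
  obtain u where u_right_inverse: "u \<in> Hom C B (FOb F B')" "b \<cdot> u = Idn C B"
    using iso_arrowE[OF b_iso(2,1)] by blast
  obtain k where k_spec: "k \<in> Hom C A' B'" "FAr F k = u \<cdot> f \<cdot> a"
    using full[of A' B' "u \<cdot> f \<cdot> a"] assms u_right_inverse(1) by auto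
  then have "b \<cdot> FAr F k = f \<cdot> a"
    using f_hom a_hom b_iso(1) u_right_inverse(1)
    by (simp add: u_right_inverse(2)[THEN comp_reassoc])
  then show ?thesis using k_spec(1) by blast
qed

lemma ex_right_quasi_inverse:
  obtains G \<epsilon> where "endofunctor C G"
    and "\<And>B. B \<in> Obj C \<Longrightarrow> \<epsilon> B \<in> Hom C (FOb F (FOb G B)) B"
    and "\<And>B. B \<in> Obj C \<Longrightarrow> iso_arrow C (\<epsilon> B)"
    and "\<And>f. f \<in> Arr C \<Longrightarrow> \<epsilon> (Tgt C f) \<cdot> FAr F (FAr G f) = f \<cdot> \<epsilon> (Src C f)"
proof -
  obtain G \<epsilon> where G_obj: "\<And>B. B \<in> Obj C \<Longrightarrow> G B \<in> Obj C"
    and \<epsilon>_hom: "\<And>B. B \<in> Obj C \<Longrightarrow> \<epsilon> B \<in> Hom C (FOb F (G B)) B"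
    and \<epsilon>_iso: "\<And>B. B \<in> Obj C \<Longrightarrow> iso_arrow C (\<epsilon> B)"
    using ex_preimages by blast
  have "\<forall>f. \<exists>k. f \<in> Arr C \<longrightarrow> k \<in> Hom C (G (Src C f)) (G (Tgt C f)) \<and>
      \<epsilon> (Tgt C f) \<cdot> FAr F k = f \<cdot> \<epsilon> (Src C f)"
    using ex_lift_of_square G_obj \<epsilon>_hom \<epsilon>_iso Hom_iff arr_obj by metis
  then obtain H where H_hom: "\<And>f. f \<in> Arr C \<Longrightarrow> H f \<in> Hom C (G (Src C f)) (G (Tgt C f))"
    and \<epsilon>_natural: "\<And>f. f \<in> Arr C \<Longrightarrow> \<epsilon> (Tgt C f) \<cdot> FAr F (H f) = f \<cdot> \<epsilon> (Src C f)"
    by metis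
  have "endofunctor C \<lparr>FOb = G, FAr = H\<rparr>"
    unfolding endofunctor_def
  proof (intro conjI ballI impI; simp only: endofun.select_convs)
    fix A assume A_obj: "A \<in> Obj C"
    then show "G A \<in> Obj C" using G_obj by blast
    show "H (Idn C A) = Idn C (G A)"
      using H_hom[of "Idn C A"] \<epsilon>_natural[of "Idn C A"] A_obj G_obj[OF A_obj] \<epsilon>_hom[OF A_obj]
      by - (rule eq_if_counit_comp_eq[OF _ _ \<epsilon>_hom[OF A_obj] \<epsilon>_iso[OF A_obj], of _ "G A"], auto)
  next
    fix f assume f_hom: "f \<in> Arr C"
    then show "H f \<in> Hom C (G (Src C f)) (G (Tgt C f))" by (rule H_hom)
    fix g assume g_hom: "g \<in> Arr C" "Src C g = Tgt C f"
    have objs: "Src C f \<in> Obj C" "Tgt C f \<in> Obj C" "Tgt C g \<in> Obj C" using f_hom g_hom by auto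
    have "\<epsilon> (Tgt C g) \<cdot> FAr F (H g \<cdot> H f) = g \<cdot> f \<cdot> \<epsilon> (Src C f)"
      using f_hom g_hom H_hom[OF f_hom] H_hom[OF g_hom(1)] \<epsilon>_hom[OF objs(1)] \<epsilon>_hom[OF objs(2)]
        \<epsilon>_hom[OF objs(3)] \<epsilon>_natural[OF f_hom]
      by (simp add: \<epsilon>_natural[OF g_hom(1), THEN comp_reassoc])
    then show "H (g \<cdot> f) = H g \<cdot> H f"
      using H_hom[of "g \<cdot> f"] \<epsilon>_natural[of "g \<cdot> f"] f_hom g_hom H_hom[OF f_hom] H_hom[OF g_hom(1)]
        \<epsilon>_hom[OF objs(1)]
      by - (rule eq_if_counit_comp_eq[OF _ _ \<epsilon>_hom[OF objs(3)] \<epsilon>_iso[OF objs(3)], of _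
            "G (Src C f)"], auto)
  qed
  then show thesis using that[of "\<lparr>FOb = G, FAr = H\<rparr>" \<epsilon>] \<epsilon>_hom \<epsilon>_iso \<epsilon>_natural by simp
qed

theorem autoequivalence: "autoequivalence C F"
proof -
  obtain G \<epsilon> where G_functor: "endofunctor C G"
    and \<epsilon>_hom: "\<And>B. B \<in> Obj C \<Longrightarrow> \<epsilon> B \<in> Hom C (FOb F (FOb G B)) B"
    and \<epsilon>_iso: "\<And>B. B \<in> Obj C \<Longrightarrow> iso_arrow C (\<epsilon> B)"
    and \<epsilon>_natural: "\<And>f. f \<in> Arr C \<Longrightarrow> \<epsilon> (Tgt C f) \<cdot> FAr F (FAr G f) = f \<cdot> \<epsilon> (Src C f)"
    using ex_right_quasi_inverse by blast
  have G_Ob: "FOb G A \<in> Obj C" if "A \<in> Obj C" for A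
    using G_functor that by (simp add: endofunctor_def)
  have G_Ar: "FAr G f \<in> Hom C (FOb G (Src C f)) (FOb G (Tgt C f))" if "f \<in> Arr C" for f
    using G_functor that unfolding endofunctor_def by blast
  have "naturally_isomorphic C (comp_fun F G) id_fun"
    using \<epsilon>_hom \<epsilon>_iso \<epsilon>_natural
    by (intro naturally_isomorphicI[of _ \<epsilon>]) (simp_all add: comp_fun_def id_fun_def)
  moreover have "naturally_isomorphic C (comp_fun G F) id_fun"
  proof -
    have "\<forall>A. \<exists>k. A \<in> Obj C \<longrightarrow> k \<in> Hom C (FOb G (FOb F A)) A \<and> FAr F k = \<epsilon> (FOb F A)"
      using full[OF G_Ob _ \<epsilon>_hom] functor_simps(1) by blast
    then obtain \<eta> where \<eta>_hom: "\<And>A. A \<in> Obj C \<Longrightarrow> \<eta> A \<in> Hom C (FOb G (FOb F A)) A"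
      and F_\<eta>_eq: "\<And>A. A \<in> Obj C \<Longrightarrow> FAr F (\<eta> A) = \<epsilon> (FOb F A)"
      by metis
    have "iso_arrow C (\<eta> A)" if "A \<in> Obj C" for A
      using reflects_iso[OF \<eta>_hom[OF that]] F_\<eta>_eq[OF that] \<epsilon>_iso that by simp
    moreover have "\<eta> (Tgt C f) \<cdot> FAr G (FAr F f) = f \<cdot> \<eta> (Src C f)" if f_hom: "f \<in> Arr C" for f
    proof (rule faithful)
      have objs: "Src C f \<in> Obj C" "Tgt C f \<in> Obj C" using f_hom by auto
      note \<eta>_arr = \<eta>_hom[OF objs(1)] \<eta>_hom[OF objs(2)]
      show "\<eta> (Tgt C f) \<cdot> FAr G (FAr F f) \<in> Hom C (FOb G (FOb F (Src C f))) (Tgt C f)"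
        "f \<cdot> \<eta> (Src C f) \<in> Hom C (FOb G (FOb F (Src C f))) (Tgt C f)"
        using f_hom \<eta>_arr G_Ar[of "FAr F f"] by auto
      show "FAr F (\<eta> (Tgt C f) \<cdot> FAr G (FAr F f)) = FAr F (f \<cdot> \<eta> (Src C f))"
        using f_hom \<eta>_arr G_Ar[of "FAr F f"] \<epsilon>_natural[of "FAr F f"] by (simp add: F_\<eta>_eq)
    qed
    ultimately show ?thesis
      using \<eta>_hom by (intro naturally_isomorphicI[of _ \<eta>]) (simp_all add: comp_fun_def id_fun_def)
  qed
  ultimately show ?thesis using functorial G_functor unfolding autoequivalence_def by blast
qed

end

locale shifted_category = preadditive_category C
  for C :: "('o, 'm, 'b) cat_scheme" (structure) +
  fixes F :: "('o, 'm) endofun"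
  assumes F_additive: "additive_endofunctor C F"
begin

lemma F_endofunctor: "endofunctor C F"
  using F_additive by (simp add: additive_endofunctor_def)

lemma FOb_obj [simp]: "A \<in> Obj C \<Longrightarrow> FOb F A \<in> Obj C"
  using F_endofunctor by (auto simp: endofunctor_def)

lemma FAr_arr [simp]:
  assumes "f \<in> Arr C"
  shows "FAr F f \<in> Arr C" "Src C (FAr F f) = FOb F (Src C f)" "Tgt C (FAr F f) = FOb F (Tgt C f)"
  using F_endofunctor assms by (auto simp: endofunctor_def)

lemma FAr_Idn [simp]: "A \<in> Obj C \<Longrightarrow> FAr F (Idn C A) = Idn C (FOb F A)"
  using F_endofunctor by (auto simp: endofunctor_def)

lemma FAr_comp [simp]:
  "f \<in> Arr C \<Longrightarrow> g \<in> Arr C \<Longrightarrow> Src C g = Tgt C f \<Longrightarrow> FAr F (g \<cdot> f) = FAr F g \<cdot> FAr F f"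
  using F_endofunctor by (auto simp: endofunctor_def)

lemma FAr_Plus [simp]:
  assumes "f \<in> Arr C" "g \<in> Arr C" "Src C g = Src C f" "Tgt C g = Tgt C f"
  shows "FAr F (f \<boxplus> g) = FAr F f \<boxplus> FAr F g"
proof -
  have "f \<in> Hom C (Src C f) (Tgt C f)" "g \<in> Hom C (Src C f) (Tgt C f)"
    "Src C f \<in> Obj C" "Tgt C f \<in> Obj C"
    using assms by auto
  then show ?thesis using F_additive unfolding additive_endofunctor_def by blast
qed

lemma FAr_Zer [simp]:
  assumes "A \<in> Obj C" "B \<in> Obj C"
  shows "FAr F (Zer C A B) = Zer C (FOb F A) (FOb F B)"
  using Zer_if_Plus_idem[of "FAr F (Zer C A B)"] FAr_Plus[of "Zer C A B" "Zer C A B"] assms by simp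

lemma FAr_Neg [simp]: "f \<in> Arr C \<Longrightarrow> FAr F (\<boxminus> f) = \<boxminus> FAr F f"
  using FAr_Plus[of f "\<boxminus> f"] by (intro Neg_unique) auto

lemma FAr_comp_eq:
  assumes "g \<cdot> f = h" "f \<in> Arr C" "g \<in> Arr C" "Src C g = Tgt C f"
  shows "FAr F g \<cdot> FAr F f = FAr F h"
  using assms FAr_comp[of f g] by simp

lemma FOb_zero_object: "zero_object C N \<Longrightarrow> zero_object C (FOb F N)"
  using FAr_Idn[of N] by (auto simp: zero_object_iff)

lemma FAr_iso_arrow:
  assumes f_hom: "f \<in> Hom C A B" and iso: "iso_arrow C f"
  shows "iso_arrow C (FAr F f)"
proof -
  have objs: "A \<in> Obj C" "B \<in> Obj C" using Hom_objD[OF f_hom] by auto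
  obtain g where g_inverse: "g \<in> Hom C B A" "g \<cdot> f = Idn C A" "f \<cdot> g = Idn C B"
    using iso_arrowE[OF iso f_hom] by blast
  have "FAr F g \<cdot> FAr F f = Idn C (FOb F A)" "FAr F f \<cdot> FAr F g = Idn C (FOb F B)"
    using f_hom g_inverse(1) objs FAr_comp_eq[OF g_inverse(2)] FAr_comp_eq[OF g_inverse(3)] by auto
  with f_hom g_inverse(1) show ?thesis
    by (intro iso_arrowI[of _ "FOb F A" "FOb F B" "FAr F g"]) auto
qed

lemma FAr_biproduct:
  assumes P_biproduct: "biproduct_arrows C A B P i j p q"
  shows "biproduct_arrows C (FOb F A) (FOb F B) (FOb F P) (FAr F i) (FAr F j) (FAr F p) (FAr F q)"
proof -
  note arr = biproduct_arrows_arr[OF P_biproduct]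
    and comps = biproduct_arrows_comp(1-4)[OF P_biproduct]
  have "FAr F i \<cdot> FAr F p \<boxplus> FAr F j \<cdot> FAr F q = FAr F (i \<cdot> p \<boxplus> j \<cdot> q)"
    using arr by simp
  with arr show ?thesis
    by (simp add: biproduct_arrows_def biproduct_arrows_sum[OF P_biproduct] comps[THEN FAr_comp_eq])
qed

lemma rmorphism_iff: "rmorphism C F (a, b, c) (f, g, h) (f', g', h') \<longleftrightarrow>
     a \<in> Hom C (Src C f) (Src C f') \<and> b \<in> Hom C (Tgt C f) (Tgt C f') \<and>
     c \<in> Hom C (Tgt C g) (Tgt C g') \<and> b \<cdot> f = f' \<cdot> a \<and> c \<cdot> g = g' \<cdot> b \<and> FAr F a \<cdot> h = h' \<cdot> c"
  by (simp add: rmorphism_def)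

lemma rmorphism_Idn:
  assumes "rdiagram C F f g h"
  shows "rmorphism C F (Idn C (Src C f), Idn C (Tgt C f), Idn C (Tgt C g)) (f, g, h) (f, g, h)"
  using assms by (auto simp: rmorphism_iff rdiagram_def)

lemma rmorphism_comp:
  assumes diagrams: "rdiagram C F f g h" "rdiagram C F f' g' h'" "rdiagram C F f'' g'' h''"
    and abc: "rmorphism C F (a, b, c) (f, g, h) (f', g', h')"
    and abc': "rmorphism C F (a', b', c') (f', g', h') (f'', g'', h'')"
  shows "rmorphism C F (a' \<cdot> a, b' \<cdot> b, c' \<cdot> c) (f, g, h) (f'', g'', h'')"
proof -
  from abc abc' have squares: "b \<cdot> f = f' \<cdot> a" "c \<cdot> g = g' \<cdot> b" "FAr F a \<cdot> h = h' \<cdot> c"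
    and squares': "b' \<cdot> f' = f'' \<cdot> a'" "c' \<cdot> g' = g'' \<cdot> b'" "FAr F a' \<cdot> h' = h'' \<cdot> c'"
    and arr: "a \<in> Hom C (Src C f) (Src C f')" "b \<in> Hom C (Tgt C f) (Tgt C f')"
      "c \<in> Hom C (Tgt C g) (Tgt C g')" "a' \<in> Hom C (Src C f') (Src C f'')"
      "b' \<in> Hom C (Tgt C f') (Tgt C f'')" "c' \<in> Hom C (Tgt C g') (Tgt C g'')"
    unfolding rmorphism_iff by blast+
  from arr diagrams show ?thesis
    by (simp add: rdiagram_def rmorphism_iff squares squares'[THEN comp_reassoc])
qed

lemma rmorphism_Plus:
  assumes "rdiagram C F f g h" "rdiagram C F f' g' h'"
    and "rmorphism C F (a, b, c) (f, g, h) (f', g', h')"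
    and "rmorphism C F (a', b', c') (f, g, h) (f', g', h')"
  shows "rmorphism C F (a \<boxplus> a', b \<boxplus> b', c \<boxplus> c') (f, g, h) (f', g', h')"
  using assms by (simp add: rdiagram_def rmorphism_iff)

lemma rmorphism_diff:
  assumes "rdiagram C F f g h" "rdiagram C F f' g' h'"
    and "rmorphism C F (a, b, c) (f, g, h) (f', g', h')"
    and "rmorphism C F (a', b', c') (f, g, h) (f', g', h')"
  shows "rmorphism C F (a \<boxplus> \<boxminus> a', b \<boxplus> \<boxminus> b', c \<boxplus> \<boxminus> c') (f, g, h) (f', g', h')"
  using assms by (simp add: rdiagram_def rmorphism_iff)

lemma rmorphism_rotate:
  assumes diagrams: "rdiagram C F f g h" "rdiagram C F f' g' h'"
    and abc: "rmorphism C F (a, b, c) (f, g, h) (f', g', h')"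
  shows "rmorphism C F (b, c, FAr F a) (g, h, \<boxminus> FAr F f) (g', h', \<boxminus> FAr F f')"
proof -
  have arr: "a \<in> Hom C (Src C f) (Src C f')" "b \<in> Hom C (Tgt C f) (Tgt C f')"
    and square: "b \<cdot> f = f' \<cdot> a"
    using abc unfolding rmorphism_iff by blast+
  have "FAr F b \<cdot> FAr F f = FAr F f' \<cdot> FAr F a"
    using arr diagrams FAr_comp_eq[OF square] by (simp add: rdiagram_def)
  then show ?thesis using diagrams abc by (simp add: rdiagram_def rmorphism_iff)
qed

lemma rmorphism_inverse:
  assumes diagrams: "rdiagram C F f g h" "rdiagram C F f' g' h'"
    and abc: "rmorphism C F (a, b, c) (f, g, h) (f', g', h')"
    and iso: "iso_arrow C a" "iso_arrow C b" "iso_arrow C c"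
  obtains a' b' c' where "rmorphism C F (a', b', c') (f', g', h') (f, g, h)"
    "a' \<cdot> a = Idn C (Src C f)" "b' \<cdot> b = Idn C (Tgt C f)"
    "iso_arrow C a'" "iso_arrow C b'" "iso_arrow C c'"
proof -
  note diagrams = diagrams[unfolded rdiagram_def]
  from abc have squares: "f' \<cdot> a = b \<cdot> f" "g' \<cdot> b = c \<cdot> g" "h' \<cdot> c = FAr F a \<cdot> h"
    and arr: "a \<in> Hom C (Src C f) (Src C f')" "b \<in> Hom C (Tgt C f) (Tgt C f')"
      "c \<in> Hom C (Tgt C g) (Tgt C g')"
    unfolding rmorphism_iff by auto
  obtain a' where a'_inverse: "a' \<in> Hom C (Src C f') (Src C f)" "a' \<cdot> a = Idn C (Src C f)"
    "a \<cdot> a' = Idn C (Src C f')" "iso_arrow C a'"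
    using iso_arrowE[OF iso(1) arr(1)] by blast
  obtain b' where b'_inverse: "b' \<in> Hom C (Tgt C f') (Tgt C f)" "b' \<cdot> b = Idn C (Tgt C f)"
    "b \<cdot> b' = Idn C (Tgt C f')" "iso_arrow C b'"
    using iso_arrowE[OF iso(2) arr(2)] by blast
  obtain c' where c'_inverse: "c' \<in> Hom C (Tgt C g') (Tgt C g)" "c' \<cdot> c = Idn C (Tgt C g)"
    "c \<cdot> c' = Idn C (Tgt C g')" "iso_arrow C c'"
    using iso_arrowE[OF iso(3) arr(3)] by blast
  have "b' \<cdot> f' = f \<cdot> a'"
    using diagrams arr a'_inverse b'_inverse squares
    by (intro commuting_square_inverse[of f _ _ f' _ _ a a' b]) auto
  moreover have "c' \<cdot> g' = g \<cdot> b'"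
    using diagrams arr c'_inverse b'_inverse squares
    by (intro commuting_square_inverse[of g _ _ g' _ _ b b' c]) auto
  moreover have "FAr F a' \<cdot> FAr F a = Idn C (FOb F (Src C f))"
    using diagrams arr a'_inverse(1) FAr_comp_eq[OF a'_inverse(2)] by simp
  then have "FAr F a' \<cdot> h' = h \<cdot> c'"
    using diagrams arr a'_inverse(1) c'_inverse squares
    by (intro commuting_square_inverse[of h _ _ h' _ _ c c' "FAr F a"]) auto
  ultimately show thesis
    using that[of a' b' c'] a'_inverse b'_inverse c'_inverse by (simp add: rmorphism_iff)
qed

lemma risomorphic_refl: "rdiagram C F f g h \<Longrightarrow> risomorphic C F (f, g, h) (f, g, h)"
  unfolding risomorphic_def
  by (rule exI, rule exI, rule exI, rule conjI, rule rmorphism_Idn) (auto simp: rdiagram_def)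

lemma risomorphic_sym:
  assumes diagrams: "rdiagram C F f g h" "rdiagram C F f' g' h'"
    and "risomorphic C F (f, g, h) (f', g', h')"
  shows "risomorphic C F (f', g', h') (f, g, h)"
  using assms(3) rmorphism_inverse[OF diagrams] unfolding risomorphic_def by metis

lemma risomorphic_trans:
  assumes diagrams: "rdiagram C F f g h" "rdiagram C F f' g' h'" "rdiagram C F f'' g'' h''"
    and "risomorphic C F (f, g, h) (f', g', h')" "risomorphic C F (f', g', h') (f'', g'', h'')"
  shows "risomorphic C F (f, g, h) (f'', g'', h'')"
proof -
  obtain a b c where abc: "rmorphism C F (a, b, c) (f, g, h) (f', g', h')"
    and iso: "iso_arrow C a" "iso_arrow C b" "iso_arrow C c"
    using assms(4) unfolding risomorphic_def by blast
  obtain a' b' c' where abc': "rmorphism C F (a', b', c') (f', g', h') (f'', g'', h'')"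
    and iso': "iso_arrow C a'" "iso_arrow C b'" "iso_arrow C c'"
    using assms(5) unfolding risomorphic_def by blast
  have "iso_arrow C (a' \<cdot> a)" "iso_arrow C (b' \<cdot> b)" "iso_arrow C (c' \<cdot> c)"
    using abc abc' iso iso' iso_arrow_comp unfolding rmorphism_iff by blast+
  then show ?thesis
    using rmorphism_comp[OF diagrams abc abc'] unfolding risomorphic_def by blast
qed

lemma rmorphism_completion_transfer:
  assumes diagrams: "rdiagram C F f g h" "rdiagram C F k l m"
    and diagrams': "rdiagram C F f' g' h'" "rdiagram C F k' l' m'"
    and xyz: "rmorphism C F (x, y, z) (f, g, h) (k, l, m)"
      "iso_arrow C x" "iso_arrow C y" "iso_arrow C z"
    and xyz': "rmorphism C F (x', y', z') (f', g', h') (k', l', m')"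
      "iso_arrow C x'" "iso_arrow C y'" "iso_arrow C z'"
    and a_hom: "a \<in> Hom C (Src C f) (Src C f')" and b_hom: "b \<in> Hom C (Tgt C f) (Tgt C f')"
    and square: "b \<cdot> f = f' \<cdot> a"
    and completion: "\<And>a b. a \<in> Hom C (Src C k) (Src C k') \<Longrightarrow> b \<in> Hom C (Tgt C k) (Tgt C k') \<Longrightarrow>
      b \<cdot> k = k' \<cdot> a \<Longrightarrow> \<exists>c. rmorphism C F (a, b, c) (k, l, m) (k', l', m')"
  shows "\<exists>c. rmorphism C F (a, b, c) (f, g, h) (f', g', h')"
proof -
  obtain u v w where uvw: "rmorphism C F (u, v, w) (k, l, m) (f, g, h)"
    and left_inverse: "u \<cdot> x = Idn C (Src C f)" "v \<cdot> y = Idn C (Tgt C f)"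
    using rmorphism_inverse[OF diagrams xyz] by metis
  obtain u' v' w' where uvw': "rmorphism C F (u', v', w') (k', l', m') (f', g', h')"
    and left_inverse': "u' \<cdot> x' = Idn C (Src C f')" "v' \<cdot> y' = Idn C (Tgt C f')"
    using rmorphism_inverse[OF diagrams' xyz'] by metis
  have arr: "x \<in> Hom C (Src C f) (Src C k)" "y \<in> Hom C (Tgt C f) (Tgt C k)"
    "x' \<in> Hom C (Src C f') (Src C k')" "y' \<in> Hom C (Tgt C f') (Tgt C k')"
    "u \<in> Hom C (Src C k) (Src C f)" "v \<in> Hom C (Tgt C k) (Tgt C f)"
    "u' \<in> Hom C (Src C k') (Src C f')" "v' \<in> Hom C (Tgt C k') (Tgt C f')"
    and squares: "y' \<cdot> f' = k' \<cdot> x'" "v \<cdot> k = f \<cdot> u"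
    using xyz(1) xyz'(1) uvw uvw' unfolding rmorphism_iff by auto
  note arrs = arr a_hom b_hom diagrams[unfolded rdiagram_def] diagrams'[unfolded rdiagram_def]
  have "(y' \<cdot> b \<cdot> v) \<cdot> k = k' \<cdot> (x' \<cdot> a \<cdot> u)"
    using arrs by (simp add: squares(2) square[THEN comp_reassoc] squares(1)[THEN comp_reassoc])
  then obtain c where abc: "rmorphism C F (x' \<cdot> a \<cdot> u, y' \<cdot> b \<cdot> v, c) (k, l, m) (k', l', m')"
    using completion[of "x' \<cdot> a \<cdot> u" "y' \<cdot> b \<cdot> v"] arrs by auto
  have "rmorphism C F (u' \<cdot> (x' \<cdot> a \<cdot> u) \<cdot> x, v' \<cdot> (y' \<cdot> b \<cdot> v) \<cdot> y, w' \<cdot> c \<cdot> z)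
      (f, g, h) (f', g', h')"
    using rmorphism_comp[OF diagrams(1) diagrams'(2,1) rmorphism_comp[OF diagrams diagrams'(2)
          xyz(1) abc] uvw'] .
  moreover have "u' \<cdot> (x' \<cdot> a \<cdot> u) \<cdot> x = a"
    using arrs by (simp add: left_inverse(1) left_inverse'(1)[THEN comp_reassoc])
  moreover have "v' \<cdot> (y' \<cdot> b \<cdot> v) \<cdot> y = b"
    using arrs by (simp add: left_inverse(2) left_inverse'(2)[THEN comp_reassoc])
  ultimately show ?thesis by metis
qed

end

section \<open>Right triangulations\<close>

text \<open>The conclusion of (RTR4), for an arbitrary class of triangles.\<close>

definition octahedral ::
    "('o, 'm, 'b) cat_scheme \<Rightarrow> ('o, 'm) endofun \<Rightarrow> ('m \<times> 'm \<times> 'm) set \<Rightarrow>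
      'm \<times> 'm \<times> 'm \<Rightarrow> 'm \<times> 'm \<times> 'm \<Rightarrow> 'm \<times> 'm \<times> 'm \<Rightarrow> bool" where
  "octahedral C F T = (\<lambda>(f, g, h) (l, m, n) (l', m', n').
     \<exists>g' \<in> Hom C (Tgt C m) (Tgt C g). \<exists>h' \<in> Hom C (Tgt C g) (FOb F (Src C l')).
       h' \<cdot>\<^bsub>C\<^esub> g = n' \<and> h \<cdot>\<^bsub>C\<^esub> g' = n \<and> g' \<cdot>\<^bsub>C\<^esub> m = g \<cdot>\<^bsub>C\<^esub> m' \<and>
       FAr F l \<cdot>\<^bsub>C\<^esub> h \<boxplus>\<^bsub>C\<^esub> FAr F l' \<cdot>\<^bsub>C\<^esub> h' = Zer C (Tgt C g) (FOb F (Tgt C l)) \<and>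
       (m \<cdot>\<^bsub>C\<^esub> l', g', h') \<in> T)"

lemma octahedralI:
  assumes "g' \<in> Hom C (Tgt C m) (Tgt C g)" "h' \<in> Hom C (Tgt C g) (FOb F (Src C l'))"
    and "h' \<cdot>\<^bsub>C\<^esub> g = n'" "h \<cdot>\<^bsub>C\<^esub> g' = n" "g' \<cdot>\<^bsub>C\<^esub> m = g \<cdot>\<^bsub>C\<^esub> m'"
    and "FAr F l \<cdot>\<^bsub>C\<^esub> h \<boxplus>\<^bsub>C\<^esub> FAr F l' \<cdot>\<^bsub>C\<^esub> h' = Zer C (Tgt C g) (FOb F (Tgt C l))"
    and "(m \<cdot>\<^bsub>C\<^esub> l', g', h') \<in> T"
  shows "octahedral C F T (f, g, h) (l, m, n) (l', m', n')"
  using assms unfolding octahedral_def prod.case by blast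

lemma octahedralE:
  assumes "octahedral C F T (f, g, h) (l, m, n) (l', m', n')"
  obtains g' h' where "g' \<in> Hom C (Tgt C m) (Tgt C g)" "h' \<in> Hom C (Tgt C g) (FOb F (Src C l'))"
    and "h' \<cdot>\<^bsub>C\<^esub> g = n'" "h \<cdot>\<^bsub>C\<^esub> g' = n" "g' \<cdot>\<^bsub>C\<^esub> m = g \<cdot>\<^bsub>C\<^esub> m'"
    and "FAr F l \<cdot>\<^bsub>C\<^esub> h \<boxplus>\<^bsub>C\<^esub> FAr F l' \<cdot>\<^bsub>C\<^esub> h' = Zer C (Tgt C g) (FOb F (Tgt C l))"
    and "(m \<cdot>\<^bsub>C\<^esub> l', g', h') \<in> T"
  using assms unfolding octahedral_def prod.case by blast

text \<open>Without (RTR4): the five lemma is needed in the quotient before (RTR4) can be verified there.\<close>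

locale pre_right_triangulation = additive_category C
  for C :: "('o, 'm, 'b) cat_scheme" (structure) +
  fixes \<Sigma> :: "('o, 'm) endofun" and RT :: "('m \<times> 'm \<times> 'm) set"
  assumes suspension_additive: "additive_endofunctor C \<Sigma>"
    and triangle_diagram: "(f, g, h) \<in> RT \<Longrightarrow> rdiagram C \<Sigma> f g h"
    and triangle_iso_closed: "(f, g, h) \<in> RT \<Longrightarrow> rdiagram C \<Sigma> f' g' h' \<Longrightarrow>
      risomorphic C \<Sigma> (f, g, h) (f', g', h') \<Longrightarrow> (f', g', h') \<in> RT"
    and triangle_zero: "zero_object C N \<Longrightarrow> A \<in> Obj C \<Longrightarrow>
      (Zer C N A, Idn C A, Zer C A (FOb \<Sigma> N)) \<in> RT"
    and triangle_ex: "f \<in> Arr C \<Longrightarrow> \<exists>g h. (f, g, h) \<in> RT"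
    and triangle_rotate: "(f, g, h) \<in> RT \<Longrightarrow> (g, h, \<boxminus> FAr \<Sigma> f) \<in> RT"
    and triangle_completion: "(f, g, h) \<in> RT \<Longrightarrow> (f', g', h') \<in> RT \<Longrightarrow>
      a \<in> Hom C (Src C f) (Src C f') \<Longrightarrow> b \<in> Hom C (Tgt C f) (Tgt C f') \<Longrightarrow>
      b \<cdot> f = f' \<cdot> a \<Longrightarrow> \<exists>c. rmorphism C \<Sigma> (a, b, c) (f, g, h) (f', g', h')"

sublocale pre_right_triangulation \<subseteq> Susp: shifted_category C \<Sigma>
  by unfold_locales (rule suspension_additive)

sublocale right_triangulation \<subseteq> pre_right_triangulation C \<Sigma> RT
  by unfold_locales (fact Sigma_additive RT_diagram RT_iso_closed RTR1_id RTR1_ex RTR2 RTR3)+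

context pre_right_triangulation
begin

lemma triangle_arr:
  assumes "(f, g, h) \<in> RT"
  shows "f \<in> Arr C" "g \<in> Arr C" "h \<in> Arr C" "Src C g = Tgt C f" "Src C h = Tgt C g"
    "Tgt C h = FOb \<Sigma> (Src C f)"
  using triangle_diagram[OF assms] by (auto simp: rdiagram_def)

lemma triangle_isoI:
  assumes "(f, g, h) \<in> RT" "rdiagram C \<Sigma> f' g' h'"
    "rmorphism C \<Sigma> (a, b, c) (f, g, h) (f', g', h')" "iso_arrow C a" "iso_arrow C b" "iso_arrow C c"
  shows "(f', g', h') \<in> RT"
  using triangle_iso_closed[OF assms(1,2)] assms(3-) unfolding risomorphic_def by blast

lemma triangle_isoI_rev:
  assumes fgh': "(f', g', h') \<in> RT" and diagram: "rdiagram C \<Sigma> f g h"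
    and abc: "rmorphism C \<Sigma> (a, b, c) (f, g, h) (f', g', h')"
    and iso: "iso_arrow C a" "iso_arrow C b" "iso_arrow C c"
  shows "(f, g, h) \<in> RT"
proof -
  have "risomorphic C \<Sigma> (f, g, h) (f', g', h')" using abc iso unfolding risomorphic_def by blast
  then show ?thesis
    using Susp.risomorphic_sym[OF diagram triangle_diagram[OF fgh']]
      triangle_iso_closed[OF fgh' diagram] by blast
qed

lemma weak_cokernel:
  assumes fgh: "(f, g, h) \<in> RT" and b_zero: "b \<in> Hom C (Tgt C f) W" "b \<cdot> f = Zer C (Src C f) W"
  obtains c where "c \<in> Hom C (Tgt C g) W" "c \<cdot> g = b"
proof -
  obtain N where N_zero: "zero_object C N" using ex_zero_object by blast
  then have N_obj: "N \<in> Obj C" by (simp add: zero_object_iff)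
  have W_obj: "W \<in> Obj C" using Hom_objD b_zero(1) by blast
  note arrs = triangle_arr[OF fgh]
  have "\<exists>c. rmorphism C \<Sigma> (Zer C (Src C f) N, b, c) (f, g, h)
      (Zer C N W, Idn C W, Zer C W (FOb \<Sigma> N))"
    using arrs b_zero N_obj W_obj
    by (intro triangle_completion[OF fgh triangle_zero[OF N_zero W_obj]]) simp_all
  then show thesis using that arrs b_zero N_obj W_obj by (auto simp: rmorphism_def)
qed

lemma weak_cokernel_second:
  assumes fgh: "(f, g, h) \<in> RT" and b_zero: "b \<in> Hom C (Tgt C g) W" "b \<cdot> g = Zer C (Tgt C f) W"
  obtains c where "c \<in> Hom C (FOb \<Sigma> (Src C f)) W" "c \<cdot> h = b"
  using weak_cokernel[OF triangle_rotate[OF fgh] b_zero(1)] b_zero(2) triangle_arr[OF fgh] by auto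

lemma comp_zero_first:
  assumes fgh: "(f, g, h) \<in> RT"
  shows "g \<cdot> f = Zer C (Src C f) (Tgt C g)"
proof -
  obtain N where N_zero: "zero_object C N" using ex_zero_object by blast
  then have N_obj: "N \<in> Obj C" by (simp add: zero_object_iff)
  note arrs = triangle_arr[OF fgh]
  have A_obj: "Src C f \<in> Obj C" using arrs by simp
  have "\<exists>c. rmorphism C \<Sigma> (Idn C (Src C f), f, c)
      (Idn C (Src C f), Zer C (Src C f) (FOb \<Sigma> N), \<boxminus> FAr \<Sigma> (Zer C N (Src C f))) (f, g, h)"
    using arrs N_obj
    by (intro triangle_completion[OF triangle_rotate[OF triangle_zero[OF N_zero A_obj]] fgh]) simp_all
  then show ?thesis using arrs N_obj by (auto simp: rmorphism_def)
qed

lemma comp_zero_second: "(f, g, h) \<in> RT \<Longrightarrow> h \<cdot> g = Zer C (Tgt C f) (FOb \<Sigma> (Src C f))"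
  using comp_zero_first[OF triangle_rotate] triangle_arr by metis

lemma comp_zero_third:
  assumes fgh: "(f, g, h) \<in> RT"
  shows "FAr \<Sigma> f \<cdot> h = Zer C (Tgt C g) (FOb \<Sigma> (Tgt C f))"
proof -
  note arrs = triangle_arr[OF fgh]
  have "\<boxminus> (FAr \<Sigma> f \<cdot> h) = \<boxminus> Zer C (Tgt C g) (FOb \<Sigma> (Tgt C f))"
    using comp_zero_second[OF triangle_rotate[OF fgh]] arrs by simp
  then show ?thesis using arrs by (subst (asm) Neg_eq_iff) simp_all
qed

lemma weak_cokernel_comp:
  assumes fgh: "(f, g, h) \<in> RT" and lmn: "(l, m, n) \<in> RT" and match: "Tgt C m = Tgt C f"
    and k_spec: "k \<in> Hom C (Src C f) (Tgt C l)" "m \<cdot> k = f"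
    and b_spec: "b \<in> Hom C (Tgt C l) W" "b \<cdot> l = Zer C (Src C l) W" "b \<cdot> k = Zer C (Src C f) W"
  obtains c where "c \<in> Hom C (Tgt C g) W" "c \<cdot> g \<cdot> m = b"
proof -
  note arrs = triangle_arr[OF fgh] triangle_arr[OF lmn] match
  obtain j where j_spec: "j \<in> Hom C (Tgt C f) W" "j \<cdot> m = b"
    using weak_cokernel[OF lmn b_spec(1,2)] match by auto
  have "j \<cdot> f = Zer C (Src C f) W"
    using arrs j_spec(1) k_spec(1) comp_assoc_arr[of k m j]
    by (simp add: k_spec(2) j_spec(2) b_spec(3))
  then obtain c where "c \<in> Hom C (Tgt C g) W" "c \<cdot> g = j"
    using weak_cokernel[OF fgh j_spec(1)] by blast
  then show thesis using that[of c] arrs j_spec(2) comp_assoc_arr[of m g c] by simp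
qed

lemma iso_arrow_if_endomorphism:
  assumes fgh: "(f, g, h) \<in> RT"
    and endo: "rmorphism C \<Sigma> (Idn C (Src C f), Idn C (Tgt C f), c) (f, g, h) (f, g, h)"
  shows "iso_arrow C c"
proof -
  let ?D = "Tgt C g"
  note arrs = triangle_arr[OF fgh]
  have c_spec: "c \<in> Hom C ?D ?D" "c \<cdot> g = g" "h \<cdot> c = h"
    using endo arrs by (auto simp: rmorphism_def)
  define n where "n = c \<boxplus> \<boxminus> Idn C ?D"
  have n_hom: "n \<in> Hom C ?D ?D" using arrs c_spec by (simp add: n_def)
  have "n \<cdot> g = Zer C (Tgt C f) ?D" using arrs c_spec by (simp add: n_def)
  then obtain s where s_spec: "s \<in> Hom C (FOb \<Sigma> (Src C f)) ?D" "s \<cdot> h = n"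
    using weak_cokernel_second[OF fgh n_hom] by blast
  have "h \<cdot> n = Zer C ?D (FOb \<Sigma> (Src C f))" using arrs c_spec by (simp add: n_def)
  then have "n \<cdot> n = Zer C ?D ?D"
    using arrs s_spec(1) n_hom comp_assoc_arr[of n h s] by (simp add: s_spec(2))
  moreover have "c = Idn C ?D \<boxplus> n"
    using c_spec arrs n_hom by (intro eq_Plus_if_diff_eq[of _ ?D ?D]) (auto simp: n_def)
  ultimately show ?thesis using n_hom iso_arrow_Idn_Plus_nilpotent[of n ?D] by simp
qed

lemma five_lemma:
  assumes fgh: "(f, g, h) \<in> RT" and fgh': "(f', g', h') \<in> RT"
    and abc: "rmorphism C \<Sigma> (a, b, c) (f, g, h) (f', g', h')"
    and iso: "iso_arrow C a" "iso_arrow C b"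
  shows "iso_arrow C c"
proof -
  note arrs = triangle_arr[OF fgh] triangle_arr[OF fgh']
  note diagram = triangle_diagram[OF fgh] and diagram' = triangle_diagram[OF fgh']
  from abc have arr: "a \<in> Hom C (Src C f) (Src C f')" "b \<in> Hom C (Tgt C f) (Tgt C f')"
      "c \<in> Hom C (Tgt C g) (Tgt C g')" and square: "f' \<cdot> a = b \<cdot> f"
    by (auto simp: rmorphism_def)
  obtain a' where a'_inverse: "a' \<in> Hom C (Src C f') (Src C f)" "a' \<cdot> a = Idn C (Src C f)"
    "a \<cdot> a' = Idn C (Src C f')"
    using iso_arrowE[OF iso(1) arr(1)] by blast
  obtain b' where b'_inverse: "b' \<in> Hom C (Tgt C f') (Tgt C f)" "b' \<cdot> b = Idn C (Tgt C f)"
    "b \<cdot> b' = Idn C (Tgt C f')"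
    using iso_arrowE[OF iso(2) arr(2)] by blast
  have "b' \<cdot> f' = f \<cdot> a'"
    using arrs arr a'_inverse b'_inverse square
    by (intro commuting_square_inverse[of f _ _ f' _ _ a a' b]) auto
  then obtain c' where abc': "rmorphism C \<Sigma> (a', b', c') (f', g', h') (f, g, h)"
    using triangle_completion[OF fgh' fgh] a'_inverse(1) b'_inverse(1) by blast
  have "iso_arrow C (c' \<cdot> c)"
    using iso_arrow_if_endomorphism[OF fgh] Susp.rmorphism_comp[OF diagram diagram' diagram abc
        abc'] a'_inverse b'_inverse by simp
  moreover have "iso_arrow C (c \<cdot> c')"
    using iso_arrow_if_endomorphism[OF fgh'] Susp.rmorphism_comp[OF diagram' diagram diagram' abc'
        abc] a'_inverse b'_inverse by simp
  moreover have "c' \<in> Hom C (Tgt C g') (Tgt C g)" using abc' by (simp add: rmorphism_def)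
  ultimately show ?thesis using arr(3) iso_arrow_of_iso_comps by blast
qed

lemma triangle_iso_completion:
  assumes fgh: "(f, g, h) \<in> RT" and fgh': "(f', g', h') \<in> RT"
    and square: "a \<in> Hom C (Src C f) (Src C f')" "b \<in> Hom C (Tgt C f) (Tgt C f')" "b \<cdot> f = f' \<cdot> a"
    and iso: "iso_arrow C a" "iso_arrow C b"
  obtains c where "rmorphism C \<Sigma> (a, b, c) (f, g, h) (f', g', h')" "iso_arrow C c"
  using triangle_completion[OF fgh fgh' square] five_lemma[OF fgh fgh' _ iso] by blast

lemma third_zero_if_split_mono:
  assumes igh: "(i, g, h) \<in> RT"
    and p_left_inverse: "p \<in> Hom C (Tgt C i) (Src C i)" "p \<cdot> i = Idn C (Src C i)"
  shows "h = Zer C (Tgt C g) (FOb \<Sigma> (Src C i))"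
proof -
  note arrs = triangle_arr[OF igh]
  have "FAr \<Sigma> p \<cdot> FAr \<Sigma> i = Idn C (FOb \<Sigma> (Src C i))"
    using arrs p_left_inverse(1) Susp.FAr_comp_eq[OF p_left_inverse(2)] by simp
  then have "h = FAr \<Sigma> p \<cdot> (FAr \<Sigma> i \<cdot> h)" using arrs p_left_inverse by (simp add: comp_reassoc)
  then show ?thesis using comp_zero_third[OF igh] arrs p_left_inverse by simp
qed

lemma biproduct_if_split_mono:
  assumes igh: "(i, g, h) \<in> RT"
    and p_left_inverse: "p \<in> Hom C (Tgt C i) (Src C i)" "p \<cdot> i = Idn C (Src C i)"
  obtains j where "biproduct_arrows C (Src C i) (Tgt C g) (Tgt C i) i j p g"
proof -
  note arrs = triangle_arr[OF igh]
  have h_zero: "h = Zer C (Tgt C g) (FOb \<Sigma> (Src C i))"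
    using third_zero_if_split_mono[OF igh p_left_inverse] .
  have g_epi: "x = Zer C (Tgt C g) W"
    if x_zero: "x \<in> Hom C (Tgt C g) W" "x \<cdot> g = Zer C (Tgt C i) W" for x W
  proof -
    obtain s where "s \<in> Hom C (FOb \<Sigma> (Src C i)) W" "s \<cdot> h = x"
      using weak_cokernel_second[OF igh x_zero] by blast
    then show ?thesis using arrs h_zero by auto
  qed
  let ?r = "Idn C (Tgt C i) \<boxplus> \<boxminus> (i \<cdot> p)"
  have "?r \<cdot> i = Zer C (Src C i) (Tgt C i)" using arrs p_left_inverse by simp
  then obtain j where j_spec: "j \<in> Hom C (Tgt C g) (Tgt C i)" "j \<cdot> g = ?r"
    using weak_cokernel[OF igh, of ?r "Tgt C i"] arrs p_left_inverse by auto
  have "(g \<cdot> j \<boxplus> \<boxminus> Idn C (Tgt C g)) \<cdot> g = Zer C (Tgt C i) (Tgt C g)"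
    using arrs p_left_inverse j_spec(1)
    by (simp add: j_spec(2) comp_zero_first[OF igh, THEN comp_reassoc])
  then have "g \<cdot> j \<boxplus> \<boxminus> Idn C (Tgt C g) = Zer C (Tgt C g) (Tgt C g)"
    using arrs j_spec(1) by (intro g_epi) auto
  then have gj_eq: "g \<cdot> j = Idn C (Tgt C g)"
    using arrs j_spec(1) by - (rule eq_if_diff_Zer[of _ "Tgt C g" "Tgt C g"], auto)
  have "(p \<cdot> j) \<cdot> g = Zer C (Tgt C i) (Src C i)"
    using arrs p_left_inverse j_spec(1)
    by (simp add: j_spec(2) p_left_inverse(2)[THEN comp_reassoc])
  then have pj_eq: "p \<cdot> j = Zer C (Tgt C g) (Src C i)"
    using arrs p_left_inverse j_spec(1) by (intro g_epi) auto
  have "i \<cdot> p \<boxplus> j \<cdot> g = Idn C (Tgt C i)"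
    using arrs p_left_inverse by (simp add: j_spec(2) Plus_left_comm[of "i \<cdot> p"])
  then show thesis
    using that[of j] arrs p_left_inverse j_spec(1) gj_eq pj_eq comp_zero_first[OF igh]
    by (simp add: biproduct_arrows_def)
qed

lemma biproduct_triangle:
  assumes P_biproduct: "biproduct_arrows C A B P i j p q"
  shows "(i, q, Zer C B (FOb \<Sigma> A)) \<in> RT"
proof -
  note arr = biproduct_arrows_arr[OF P_biproduct] and comps = biproduct_arrows_comp[OF P_biproduct]
  obtain g h where igh: "(i, g, h) \<in> RT" using triangle_ex arr by blast
  obtain k where complement_biproduct: "biproduct_arrows C A (Tgt C g) P i k p g"
    using biproduct_if_split_mono[OF igh, of p] arr comps by auto
  have h_zero: "h = Zer C (Tgt C g) (FOb \<Sigma> A)"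
    using third_zero_if_split_mono[OF igh, of p] arr comps by simp
  note arrs = arr biproduct_arrows_arr[OF complement_biproduct]
  show ?thesis
  proof (rule triangle_isoI[OF igh])
    show "rdiagram C \<Sigma> i q (Zer C B (FOb \<Sigma> A))" using arrs by (simp add: rdiagram_def)
    show "rmorphism C \<Sigma> (Idn C A, Idn C P, q \<cdot> k) (i, g, h) (i, q, Zer C B (FOb \<Sigma> A))"
      using arrs h_zero biproduct_complement_comp[OF P_biproduct complement_biproduct]
      by (simp add: rmorphism_def)
    show "iso_arrow C (q \<cdot> k)" using biproduct_complement_iso[OF P_biproduct complement_biproduct] .
  qed (use arrs in auto)
qed

end

locale octahedral_input_iso = pre_right_triangulation +
  fixes f g h l m n l' m' n' f\<^sub>1 g\<^sub>1 h\<^sub>1 l\<^sub>1 m\<^sub>1 n\<^sub>1 l'\<^sub>1 m'\<^sub>1 n'\<^sub>1 a b c u d a'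
  assumes fgh: "(f, g, h) \<in> RT" and lmn: "(l, m, n) \<in> RT" and lmn': "(l', m', n') \<in> RT"
    and match: "Src C l = Src C f" "Tgt C l' = Tgt C l" "Tgt C m' = Tgt C f"
    and fgh\<^sub>1: "(f\<^sub>1, g\<^sub>1, h\<^sub>1) \<in> RT" and lmn\<^sub>1: "(l\<^sub>1, m\<^sub>1, n\<^sub>1) \<in> RT" and lmn'\<^sub>1: "(l'\<^sub>1, m'\<^sub>1, n'\<^sub>1) \<in> RT"
    and match\<^sub>1: "Src C l\<^sub>1 = Src C f\<^sub>1" "Tgt C l'\<^sub>1 = Tgt C l\<^sub>1" "Tgt C m'\<^sub>1 = Tgt C f\<^sub>1"
    and abc: "rmorphism C \<Sigma> (a, b, c) (f, g, h) (f\<^sub>1, g\<^sub>1, h\<^sub>1)"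
    and aud: "rmorphism C \<Sigma> (a, u, d) (l, m, n) (l\<^sub>1, m\<^sub>1, n\<^sub>1)"
    and aub: "rmorphism C \<Sigma> (a', u, b) (l', m', n') (l'\<^sub>1, m'\<^sub>1, n'\<^sub>1)"
    and iso: "iso_arrow C a" "iso_arrow C c" "iso_arrow C u" "iso_arrow C d" "iso_arrow C a'"
begin

lemmas arrs = triangle_arr[OF fgh] triangle_arr[OF lmn] triangle_arr[OF lmn'] match
  triangle_arr[OF fgh\<^sub>1] triangle_arr[OF lmn\<^sub>1] triangle_arr[OF lmn'\<^sub>1] match\<^sub>1

lemma iso_homs:
  "a \<in> Hom C (Src C f) (Src C f\<^sub>1)" "b \<in> Hom C (Tgt C f) (Tgt C f\<^sub>1)" "c \<in> Hom C (Tgt C g) (Tgt C g\<^sub>1)"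
  "u \<in> Hom C (Tgt C l) (Tgt C l\<^sub>1)" "d \<in> Hom C (Tgt C m) (Tgt C m\<^sub>1)"
    "a' \<in> Hom C (Src C l') (Src C l'\<^sub>1)"
  using abc aud aub arrs by (auto simp: rmorphism_def)

lemma squares:
  "c \<cdot> g = g\<^sub>1 \<cdot> b" "FAr \<Sigma> a \<cdot> h = h\<^sub>1 \<cdot> c" "u \<cdot> l = l\<^sub>1 \<cdot> a" "d \<cdot> m = m\<^sub>1 \<cdot> u" "FAr \<Sigma> a \<cdot> n = n\<^sub>1 \<cdot> d"
  "u \<cdot> l' = l'\<^sub>1 \<cdot> a'" "b \<cdot> m' = m'\<^sub>1 \<cdot> u" "FAr \<Sigma> a' \<cdot> n' = n'\<^sub>1 \<cdot> b"
  using abc aud aub by (auto simp: rmorphism_def)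

lemma suspended_isos:
  "FAr \<Sigma> a \<in> Hom C (FOb \<Sigma> (Src C f)) (FOb \<Sigma> (Src C f\<^sub>1))" "iso_arrow C (FAr \<Sigma> a)"
  "FAr \<Sigma> a' \<in> Hom C (FOb \<Sigma> (Src C l')) (FOb \<Sigma> (Src C l'\<^sub>1))" "iso_arrow C (FAr \<Sigma> a')"
  "FAr \<Sigma> u \<in> Hom C (FOb \<Sigma> (Tgt C l)) (FOb \<Sigma> (Tgt C l\<^sub>1))" "iso_arrow C (FAr \<Sigma> u)"
  using Susp.FAr_iso_arrow iso_homs iso by (auto simp del: Hom_iff simp add: Hom_def)

context
  fixes g' h' g'\<^sub>1 h'\<^sub>1
  assumes g'_hom: "g' \<in> Hom C (Tgt C m) (Tgt C g)"
    and h'_hom: "h' \<in> Hom C (Tgt C g) (FOb \<Sigma> (Src C l'))"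
    and g'\<^sub>1_hom: "g'\<^sub>1 \<in> Hom C (Tgt C m\<^sub>1) (Tgt C g\<^sub>1)"
    and h'\<^sub>1_hom: "h'\<^sub>1 \<in> Hom C (Tgt C g\<^sub>1) (FOb \<Sigma> (Src C l'\<^sub>1))"
    and cg'_eq: "c \<cdot> g' = g'\<^sub>1 \<cdot> d" and ah'_eq: "FAr \<Sigma> a' \<cdot> h' = h'\<^sub>1 \<cdot> c"
begin

lemma octahedral_triangles_transfer:
  assumes "h'\<^sub>1 \<cdot> g\<^sub>1 = n'\<^sub>1" "h\<^sub>1 \<cdot> g'\<^sub>1 = n\<^sub>1" "g'\<^sub>1 \<cdot> m\<^sub>1 = g\<^sub>1 \<cdot> m'\<^sub>1"
  shows "h' \<cdot> g = n'" "h \<cdot> g' = n" "g' \<cdot> m = g \<cdot> m'"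
proof -
  show "h' \<cdot> g = n'"
    by (rule commuting_triangle_transfer[OF _ h'_hom _ _ h'\<^sub>1_hom _ iso_homs(2,3) suspended_isos(3,4)
          squares(1) ah'_eq squares(8) assms(1)]) (use arrs in auto)
  show "h \<cdot> g' = n"
    by (rule commuting_triangle_transfer[OF g'_hom _ _ g'\<^sub>1_hom _ _ iso_homs(5,3) suspended_isos(1,2)
          cg'_eq squares(2,5) assms(2)]) (use arrs in auto)
  have cgm': "c \<cdot> (g \<cdot> m') = (g\<^sub>1 \<cdot> m'\<^sub>1) \<cdot> u"
    using arrs iso_homs by (simp add: squares(1)[THEN comp_reassoc] squares(7))
  show "g' \<cdot> m = g \<cdot> m'"
    by (rule commuting_triangle_transfer[OF _ g'_hom _ _ g'\<^sub>1_hom _ iso_homs(4,5,3) iso(2)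
          squares(4) cg'_eq cgm' assms(3)]) (use arrs in auto)
qed

lemma octahedral_sum_transfer:
  assumes "FAr \<Sigma> l\<^sub>1 \<cdot> h\<^sub>1 \<boxplus> FAr \<Sigma> l'\<^sub>1 \<cdot> h'\<^sub>1 = Zer C (Tgt C g\<^sub>1) (FOb \<Sigma> (Tgt C l\<^sub>1))"
  shows "FAr \<Sigma> l \<cdot> h \<boxplus> FAr \<Sigma> l' \<cdot> h' = Zer C (Tgt C g) (FOb \<Sigma> (Tgt C l))"
proof (rule iso_arrow_cancel_left[OF suspended_isos(6,5)])
  note arrs = arrs iso_homs h'_hom h'\<^sub>1_hom
  have \<Sigma>ul_eq: "FAr \<Sigma> u \<cdot> FAr \<Sigma> l = FAr \<Sigma> l\<^sub>1 \<cdot> FAr \<Sigma> a" "FAr \<Sigma> u \<cdot> FAr \<Sigma> l' = FAr \<Sigma> l'\<^sub>1 \<cdot> FAr \<Sigma> a'"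
    using arrs Susp.FAr_comp_eq[OF squares(3)] Susp.FAr_comp_eq[OF squares(6)] by simp_all
  have "FAr \<Sigma> u \<cdot> (FAr \<Sigma> l \<cdot> h \<boxplus> FAr \<Sigma> l' \<cdot> h') = (FAr \<Sigma> l\<^sub>1 \<cdot> h\<^sub>1 \<boxplus> FAr \<Sigma> l'\<^sub>1 \<cdot> h'\<^sub>1) \<cdot> c"
    using arrs by (simp add: \<Sigma>ul_eq[THEN comp_reassoc] squares(2) ah'_eq)
  also have "\<dots> = FAr \<Sigma> u \<cdot> Zer C (Tgt C g) (FOb \<Sigma> (Tgt C l))"
    unfolding assms using arrs by simp
  finally show "FAr \<Sigma> u \<cdot> (FAr \<Sigma> l \<cdot> h \<boxplus> FAr \<Sigma> l' \<cdot> h') =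
      FAr \<Sigma> u \<cdot> Zer C (Tgt C g) (FOb \<Sigma> (Tgt C l))" .
  show "FAr \<Sigma> l \<cdot> h \<boxplus> FAr \<Sigma> l' \<cdot> h' \<in> Hom C (Tgt C g) (FOb \<Sigma> (Tgt C l))"
    "Zer C (Tgt C g) (FOb \<Sigma> (Tgt C l)) \<in> Hom C (Tgt C g) (FOb \<Sigma> (Tgt C l))"
    using arrs by auto
qed

lemma octahedral_fourth_triangle_transfer:
  assumes "(m\<^sub>1 \<cdot> l'\<^sub>1, g'\<^sub>1, h'\<^sub>1) \<in> RT"
  shows "(m \<cdot> l', g', h') \<in> RT"
proof (rule triangle_isoI_rev[OF assms _ _ iso(5,4,2)])
  note arrs = arrs iso_homs g'_hom h'_hom g'\<^sub>1_hom h'\<^sub>1_hom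
  show "rdiagram C \<Sigma> (m \<cdot> l') g' h'" using arrs by (simp add: rdiagram_def)
  show "rmorphism C \<Sigma> (a', d, c) (m \<cdot> l', g', h') (m\<^sub>1 \<cdot> l'\<^sub>1, g'\<^sub>1, h'\<^sub>1)"
    using arrs by (simp add: rmorphism_def cg'_eq ah'_eq squares(4)[THEN comp_reassoc] squares(6))
qed

end

lemma octahedral_transfer:
  assumes octahedron: "octahedral C \<Sigma> RT (f\<^sub>1, g\<^sub>1, h\<^sub>1) (l\<^sub>1, m\<^sub>1, n\<^sub>1) (l'\<^sub>1, m'\<^sub>1, n'\<^sub>1)"
  shows "octahedral C \<Sigma> RT (f, g, h) (l, m, n) (l', m', n')"
proof -
  obtain g'\<^sub>1 h'\<^sub>1 where g'\<^sub>1_hom: "g'\<^sub>1 \<in> Hom C (Tgt C m\<^sub>1) (Tgt C g\<^sub>1)"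
    and h'\<^sub>1_hom: "h'\<^sub>1 \<in> Hom C (Tgt C g\<^sub>1) (FOb \<Sigma> (Src C l'\<^sub>1))"
    and triangles: "h'\<^sub>1 \<cdot> g\<^sub>1 = n'\<^sub>1" "h\<^sub>1 \<cdot> g'\<^sub>1 = n\<^sub>1" "g'\<^sub>1 \<cdot> m\<^sub>1 = g\<^sub>1 \<cdot> m'\<^sub>1"
    and sum: "FAr \<Sigma> l\<^sub>1 \<cdot> h\<^sub>1 \<boxplus> FAr \<Sigma> l'\<^sub>1 \<cdot> h'\<^sub>1 = Zer C (Tgt C g\<^sub>1) (FOb \<Sigma> (Tgt C l\<^sub>1))"
    and fourth: "(m\<^sub>1 \<cdot> l'\<^sub>1, g'\<^sub>1, h'\<^sub>1) \<in> RT"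
    by (rule octahedralE[OF octahedron])
  have "g'\<^sub>1 \<cdot> d \<in> Hom C (Tgt C m) (Tgt C g\<^sub>1)" using g'\<^sub>1_hom iso_homs by simp
  then obtain g' where g'_hom: "g' \<in> Hom C (Tgt C m) (Tgt C g)" and cg'_eq: "c \<cdot> g' = g'\<^sub>1 \<cdot> d"
    using iso_arrow_lift[OF iso(2) iso_homs(3)] by blast
  have "h'\<^sub>1 \<cdot> c \<in> Hom C (Tgt C g) (FOb \<Sigma> (Src C l'\<^sub>1))" using h'\<^sub>1_hom iso_homs by simp
  then obtain h' where h'_hom: "h' \<in> Hom C (Tgt C g) (FOb \<Sigma> (Src C l'))"
    and ah'_eq: "FAr \<Sigma> a' \<cdot> h' = h'\<^sub>1 \<cdot> c"
    using iso_arrow_lift[OF suspended_isos(4,3)] by blast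
  note induced = g'_hom h'_hom g'\<^sub>1_hom h'\<^sub>1_hom cg'_eq ah'_eq
  show ?thesis
    by (rule octahedralI[OF g'_hom h'_hom octahedral_triangles_transfer[OF induced triangles]
          octahedral_sum_transfer[OF induced sum] octahedral_fourth_triangle_transfer[OF induced
              fourth]])
qed

end

lemma (in pre_right_triangulation) octahedral_iso_closed:
  assumes fgh: "(f, g, h) \<in> RT" and lmn: "(l, m, n) \<in> RT" and lmn': "(l', m', n') \<in> RT"
    and match: "Src C l = Src C f" "Tgt C l' = Tgt C l" "Tgt C m' = Tgt C f" "m' \<cdot> l = f"
    and fgh\<^sub>1: "(f\<^sub>1, g\<^sub>1, h\<^sub>1) \<in> RT" and lmn\<^sub>1: "(l\<^sub>1, m\<^sub>1, n\<^sub>1) \<in> RT" and lmn'\<^sub>1: "(l'\<^sub>1, m'\<^sub>1, n'\<^sub>1) \<in> RT"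
    and match\<^sub>1: "Src C l\<^sub>1 = Src C f\<^sub>1" "Tgt C l'\<^sub>1 = Tgt C l\<^sub>1" "Tgt C m'\<^sub>1 = Tgt C f\<^sub>1" "m'\<^sub>1 \<cdot> l\<^sub>1 = f\<^sub>1"
    and a_iso: "a \<in> Hom C (Src C f) (Src C f\<^sub>1)" "iso_arrow C a"
    and u_iso: "u \<in> Hom C (Tgt C l) (Tgt C l\<^sub>1)" "iso_arrow C u" and ul_eq: "u \<cdot> l = l\<^sub>1 \<cdot> a"
    and aub: "rmorphism C \<Sigma> (a', u, b) (l', m', n') (l'\<^sub>1, m'\<^sub>1, n'\<^sub>1)" "iso_arrow C a'"
      "iso_arrow C b"
    and octahedron: "octahedral C \<Sigma> RT (f\<^sub>1, g\<^sub>1, h\<^sub>1) (l\<^sub>1, m\<^sub>1, n\<^sub>1) (l'\<^sub>1, m'\<^sub>1, n'\<^sub>1)"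
  shows "octahedral C \<Sigma> RT (f, g, h) (l, m, n) (l', m', n')"
proof -
  note arrs = triangle_arr[OF fgh] triangle_arr[OF lmn] triangle_arr[OF lmn'] match(1-3)
    triangle_arr[OF fgh\<^sub>1] triangle_arr[OF lmn\<^sub>1] triangle_arr[OF lmn'\<^sub>1] match\<^sub>1(1-3)
  have b_hom: "b \<in> Hom C (Tgt C f) (Tgt C f\<^sub>1)" and bm'_eq: "b \<cdot> m' = m'\<^sub>1 \<cdot> u"
    using aub(1) arrs by (auto simp: rmorphism_def)
  have "b \<cdot> f = m'\<^sub>1 \<cdot> u \<cdot> l"
    using arrs b_hom u_iso(1) comp_assoc_arr[of l m' b] by (simp add: match(4) bm'_eq)
  also have "\<dots> = f\<^sub>1 \<cdot> a" using arrs a_iso(1) u_iso(1) comp_assoc_arr[of a l\<^sub>1 m'\<^sub>1]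
    by (simp add: ul_eq match\<^sub>1(4))
  finally obtain c where abc: "rmorphism C \<Sigma> (a, b, c) (f, g, h) (f\<^sub>1, g\<^sub>1, h\<^sub>1)" "iso_arrow C c"
    using triangle_iso_completion[OF fgh fgh\<^sub>1 a_iso(1) b_hom _ a_iso(2) aub(3)] by blast
  have "a \<in> Hom C (Src C l) (Src C l\<^sub>1)" using a_iso(1) arrs by simp
  then obtain d where aud: "rmorphism C \<Sigma> (a, u, d) (l, m, n) (l\<^sub>1, m\<^sub>1, n\<^sub>1)" "iso_arrow C d"
    using triangle_iso_completion[OF lmn lmn\<^sub>1 _ u_iso(1) ul_eq a_iso(2) u_iso(2)] by blast
  interpret octahedral_input_iso C \<Sigma> RT f g h l m n l' m' n' f\<^sub>1 g\<^sub>1 h\<^sub>1 l\<^sub>1 m\<^sub>1 n\<^sub>1 l'\<^sub>1 m'\<^sub>1 n'\<^sub>1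
    a b c u d a'
    by unfold_locales (fact fgh lmn lmn' match fgh\<^sub>1 lmn\<^sub>1 lmn'\<^sub>1 match\<^sub>1 abc aud aub a_iso(2)
        u_iso(2))+
  show ?thesis using octahedral_transfer[OF octahedron] .
qed

section \<open>Right triangulations whose suspension is an equivalence\<close>

locale stable_right_triangulation = right_triangulation +
  assumes Sigma_full: "A \<in> Obj C \<Longrightarrow> B \<in> Obj C \<Longrightarrow> k \<in> Hom C (FOb \<Sigma> A) (FOb \<Sigma> B) \<Longrightarrow>
      \<exists>f \<in> Hom C A B. FAr \<Sigma> f = k"
    and Sigma_faithful: "f \<in> Hom C A B \<Longrightarrow> g \<in> Hom C A B \<Longrightarrow> FAr \<Sigma> f = FAr \<Sigma> g \<Longrightarrow> f = g"
    and Sigma_essentially_surjective: "B \<in> Obj C \<Longrightarrow> \<exists>A \<in> Obj C. isomorphic C (FOb \<Sigma> A) B"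

sublocale stable_right_triangulation \<subseteq> Equiv: fully_faithful_essentially_surjective C \<Sigma>
  by unfold_locales (fact Susp.F_endofunctor Sigma_full Sigma_faithful
      Sigma_essentially_surjective)+

context stable_right_triangulation
begin

text \<open>The third rotations of \<open>(f, g, h)\<close> and of a triangle on \<open>f\<close> are isomorphic, and the
  isomorphism desuspends.\<close>

lemma rotate_back:
  assumes diagram: "rdiagram C \<Sigma> f g h" and ghf: "(g, h, \<boxminus> FAr \<Sigma> f) \<in> RT"
  shows "(f, g, h) \<in> RT"
proof -
  let ?A = "Src C f" and ?B = "Tgt C f" and ?D = "Tgt C g"
  have f_hom: "f \<in> Arr C" using diagram by (simp add: rdiagram_def)
  then obtain g' h' where fgh': "(f, g', h') \<in> RT" using triangle_ex by blast
  note arrs = diagram[unfolded rdiagram_def] triangle_arr[OF fgh']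
  have rotated: "(\<boxminus> FAr \<Sigma> f, \<boxminus> FAr \<Sigma> g, \<boxminus> FAr \<Sigma> h) \<in> RT"
    using triangle_rotate[OF triangle_rotate[OF ghf]] .
  have rotated': "(\<boxminus> FAr \<Sigma> f, \<boxminus> FAr \<Sigma> g', \<boxminus> FAr \<Sigma> h') \<in> RT"
    using triangle_rotate[OF triangle_rotate[OF triangle_rotate[OF fgh']]] .
  obtain c where c_iso: "iso_arrow C c" and "rmorphism C \<Sigma> (Idn C (FOb \<Sigma> ?A), Idn C (FOb \<Sigma> ?B), c)
      (\<boxminus> FAr \<Sigma> f, \<boxminus> FAr \<Sigma> g', \<boxminus> FAr \<Sigma> h') (\<boxminus> FAr \<Sigma> f, \<boxminus> FAr \<Sigma> g, \<boxminus> FAr \<Sigma> h)"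
    by (rule triangle_iso_completion[OF rotated' rotated, of "Idn C (FOb \<Sigma> ?A)" "Idn C (FOb \<Sigma> ?B)"])
      (use arrs in auto)
  then have c_hom: "c \<in> Hom C (FOb \<Sigma> (Tgt C g')) (FOb \<Sigma> ?D)" and "\<boxminus> (c \<cdot> FAr \<Sigma> g') = \<boxminus> FAr \<Sigma> g"
    and "\<boxminus> FAr \<Sigma> h' = \<boxminus> (FAr \<Sigma> h \<cdot> c)"
    using arrs by (auto simp: rmorphism_def)
  then have cg_eq: "c \<cdot> FAr \<Sigma> g' = FAr \<Sigma> g" and hc_eq: "FAr \<Sigma> h' = FAr \<Sigma> h \<cdot> c"
    using arrs by (simp_all add: Neg_eq_iff)
  obtain k where k_spec: "k \<in> Hom C (Tgt C g') ?D" "FAr \<Sigma> k = c"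
    using Sigma_full[of "Tgt C g'" ?D c] arrs c_hom by auto
  have kg_eq: "k \<cdot> g' = g"
    using arrs k_spec cg_eq by - (rule Sigma_faithful[of _ ?B ?D], auto)
  have hk_eq: "h' = h \<cdot> k"
    using arrs k_spec hc_eq by - (rule Sigma_faithful[of _ "Tgt C g'" "FOb \<Sigma> ?A"], auto)
  show ?thesis
  proof (rule triangle_isoI[OF fgh' diagram])
    show "rmorphism C \<Sigma> (Idn C ?A, Idn C ?B, k) (f, g', h') (f, g, h)"
      using arrs k_spec kg_eq hk_eq by (auto simp: rmorphism_def)
    show "iso_arrow C k" using Equiv.reflects_iso[OF k_spec(1)] k_spec(2) c_iso by simp
  qed (use f_hom in auto)
qed

lemma ex_rotate_back:
  assumes fgh: "(f, g, h) \<in> RT"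
  obtains l \<theta> where "(l, f, \<theta> \<cdot> g) \<in> RT" "l \<in> Arr C" "Tgt C l = Src C f"
    "\<theta> \<in> Hom C (Tgt C g) (FOb \<Sigma> (Src C l))" "iso_arrow C \<theta>" "FAr \<Sigma> l \<cdot> \<theta> = \<boxminus> h"
proof -
  let ?A = "Src C f" and ?D = "Tgt C g"
  note arrs = triangle_arr[OF fgh]
  obtain L \<theta>' where L_obj: "L \<in> Obj C" and \<theta>'_iso: "\<theta>' \<in> Hom C (FOb \<Sigma> L) ?D" "iso_arrow C \<theta>'"
    using Sigma_essentially_surjective[of ?D] arrs by (auto simp: isomorphic_def)
  obtain \<theta> where \<theta>_iso: "\<theta> \<in> Hom C ?D (FOb \<Sigma> L)" "\<theta>' \<cdot> \<theta> = Idn C ?D" "iso_arrow C \<theta>"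
    using iso_arrowE[OF \<theta>'_iso(2,1)] by blast
  obtain l where l_spec: "l \<in> Hom C L ?A" "FAr \<Sigma> l = \<boxminus> (h \<cdot> \<theta>')"
    using Sigma_full[of L ?A "\<boxminus> (h \<cdot> \<theta>')"] arrs L_obj \<theta>'_iso by auto
  have l\<theta>_eq: "FAr \<Sigma> l \<cdot> \<theta> = \<boxminus> h" using arrs \<theta>'_iso(1) \<theta>_iso(1,2) by (simp add: l_spec(2))
  have "(f, \<theta> \<cdot> g, \<boxminus> FAr \<Sigma> l) \<in> RT"
  proof (rule triangle_isoI[OF fgh])
    show "rdiagram C \<Sigma> f (\<theta> \<cdot> g) (\<boxminus> FAr \<Sigma> l)"
      using arrs \<theta>_iso(1) l_spec(1) by (simp add: rdiagram_def)
    show "rmorphism C \<Sigma> (Idn C ?A, Idn C (Tgt C f), \<theta>) (f, g, h) (f, \<theta> \<cdot> g, \<boxminus> FAr \<Sigma> l)"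
      using arrs \<theta>_iso(1) l_spec(1) l\<theta>_eq by (simp add: rmorphism_def)
  qed (use arrs \<theta>_iso(3) in auto)
  then have "(l, f, \<theta> \<cdot> g) \<in> RT"
    using arrs \<theta>_iso(1) l_spec(1) by - (rule rotate_back, auto simp: rdiagram_def)
  then show thesis using that[of l \<theta>] \<theta>_iso l_spec(1) l\<theta>_eq by simp
qed

lemma identity_triangle:
  assumes N_zero: "zero_object C N" and A_obj: "A \<in> Obj C"
  shows "(Idn C A, Zer C A N, Zer C N (FOb \<Sigma> A)) \<in> RT"
proof (rule triangle_isoI[OF triangle_rotate[OF triangle_zero[OF N_zero A_obj]]])
  have objs: "N \<in> Obj C" "FOb \<Sigma> N \<in> Obj C" using N_zero by (auto simp: zero_object_iff)
  show "rdiagram C \<Sigma> (Idn C A) (Zer C A N) (Zer C N (FOb \<Sigma> A))"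
    using A_obj objs by (simp add: rdiagram_def)
  show "rmorphism C \<Sigma> (Idn C A, Idn C A, Zer C (FOb \<Sigma> N) N)
      (Idn C A, Zer C A (FOb \<Sigma> N), \<boxminus> FAr \<Sigma> (Zer C N A)) (Idn C A, Zer C A N, Zer C N (FOb \<Sigma> A))"
    using A_obj objs by (simp add: rmorphism_def)
  show "iso_arrow C (Zer C (FOb \<Sigma> N) N)"
    using iso_arrow_zero_objects[OF Susp.FOb_zero_object[OF N_zero] N_zero] .
qed (use A_obj in auto)

lemma octahedral_axiom:
  assumes f_triangle: "(f, f\<^sub>1, f\<^sub>2) \<in> RT" and g_triangle: "(g, g\<^sub>1, g\<^sub>2) \<in> RT"
    and gf_triangle: "(g \<cdot> f, k\<^sub>1, k\<^sub>2) \<in> RT"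
    and composable: "Src C g = Tgt C f"
  shows "\<exists>u \<in> Hom C (Tgt C f\<^sub>1) (Tgt C k\<^sub>1). \<exists>v \<in> Hom C (Tgt C k\<^sub>1) (Tgt C g\<^sub>1).
        (u, v, FAr \<Sigma> f\<^sub>1 \<cdot> g\<^sub>2) \<in> RT \<and>
        u \<cdot> f\<^sub>1 = k\<^sub>1 \<cdot> g \<and> k\<^sub>2 \<cdot> u = f\<^sub>2 \<and> v \<cdot> k\<^sub>1 = g\<^sub>1 \<and> g\<^sub>2 \<cdot> v = FAr \<Sigma> f \<cdot> k\<^sub>2"
proof -
  let ?V = "Tgt C g\<^sub>1" and ?U = "Tgt C k\<^sub>1" and ?R = "Tgt C f\<^sub>1"
  note arrs = triangle_arr[OF f_triangle] triangle_arr[OF g_triangle] composable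
  have k_hom: "k\<^sub>1 \<in> Hom C (Tgt C g) ?U" "k\<^sub>2 \<in> Hom C ?U (FOb \<Sigma> (Src C f))"
    using triangle_arr[OF gf_triangle] arrs by auto
  obtain l \<theta> where l_triangle: "(l, g, \<theta> \<cdot> g\<^sub>1) \<in> RT" "l \<in> Arr C" "Tgt C l = Src C g"
    and \<theta>_iso: "\<theta> \<in> Hom C ?V (FOb \<Sigma> (Src C l))" "iso_arrow C \<theta>" and l\<theta>_eq: "FAr \<Sigma> l \<cdot> \<theta> = \<boxminus> g\<^sub>2"
    using ex_rotate_back[OF g_triangle] by blast
  obtain u w where u_hom: "u \<in> Hom C ?R ?U" and w_hom: "w \<in> Hom C ?U (FOb \<Sigma> (Src C l))"
    and wk_eq: "w \<cdot> k\<^sub>1 = \<theta> \<cdot> g\<^sub>1" and ku_eq: "k\<^sub>2 \<cdot> u = f\<^sub>2" and uf_eq: "u \<cdot> f\<^sub>1 = k\<^sub>1 \<cdot> g"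
    and sum: "FAr \<Sigma> f \<cdot> k\<^sub>2 \<boxplus> FAr \<Sigma> l \<cdot> w = Zer C ?U (FOb \<Sigma> (Tgt C f))"
    and uw_triangle: "(f\<^sub>1 \<cdot> l, u, w) \<in> RT"
    using RTR4[OF gf_triangle f_triangle l_triangle(1)] arrs l_triangle(2,3) by auto
  obtain v where v_hom: "v \<in> Hom C ?U ?V" and \<theta>v_eq: "\<theta> \<cdot> v = w"
    using iso_arrow_lift[OF \<theta>_iso(2,1) w_hom] by blast
  have lw_eq: "FAr \<Sigma> l \<cdot> w = \<boxminus> (g\<^sub>2 \<cdot> v)"
    using arrs l_triangle \<theta>_iso(1) v_hom by (simp add: \<theta>v_eq[symmetric] l\<theta>_eq[THEN comp_reassoc])
  have "(u, v, FAr \<Sigma> f\<^sub>1 \<cdot> g\<^sub>2) \<in> RT"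
  proof (rule triangle_isoI_rev[OF triangle_rotate[OF uw_triangle]])
    show "rdiagram C \<Sigma> u v (FAr \<Sigma> f\<^sub>1 \<cdot> g\<^sub>2)" using arrs u_hom v_hom by (simp add: rdiagram_def)
    show "rmorphism C \<Sigma> (Idn C ?R, Idn C ?U, \<theta>) (u, v, FAr \<Sigma> f\<^sub>1 \<cdot> g\<^sub>2) (u, w, \<boxminus> FAr \<Sigma> (f\<^sub>1 \<cdot> l))"
      using arrs \<theta>_iso(1) u_hom v_hom w_hom l_triangle k_hom
      by (simp add: rmorphism_def \<theta>v_eq l\<theta>_eq)
  qed (use arrs u_hom k_hom \<theta>_iso(2) in auto)
  moreover have "v \<cdot> k\<^sub>1 = g\<^sub>1"
  proof (rule iso_arrow_cancel_left[OF \<theta>_iso(2,1)])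
    show "\<theta> \<cdot> (v \<cdot> k\<^sub>1) = \<theta> \<cdot> g\<^sub>1"
      using \<theta>_iso(1) v_hom k_hom wk_eq by (simp add: \<theta>v_eq[THEN comp_reassoc])
  qed (use arrs v_hom k_hom in auto)
  moreover have "g\<^sub>2 \<cdot> v = FAr \<Sigma> f \<cdot> k\<^sub>2"
    using arrs v_hom k_hom sum lw_eq
    by - (rule eq_if_diff_Zer[symmetric, of _ ?U "FOb \<Sigma> (Tgt C f)"], auto)
  ultimately show ?thesis using u_hom v_hom uf_eq ku_eq by blast
qed

theorem triangulated: "triangulated_category C \<Sigma> RT"
proof unfold_locales
  show "rdiagram C \<Sigma> f g h \<Longrightarrow> (f, g, h) \<in> RT \<longleftrightarrow> (g, h, \<boxminus> FAr \<Sigma> f) \<in> RT" for f g h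
    using triangle_rotate rotate_back by blast
qed (fact Sigma_additive Equiv.autoequivalence triangle_diagram triangle_iso_closed
    identity_triangle
    triangle_ex triangle_completion | rule octahedral_axiom; assumption)+

end

section \<open>Duality\<close>

context category
begin

lemma isomorphic_sym: "isomorphic C A B \<Longrightarrow> isomorphic C B A"
  unfolding isomorphic_def using iso_arrowE by metis

end

definition dual_category :: "('o, 'm, 'b) pt_cat_scheme \<Rightarrow> ('o, 'm, 'b) pt_cat_scheme" where
  "dual_category C = C\<lparr>Src := Tgt C, Tgt := Src C, Comp := (\<lambda>g f. f \<cdot>\<^bsub>C\<^esub> g), Zer := (\<lambda>A B. Zer C B A),
     Sig := Ome C, RTri := {(f, g, h). (h, g, f) \<in> LTri C},
     Ome := Sig C, LTri := {(e, f, g). (g, f, e) \<in> RTri C},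
     Psi := (\<lambda>A B. Psi_inv C B A)\<rparr>"

lemma dual_category_select [simp]:
  "Obj (dual_category C) = Obj C" "Arr (dual_category C) = Arr C"
  "Src (dual_category C) = Tgt C" "Tgt (dual_category C) = Src C"
  "Idn (dual_category C) = Idn C" "g \<cdot>\<^bsub>dual_category C\<^esub> f = f \<cdot>\<^bsub>C\<^esub> g"
  "Plus (dual_category C) = Plus C" "Zer (dual_category C) A B = Zer C B A"
  "Sig (dual_category C) = Ome C" "Ome (dual_category C) = Sig C"
  "(f, g, h) \<in> RTri (dual_category C) \<longleftrightarrow> (h, g, f) \<in> LTri C"
  "(f, g, h) \<in> LTri (dual_category C) \<longleftrightarrow> (h, g, f) \<in> RTri C"
  "Psi (dual_category C) A B = Psi_inv C B A"
  by (simp_all add: dual_category_def)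

lemma dual_Hom [simp]: "Hom (dual_category C) A B = Hom C B A"
  by (auto simp: Hom_def)

lemma dual_hom_group [simp]: "hom_group (dual_category C) A B = hom_group C B A"
  by (simp add: hom_group_def)

lemma dual_Neg [simp]: "Neg (dual_category C) = Neg C"
  by (simp add: Neg_def fun_eq_iff)

lemma dual_iso_arrow [simp]: "iso_arrow (dual_category C) = iso_arrow C"
  by (auto simp: iso_arrow_def fun_eq_iff)

lemma dual_isomorphic [simp]: "isomorphic (dual_category C) A B \<longleftrightarrow> isomorphic C B A"
  by (simp add: isomorphic_def)

lemma dual_zero_object [simp]: "zero_object (dual_category C) = zero_object C"
  by (auto simp: zero_object_def fun_eq_iff)

lemma dual_biproduct [simp]: "biproduct (dual_category C) A B P \<longleftrightarrow> biproduct C A B P"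
  unfolding biproduct_def by (simp, blast)

lemma dual_endofunctor [simp]: "endofunctor (dual_category C) = endofunctor C"
  by (auto simp: endofunctor_def fun_eq_iff)

lemma dual_additive_endofunctor [simp]:
  "additive_endofunctor (dual_category C) = additive_endofunctor C"
  unfolding additive_endofunctor_def fun_eq_iff by (simp, blast)

lemma dual_factors_through [simp]: "factors_through (dual_category C) J = factors_through C J"
  unfolding factors_through_def fun_eq_iff by (simp, blast)

lemma dual_null_arrow [simp]: "null_arrow (dual_category C) = null_arrow C"
  by (simp add: null_arrow_def fun_eq_iff)

lemma dual_Sigma_epic [simp]: "Sigma_epic (dual_category C) F f \<longleftrightarrow> Omega_monic C F f"
  by (simp add: Sigma_epic_def Omega_monic_def)

lemma dual_Omega_monic [simp]: "Omega_monic (dual_category C) F f \<longleftrightarrow> Sigma_epic C F f"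
  by (simp add: Sigma_epic_def Omega_monic_def)

lemma dual_rdiagram [simp]: "rdiagram (dual_category C) F f g h \<longleftrightarrow> ldiagram C F h g f"
  by (auto simp: rdiagram_def ldiagram_def)

lemma dual_ldiagram [simp]: "ldiagram (dual_category C) F e f g \<longleftrightarrow> rdiagram C F g f e"
  by (auto simp: rdiagram_def ldiagram_def)

lemma dual_rmorphism:
  assumes "ldiagram C F e f g" "ldiagram C F e' f' g'"
  shows "rmorphism (dual_category C) F (c, b, a) (g', f', e') (g, f, e) \<longleftrightarrow>
    lmorphism C F (a, b, c) (e, f, g) (e', f', g')"
  using assms by (auto simp: rmorphism_def lmorphism_def ldiagram_def)

lemma dual_lmorphism:
  assumes "rdiagram C F f g h" "rdiagram C F f' g' h'"
  shows "lmorphism (dual_category C) F (c, b, a) (h', g', f') (h, g, f) \<longleftrightarrow>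
    rmorphism C F (a, b, c) (f, g, h) (f', g', h')"
  using assms by (auto simp: rmorphism_def lmorphism_def rdiagram_def)

lemma dual_risomorphic:
  assumes "ldiagram C F e f g" "ldiagram C F e' f' g'"
  shows "risomorphic (dual_category C) F (g', f', e') (g, f, e) \<longleftrightarrow>
    lisomorphic C F (e, f, g) (e', f', g')"
  unfolding risomorphic_def lisomorphic_def dual_rmorphism[OF assms, symmetric] by auto

lemma dual_lisomorphic:
  assumes "rdiagram C F f g h" "rdiagram C F f' g' h'"
  shows "lisomorphic (dual_category C) F (h', g', f') (h, g, f) \<longleftrightarrow>
    risomorphic C F (f, g, h) (f', g', h')"
  unfolding risomorphic_def lisomorphic_def dual_lmorphism[OF assms, symmetric] by auto

sublocale left_triangulation \<subseteq> Loop: shifted_category C \<Omega>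
  by unfold_locales (rule Omega_additive)

context pseudo_triangulated
begin

abbreviation "\<Sigma>\<^sub>0 \<equiv> FOb (Sig C)"
abbreviation "\<Omega>\<^sub>0 \<equiv> FOb (Ome C)"
abbreviation "\<Sigma>\<^sub>1 \<equiv> FAr (Sig C)"
abbreviation "\<Omega>\<^sub>1 \<equiv> FAr (Ome C)"

lemma Psi_hom:
  assumes "x \<in> Hom C (\<Omega>\<^sub>0 A) B" "A \<in> Obj C"
  shows "Psi C A B x \<in> Hom C A (\<Sigma>\<^sub>0 B)"
  using Psi_bij[of A B] assms Hom_objD[OF assms(1)] by (blast dest: bij_betwE)

lemma Psi_inv_hom:
  assumes "y \<in> Hom C A (\<Sigma>\<^sub>0 B)" "B \<in> Obj C"
  shows "Psi_inv C A B y \<in> Hom C (\<Omega>\<^sub>0 A) B" "Psi C A B (Psi_inv C A B y) = y"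
  using Psi_bij[of A B] assms Hom_objD[OF assms(1)] unfolding Psi_inv_def bij_betw_def
  by (metis inv_into_into, metis f_inv_into_f)

lemma Psi_inj:
  assumes "x \<in> Hom C (\<Omega>\<^sub>0 A) B" "y \<in> Hom C (\<Omega>\<^sub>0 A) B" "A \<in> Obj C" "Psi C A B x = Psi C A B y"
  shows "x = y"
  using Psi_bij[of A B] assms Hom_objD[OF assms(1)] unfolding bij_betw_def by (blast dest: inj_onD)

lemma Psi_inv_Psi:
  assumes "x \<in> Hom C (\<Omega>\<^sub>0 A) B" "A \<in> Obj C"
  shows "Psi_inv C A B (Psi C A B x) = x"
  using Psi_bij[of A B] assms Hom_objD[OF assms(1)] unfolding Psi_inv_def bij_betw_def by simp

lemma dual_Psi_inv:
  assumes "x \<in> Hom C (\<Omega>\<^sub>0 A) B" "A \<in> Obj C"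
  shows "Psi_inv (dual_category C) B A x = Psi C A B x"
  using inv_into_inv_into_eq[OF Psi_bij[of A B], of x] assms Hom_objD[OF assms(1)]
  by (simp add: Psi_inv_def)

lemma Psi_comp:
  assumes "x \<in> Hom C (\<Omega>\<^sub>0 A) B" "A \<in> Obj C"
  shows "b \<in> Hom C B B' \<Longrightarrow> Psi C A B' (b \<cdot> x) = \<Sigma>\<^sub>1 b \<cdot> Psi C A B x"
    and "a \<in> Hom C A' A \<Longrightarrow> Psi C A' B (x \<cdot> \<Omega>\<^sub>1 a) = Psi C A B x \<cdot> a"
proof -
  have B_obj: "B \<in> Obj C" using Hom_objD assms by blast
  note Psi_x = Psi_hom[OF assms]
  show "Psi C A B' (b \<cdot> x) = \<Sigma>\<^sub>1 b \<cdot> Psi C A B x" if b_hom: "b \<in> Hom C B B'"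
    using Psi_natural[of A B A B' x "Idn C A" b] assms B_obj Hom_objD[OF b_hom] b_hom Psi_x by simp
  show "Psi C A' B (x \<cdot> \<Omega>\<^sub>1 a) = Psi C A B x \<cdot> a" if a_hom: "a \<in> Hom C A' A"
    using Psi_natural[of A B A' B x a "Idn C B"] assms B_obj Hom_objD[OF a_hom] a_hom Psi_x by simp
qed

lemma Psi_Neg:
  assumes x_hom: "x \<in> Hom C (\<Omega>\<^sub>0 A) B" and A_obj: "A \<in> Obj C"
  shows "Psi C A B (\<boxminus> x) = \<boxminus> Psi C A B x"
proof -
  have B_obj: "B \<in> Obj C" using Hom_objD x_hom by blast
  have "\<boxminus> x = \<boxminus> Idn C B \<cdot> x" using x_hom B_obj by simp
  then show ?thesis
    using Psi_comp(1)[OF x_hom A_obj, of "\<boxminus> Idn C B" B] Psi_hom[OF x_hom A_obj] x_hom B_obj by simp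
qed

lemma Psi_inv_comp:
  assumes "x \<in> Hom C B (\<Sigma>\<^sub>0 A)" "a \<in> Hom C A A'" "b \<in> Hom C B' B"
  shows "Psi_inv C B' A' (\<Sigma>\<^sub>1 a \<cdot> x \<cdot> b) = a \<cdot> Psi_inv C B A x \<cdot> \<Omega>\<^sub>1 b"
proof -
  have objs: "A \<in> Obj C" "B \<in> Obj C" "A' \<in> Obj C" "B' \<in> Obj C"
    using assms Hom_objD by blast+
  note Psi_inv_x = Psi_inv_hom[OF assms(1) objs(1)]
  have "a \<cdot> Psi_inv C B A x \<cdot> \<Omega>\<^sub>1 b \<in> Hom C (\<Omega>\<^sub>0 B') A'" using Psi_inv_x(1) assms by simp
  moreover have "Psi C B' A' (a \<cdot> Psi_inv C B A x \<cdot> \<Omega>\<^sub>1 b) = \<Sigma>\<^sub>1 a \<cdot> x \<cdot> b"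
    using Psi_natural[OF objs(2,1,4,3) Psi_inv_x(1) assms(3,2)] by (simp add: Psi_inv_x(2))
  ultimately show ?thesis using Psi_inv_Psi objs(4) by metis
qed

lemma dual_preadditive_category: "preadditive_category (dual_category C)"
  by (intro preadditive_category.intro category.intro preadditive_category_axioms.intro)
    (auto simp: hom_comm_group)

lemma dual_additive_category: "additive_category (dual_category C)"
proof -
  interpret dual: preadditive_category "dual_category C" by (rule dual_preadditive_category)
  show ?thesis
    by unfold_locales (use ex_zero_object ex_biproduct in auto)
qed

lemma dual_right_triangulation:
  "right_triangulation (dual_category C) (Sig (dual_category C)) (RTri (dual_category C))"
proof -
  interpret dual: additive_category "dual_category C" by (rule dual_additive_category)
  interpret dual: shifted_category "dual_category C" "Ome C"
    by unfold_locales (simp add: Omega_additive)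
  show ?thesis
  proof unfold_locales
    fix f g h f' g' h'
    assume hgf: "(f, g, h) \<in> RTri (dual_category C)"
      and diagram': "rdiagram (dual_category C) (Sig (dual_category C)) f' g' h'"
      and iso: "risomorphic (dual_category C) (Sig (dual_category C)) (f, g, h) (f', g', h')"
    then have diagrams: "ldiagram C (Ome C) h g f" "ldiagram C (Ome C) h' g' f'"
      using LT_diagram by simp_all
    have "lisomorphic C (Ome C) (h, g, f) (h', g', f')"
      using dual.risomorphic_sym[of f g h f' g' h'] diagrams iso dual_risomorphic[OF diagrams]
      by simp
    then show "(f', g', h') \<in> RTri (dual_category C)"
      using LT_iso_closed[of h g f] hgf diagrams by simp
  next
    fix f g h f' g' h' a b
    assume tri: "(f, g, h) \<in> RTri (dual_category C)" "(f', g', h') \<in> RTri (dual_category C)"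
      and ab_spec: "a \<in> Hom (dual_category C) (Src (dual_category C) f) (Src (dual_category C) f')"
      "b \<in> Hom (dual_category C) (Tgt (dual_category C) f) (Tgt (dual_category C) f')"
      "b \<cdot>\<^bsub>dual_category C\<^esub> f = f' \<cdot>\<^bsub>dual_category C\<^esub> a"
    have "\<exists>c. lmorphism C (Ome C) (c, b, a) (h', g', f') (h, g, f)"
      using tri ab_spec by (intro LTR3) simp_all
    then show "\<exists>c. rmorphism (dual_category C) (Sig (dual_category C)) (a, b, c)
        (f, g, h) (f', g', h')"
      using dual_rmorphism[OF LT_diagram LT_diagram] tri by simp
  next
    fix f assume "f \<in> Arr (dual_category C)"
    then show "\<exists>g h. (f, g, h) \<in> RTri (dual_category C)" using LTR1_ex[of f] by auto
  qed (use Omega_additive LT_diagram LTR1_id LTR2 LTR4 in simp_all)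
qed

lemma dual_left_triangulation:
  "left_triangulation (dual_category C) (Ome (dual_category C)) (LTri (dual_category C))"
proof -
  interpret dual: additive_category "dual_category C" by (rule dual_additive_category)
  show ?thesis
  proof unfold_locales
    fix e f g e' f' g'
    assume gfe: "(e, f, g) \<in> LTri (dual_category C)"
      and diagram': "ldiagram (dual_category C) (Ome (dual_category C)) e' f' g'"
      and iso: "lisomorphic (dual_category C) (Ome (dual_category C)) (e, f, g) (e', f', g')"
    then have diagrams: "rdiagram C (Sig C) g f e" "rdiagram C (Sig C) g' f' e'"
      using RT_diagram by simp_all
    have "risomorphic C (Sig C) (g, f, e) (g', f', e')"
      using Susp.risomorphic_sym[OF diagrams(2,1)] iso dual_lisomorphic[OF diagrams(2,1)] by simp
    then show "(e', f', g') \<in> LTri (dual_category C)"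
      using RT_iso_closed[of g f e] gfe diagrams by simp
  next
    fix e f g e' f' g' b c
    assume tri: "(e, f, g) \<in> LTri (dual_category C)" "(e', f', g') \<in> LTri (dual_category C)"
      and bc_spec: "b \<in> Hom (dual_category C) (Src (dual_category C) g) (Src (dual_category C) g')"
      "c \<in> Hom (dual_category C) (Tgt (dual_category C) g) (Tgt (dual_category C) g')"
      "c \<cdot>\<^bsub>dual_category C\<^esub> g = g' \<cdot>\<^bsub>dual_category C\<^esub> b"
    have "\<exists>a. rmorphism C (Sig C) (c, b, a) (g', f', e') (g, f, e)"
      using tri bc_spec by (intro RTR3) simp_all
    then show "\<exists>a. lmorphism (dual_category C) (Ome (dual_category C)) (a, b, c)
        (e, f, g) (e', f', g')"
      using dual_lmorphism[OF RT_diagram RT_diagram] tri by simp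
  next
    fix g assume "g \<in> Arr (dual_category C)"
    then show "\<exists>e f. (e, f, g) \<in> LTri (dual_category C)" using RTR1_ex[of g] by auto
  qed (use Sigma_additive RT_diagram RTR1_id RTR2 RTR4 in simp_all)
qed

theorem dual_pseudo_triangulated: "pseudo_triangulated (dual_category C)"
proof (intro pseudo_triangulated.intro pseudo_triangulated_axioms.intro
    dual_right_triangulation dual_left_triangulation; simp only: dual_category_select dual_Hom)
  show "bij_betw (Psi_inv C B A) (Hom C B (\<Sigma>\<^sub>0 A)) (Hom C (\<Omega>\<^sub>0 B) A)"
    if "A \<in> Obj C" "B \<in> Obj C" for A B
    unfolding Psi_inv_def using bij_betw_inv_into[OF Psi_bij[OF that(2,1)]] .
  show "Psi_inv C B' A' ((\<Sigma>\<^sub>1 a \<cdot> x) \<cdot> b) = (a \<cdot> Psi_inv C B A x) \<cdot> \<Omega>\<^sub>1 b"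
    if "A \<in> Obj C" "x \<in> Hom C B (\<Sigma>\<^sub>0 A)" "a \<in> Hom C A A'" "b \<in> Hom C B' B" for A B A' B' x a b
    using Psi_inv_comp[OF that(2-4)] Psi_inv_hom(1)[OF that(2,1)] that by simp
next
  fix g e f g' h'
  assume g_Sigma_epic: "Sigma_epic (dual_category C) (Ome C) g" and gfe: "(g, f, e) \<in> RTri C"
    and hgf: "(h', g', f) \<in> LTri C"
  obtain a where "a \<in> Hom C (Src C g) (Src C g')" "iso_arrow C a" "g' \<cdot> a = g"
    "\<boxminus> (a \<cdot> Psi_inv C (Tgt C f) (Src C g) e) = h'"
    using G2[OF _ gfe hgf] g_Sigma_epic by auto
  moreover have "Psi_inv C (Tgt C f) (Src C g) e \<in> Hom C (\<Omega>\<^sub>0 (Tgt C f)) (Src C g)"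
    using triangle_arr[OF gfe] by (intro Psi_inv_hom) auto
  ultimately show "\<exists>c\<in>Hom C (Src C g) (Src C g'). iso_arrow (dual_category C) c \<and> g' \<cdot> c = g \<and>
      c \<cdot> \<boxminus>\<^bsub>dual_category C\<^esub> Psi_inv C (Tgt C f) (Src C g) e = h'"
    by (auto intro!: bexI[of _ a])
next
  fix f g h e' f'
  assume f_Omega_monic: "Omega_monic (dual_category C) (Sig C) f" and hgf: "(h, g, f) \<in> LTri C"
    and gfe: "(g, f', e') \<in> RTri C"
  have h_spec: "h \<in> Hom C (\<Omega>\<^sub>0 (Tgt C f)) (Src C g)" "Tgt C f \<in> Obj C"
    using LT_diagram[OF hgf] by (auto simp: ldiagram_def)
  obtain c where "c \<in> Hom C (Tgt C f') (Tgt C f)" "iso_arrow C c" "c \<cdot> f' = f"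
    "(\<boxminus> Psi C (Tgt C f) (Src C g) h) \<cdot> c = e'"
    using G1[OF _ hgf gfe] f_Omega_monic by auto
  then show "\<exists>a\<in>Hom C (Tgt C f') (Tgt C f). iso_arrow (dual_category C) a \<and> a \<cdot> f' = f \<and>
      \<boxminus>\<^bsub>dual_category C\<^esub> (Psi_inv (dual_category C) (Src C g) (Tgt C f) h \<cdot> a) = e'"
    using Psi_hom[OF h_spec] by (auto simp: dual_Psi_inv[OF h_spec] intro!: bexI[of _ c])
qed

lemma left_triangle_arr:
  assumes "(e, f, g) \<in> LTri C"
  shows "e \<in> Arr C" "f \<in> Arr C" "g \<in> Arr C" "Src C f = Tgt C e" "Src C g = Tgt C f"
    "Src C e = \<Omega>\<^sub>0 (Tgt C g)"
  using LT_diagram[OF assms] by (auto simp: ldiagram_def)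

lemma left_triangle_isoI:
  assumes "(e, f, g) \<in> LTri C" "ldiagram C (Ome C) e' f' g'"
    "lmorphism C (Ome C) (a, b, c) (e, f, g) (e', f', g')" "iso_arrow C a" "iso_arrow C b"
      "iso_arrow C c"
  shows "(e', f', g') \<in> LTri C"
  using LT_iso_closed[OF assms(1,2)] assms(3-) unfolding lisomorphic_def by blast

lemma weak_kernel:
  assumes efg: "(e, f, g) \<in> LTri C" and b_zero: "b \<in> Hom C W (Src C g)" "g \<cdot> b = Zer C W (Tgt C g)"
  obtains a where "a \<in> Hom C W (Src C f)" "f \<cdot> a = b"
proof -
  interpret dual: pseudo_triangulated "dual_category C" by (rule dual_pseudo_triangulated)
  show thesis using dual.weak_cokernel[of g f e b W] that efg b_zero by auto
qed

lemma weak_kernel_second: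
  assumes efg: "(e, f, g) \<in> LTri C" and b_zero: "b \<in> Hom C W (Src C f)" "f \<cdot> b = Zer C W (Tgt C f)"
  obtains a where "a \<in> Hom C W (\<Omega>\<^sub>0 (Tgt C g))" "e \<cdot> a = b"
proof -
  interpret dual: pseudo_triangulated "dual_category C" by (rule dual_pseudo_triangulated)
  show thesis using dual.weak_cokernel_second[of g f e b W] that efg b_zero
    left_triangle_arr[OF efg] by auto
qed

lemma left_triangle_comp_zero:
  assumes efg: "(e, f, g) \<in> LTri C"
  shows "g \<cdot> f = Zer C (Src C f) (Tgt C g)" "f \<cdot> e = Zer C (\<Omega>\<^sub>0 (Tgt C g)) (Tgt C f)"
proof -
  interpret dual: pseudo_triangulated "dual_category C" by (rule dual_pseudo_triangulated)
  show "g \<cdot> f = Zer C (Src C f) (Tgt C g)" "f \<cdot> e = Zer C (\<Omega>\<^sub>0 (Tgt C g)) (Tgt C f)"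
    using dual.comp_zero_first[of g f e] dual.comp_zero_second[of g f e] efg
      left_triangle_arr[OF efg]
    by simp_all
qed

end

section \<open>Extensions\<close>

definition extensions :: "('o, 'm, 'b) pt_cat_scheme \<Rightarrow> ('m \<times> 'm \<times> 'm) set" where
  "extensions C = {(f, g, h). \<exists>e. extension C e f g h}"

lemma extensions_iff: "(f, g, h) \<in> extensions C \<longleftrightarrow> (\<exists>e. extension C e f g h)"
  by (simp add: extensions_def)

context additive_category
begin

lemma null_arrowI:
  assumes "X \<in> Obj C" "x \<in> Hom C A (FOb F X)" "y \<in> Hom C (FOb F X) B"
  shows "null_arrow C F (y \<cdot> x)"
  unfolding null_arrow_def
  by (rule factors_throughI[of "FOb F X" _ x A y B]) (use assms in auto)

lemma null_arrow_Plus: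
  assumes F_functor: "additive_endofunctor C F" and "null_arrow C F f" "null_arrow C F g"
    "Src C g = Src C f" "Tgt C g = Tgt C f"
  shows "null_arrow C F (f \<boxplus> g)"
proof -
  interpret shifted_category C F by unfold_locales (rule F_functor)
  have "\<exists>P \<in> FOb F ` Obj C. biproduct C X Y P"
    if X_suspended: "X \<in> FOb F ` Obj C" and Y_suspended: "Y \<in> FOb F ` Obj C" for X Y
  proof -
    obtain A B where preimages: "A \<in> Obj C" "B \<in> Obj C" "X = FOb F A" "Y = FOb F B"
      using X_suspended Y_suspended by blast
    obtain P where P_biproduct: "biproduct C A B P" using ex_biproduct preimages by blast
    then obtain i j p q where P_arrows: "biproduct_arrows C A B P i j p q"
      unfolding biproduct_iff by blast
    then have "biproduct C X Y (FOb F P)"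
      using FAr_biproduct[OF P_arrows] preimages unfolding biproduct_iff by blast
    then show ?thesis using P_biproduct unfolding biproduct_def by blast
  qed
  then show ?thesis using factors_through_Plus assms(2-) unfolding null_arrow_def by blast
qed

lemma null_arrow_Zer:
  assumes F_functor: "additive_endofunctor C F" and "A \<in> Obj C" "B \<in> Obj C"
  shows "null_arrow C F (Zer C A B)"
proof -
  interpret shifted_category C F by unfold_locales (rule F_functor)
  show ?thesis
    using null_arrowI[of A "Zer C A (FOb F A)" A F "Zer C (FOb F A) B" B] assms by simp
qed

end

context pseudo_triangulated
begin

lemma extension_triangle: "(f, g, h) \<in> extensions C \<Longrightarrow> (f, g, h) \<in> RTri C"
  by (auto simp: extensions_iff extension_def)

lemmas extension_arr = triangle_arr[OF extension_triangle]

lemma extensionD: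
  assumes "extension C e f g h"
  shows "(f, g, h) \<in> RTri C" "(e, f, g) \<in> LTri C" "h = \<boxminus> Psi C (Tgt C g) (Src C f) e"
  using assms by (auto simp: extension_def)

lemma dual_extension: "extension (dual_category C) h g f e \<longleftrightarrow> extension C e f g h"
proof -
  have "h = \<boxminus> Psi C (Tgt C g) (Src C f) e \<longleftrightarrow> e = \<boxminus> Psi_inv C (Tgt C g) (Src C f) h"
    if fgh: "(f, g, h) \<in> RTri C" and efg: "(e, f, g) \<in> LTri C"
  proof -
    let ?A = "Src C f" and ?D = "Tgt C g"
    have e_hom: "e \<in> Hom C (\<Omega>\<^sub>0 ?D) ?A" and h_hom: "h \<in> Hom C ?D (\<Sigma>\<^sub>0 ?A)"
      and objs: "?A \<in> Obj C" "?D \<in> Obj C"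
      using triangle_arr[OF fgh] left_triangle_arr[OF efg] by auto
    note Psi_inv_x = Psi_inv_hom[OF h_hom objs(1)]
    have "h = \<boxminus> Psi C ?D ?A e \<longleftrightarrow> Psi C ?D ?A (\<boxminus> e) = h"
      using Psi_Neg[OF e_hom objs(2)] by auto
    also have "\<dots> \<longleftrightarrow> \<boxminus> e = Psi_inv C ?D ?A h"
      using Psi_inj[of "\<boxminus> e" ?D ?A "Psi_inv C ?D ?A h"] e_hom Psi_inv_x objs by auto
    also have "\<dots> \<longleftrightarrow> e = \<boxminus> Psi_inv C ?D ?A h" 
      using e_hom Psi_inv_x(1) Neg_eq_iff[of "\<boxminus> e" "Psi_inv C ?D ?A h"] by simp
    finally show ?thesis .
  qed
  then show ?thesis by (auto simp: extension_def)
qed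

lemma extension_rmorphism_iff_dual:
  assumes extension: "extension C e f g h" and extension': "extension C e' f' g' h'"
  shows "rmorphism (dual_category C) (Sig (dual_category C)) (c, b, a) (g', f', e') (g, f, e) \<longleftrightarrow>
    rmorphism C (Sig C) (a, b, c) (f, g, h) (f', g', h')"
proof -
  let ?A = "Src C f" and ?D = "Tgt C g" and ?A' = "Src C f'" and ?D' = "Tgt C g'"
  note arrs = triangle_arr[OF extensionD(1)[OF extension]]
    left_triangle_arr[OF extensionD(2)[OF extension]]
    triangle_arr[OF extensionD(1)[OF extension']] left_triangle_arr[OF extensionD(2)[OF extension']]
  have e_spec: "e \<in> Hom C (\<Omega>\<^sub>0 ?D) ?A" "?D \<in> Obj C"
    and e'_spec: "e' \<in> Hom C (\<Omega>\<^sub>0 ?D') ?A'" "?D' \<in> Obj C"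
    using arrs by auto
  note Psi_e = Psi_hom[OF e_spec] and Psi_e' = Psi_hom[OF e'_spec]
  have "\<Sigma>\<^sub>1 a \<cdot> h = h' \<cdot> c \<longleftrightarrow> a \<cdot> e = e' \<cdot> \<Omega>\<^sub>1 c"
    if a_hom: "a \<in> Hom C ?A ?A'" and c_hom: "c \<in> Hom C ?D ?D'"
  proof -
    have ae_hom: "a \<cdot> e \<in> Hom C (\<Omega>\<^sub>0 ?D) ?A'" and ec_hom: "e' \<cdot> \<Omega>\<^sub>1 c \<in> Hom C (\<Omega>\<^sub>0 ?D) ?A'"
      using e_spec e'_spec a_hom c_hom by auto
    have "\<Sigma>\<^sub>1 a \<cdot> h = \<boxminus> Psi C ?D ?A' (a \<cdot> e)"
      using Psi_e a_hom Psi_comp(1)[OF e_spec a_hom] by (simp add: extensionD(3)[OF extension])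
    moreover have "h' \<cdot> c = \<boxminus> Psi C ?D ?A' (e' \<cdot> \<Omega>\<^sub>1 c)"
      using Psi_e' c_hom Psi_comp(2)[OF e'_spec c_hom] by (simp add: extensionD(3)[OF extension'])
    ultimately show ?thesis
      using Psi_hom[OF ae_hom e_spec(2)] Psi_hom[OF ec_hom e_spec(2)]
        Psi_inj[OF ae_hom ec_hom e_spec(2)] Neg_eq_iff by auto
  qed
  then show ?thesis
    using arrs by (auto simp: rmorphism_def)
qed

lemma extension_of_Omega_monic:
  assumes fgh: "(f, g, h) \<in> RTri C" and f_Omega_monic: "Omega_monic C (Ome C) f"
  obtains e where "extension C e f g h"
proof -
  let ?A = "Src C f" and ?B = "Tgt C f" and ?D = "Tgt C g"
  note arrs = triangle_arr[OF fgh]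
  obtain e' f' where efg': "(e', f', g) \<in> LTri C" using LTR1_ex arrs by blast
  note arrs' = left_triangle_arr[OF efg']
  obtain a where a_iso: "a \<in> Hom C ?A (Src C f')" "iso_arrow C a" "f' \<cdot> a = f"
    and e'_eq: "\<boxminus> (a \<cdot> Psi_inv C ?D ?A h) = e'"
    using G2[OF f_Omega_monic fgh efg'] by blast
  obtain a' where a'_inverse: "a' \<in> Hom C (Src C f') ?A" "a' \<cdot> a = Idn C ?A"
    "a \<cdot> a' = Idn C (Src C f')"
    "iso_arrow C a'"
    using iso_arrowE[OF a_iso(2,1)] by blast
  define e where "e = \<boxminus> Psi_inv C ?D ?A h"
  have Psi_inv_h: "Psi_inv C ?D ?A h \<in> Hom C (\<Omega>\<^sub>0 ?D) ?A" "Psi C ?D ?A (Psi_inv C ?D ?A h) = h"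
    using arrs by (intro Psi_inv_hom; simp)+
  have e_hom: "e \<in> Hom C (\<Omega>\<^sub>0 ?D) ?A" using Psi_inv_h(1) by (simp add: e_def)
  have "a' \<cdot> e' = e"
    using a_iso(1) a'_inverse(1) Psi_inv_h(1) arrs
    by (simp add: e'_eq[symmetric] e_def a'_inverse(2)[THEN comp_reassoc])
  moreover have "f \<cdot> a' = f'"
    using a_iso(1,3) a'_inverse(1,3) arrs arrs' comp_assoc_arr[of a' a f'] by simp
  ultimately have "(e, f, g) \<in> LTri C"
    using arrs arrs' a'_inverse e_hom
    by (intro left_triangle_isoI[OF efg', of e f g a' "Idn C ?B" "Idn C ?D"])
      (simp_all add: ldiagram_def lmorphism_def)
  moreover have "h = \<boxminus> Psi C ?D ?A e"
    using arrs Psi_inv_h Psi_Neg[OF Psi_inv_h(1)] by (simp add: e_def)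
  ultimately show thesis using that fgh by (simp add: extension_def)
qed

lemma Omega_monicD:
  assumes "Omega_monic C (Ome C) f" "a \<in> Hom C W (Src C f)" "f \<cdot> a = Zer C W (Tgt C f)"
  shows "null_arrow C (Ome C) a"
  using assms Hom_objD[OF assms(2)] unfolding Omega_monic_def by blast

lemma Omega_monicI:
  assumes "f \<in> Arr C"
    and "\<And>W a. a \<in> Hom C W (Src C f) \<Longrightarrow> f \<cdot> a = Zer C W (Tgt C f) \<Longrightarrow> null_arrow C (Ome C) a"
  shows "Omega_monic C (Ome C) f"
  using assms unfolding Omega_monic_def by blast

lemma Omega_monic_if_left_triangle:
  assumes efg: "(e, f, g) \<in> LTri C"
  shows "Omega_monic C (Ome C) f"
proof (rule Omega_monicI)
  note arrs = left_triangle_arr[OF efg]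
  show "f \<in> Arr C" using arrs by simp
  fix W a assume a_zero: "a \<in> Hom C W (Src C f)" "f \<cdot> a = Zer C W (Tgt C f)"
  obtain a' where "a' \<in> Hom C W (\<Omega>\<^sub>0 (Tgt C g))" "e \<cdot> a' = a"
    using weak_kernel_second[OF efg a_zero] by blast
  then show "null_arrow C (Ome C) a"
    using null_arrowI[of "Tgt C g" a' W "Ome C" e "Src C f"] arrs by simp
qed

lemma extensions_iff_Omega_monic:
  "(f, g, h) \<in> extensions C \<longleftrightarrow> (f, g, h) \<in> RTri C \<and> Omega_monic C (Ome C) f"
  using extension_of_Omega_monic Omega_monic_if_left_triangle extensionD
  unfolding extensions_iff by metis

lemma Omega_monic_if_comp:
  assumes gf_Omega_monic: "Omega_monic C (Ome C) (g \<cdot> f)" and f_hom: "f \<in> Hom C A B"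
    and g_hom: "g \<in> Hom C B D"
  shows "Omega_monic C (Ome C) f"
proof (rule Omega_monicI)
  fix W a assume a_zero: "a \<in> Hom C W (Src C f)" "f \<cdot> a = Zer C W (Tgt C f)"
  then show "null_arrow C (Ome C) a"
    using f_hom g_hom Hom_objD[OF g_hom] Hom_objD[OF a_zero(1)]
    by (intro Omega_monicD[OF gf_Omega_monic, of a W]) auto
qed (use f_hom in simp)

lemma extension_of_factor:
  assumes fgh: "(f, g, h) \<in> extensions C" and "k \<cdot> l = f" "l \<in> Hom C A B" "k \<in> Hom C B D"
  obtains m n where "(l, m, n) \<in> extensions C"
proof -
  obtain m n where "(l, m, n) \<in> RTri C" using RTR1_ex[of l] assms(3) by auto
  then show thesis
    using that fgh Omega_monic_if_comp[of k l A B D] assms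
    unfolding extensions_iff_Omega_monic by blast
qed

lemma extension_isoI:
  assumes fgh: "(f, g, h) \<in> extensions C"
    and b_iso: "b \<in> Hom C (Tgt C f) B" "iso_arrow C b"
    and c_iso: "c \<in> Hom C (Tgt C g) D" "iso_arrow C c"
    and f'_spec: "f' \<in> Hom C (Src C f) B" "b \<cdot> f = f'"
    and g'_spec: "g' \<in> Hom C B D" "c \<cdot> g = g' \<cdot> b"
    and h'_spec: "h' \<in> Hom C D (\<Sigma>\<^sub>0 (Src C f))" "h' \<cdot> c = h"
  shows "(f', g', h') \<in> extensions C"
proof -
  note arrs = extension_arr[OF fgh]
  obtain b' where b'_left_inverse: "b' \<in> Hom C B (Tgt C f)" "b' \<cdot> b = Idn C (Tgt C f)"
    using iso_arrowE[OF b_iso(2,1)] by blast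
  have "b' \<cdot> f' = f" using arrs b_iso b'_left_inverse
    by (simp add: f'_spec(2)[symmetric] b'_left_inverse(2)[THEN comp_reassoc])
  then obtain m n where "(f', m, n) \<in> extensions C"
    using extension_of_factor[OF fgh _ f'_spec(1) b'_left_inverse(1)] by blast
  moreover have "(f', g', h') \<in> RTri C"
    using arrs b_iso c_iso f'_spec g'_spec h'_spec
    by (intro triangle_isoI[OF extension_triangle[OF fgh], of f' g' h' "Idn C (Src C f)" b c])
      (auto simp: rdiagram_def rmorphism_def)
  ultimately show ?thesis by (simp add: extensions_iff_Omega_monic)
qed

lemma biproduct_extension:
  assumes P_biproduct: "biproduct_arrows C A B P i j p q"
  shows "(i, q, Zer C B (\<Sigma>\<^sub>0 A)) \<in> extensions C"
proof -
  note arrs = biproduct_arrows_arr[OF P_biproduct]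
  have "Omega_monic C (Ome C) i"
  proof (rule Omega_monicI)
    fix W a assume a_zero: "a \<in> Hom C W (Src C i)" "i \<cdot> a = Zer C W (Tgt C i)"
    have W_obj: "W \<in> Obj C" using Hom_objD[OF a_zero(1)] by simp
    have "a = p \<cdot> (i \<cdot> a)" using arrs a_zero(1) by (simp add: biproduct_arrows_comp[OF P_biproduct])
    also have "\<dots> = Zer C W A" unfolding a_zero(2) using arrs W_obj by simp
    finally show "null_arrow C (Ome C) a" using null_arrow_Zer[OF Omega_additive W_obj] arrs by simp
  qed (use arrs in simp)
  then show ?thesis using biproduct_triangle[OF P_biproduct]
    by (simp add: extensions_iff_Omega_monic)
qed

lemma zero_extension:
  assumes N_zero: "zero_object C N" and A_obj: "A \<in> Obj C"
  shows "(Zer C N A, Idn C A, Zer C A (\<Sigma>\<^sub>0 N)) \<in> extensions C"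
proof -
  have N_obj: "N \<in> Obj C" using N_zero by (simp add: zero_object_iff)
  have "Omega_monic C (Ome C) (Zer C N A)"
  proof (rule Omega_monicI)
    fix W a assume a_hom: "a \<in> Hom C W (Src C (Zer C N A))"
    then have "a = Zer C W N" using arrow_to_zero_object[OF N_zero, of a] N_obj A_obj by simp
    then show "null_arrow C (Ome C) a"
      using null_arrow_Zer[OF Omega_additive _ N_obj] Hom_objD[OF a_hom] by simp
  qed (use N_obj A_obj in simp)
  then show ?thesis using RTR1_id[OF N_zero A_obj] by (simp add: extensions_iff_Omega_monic)
qed

text \<open>If \<open>m l' a = 0\<close>, then \<open>l' a = l b\<close> and \<open>f b = 0\<close>, so \<open>b = e c\<close>; since \<open>l e = l' z\<close>, the
  arrow \<open>a - z c\<close> is killed by \<open>l'\<close> and factors through \<open>e'\<close>.\<close>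

lemma Omega_monic_octahedron:
  assumes efg: "(e, f, g) \<in> LTri C" and klm: "(k, l, m) \<in> LTri C" and elm': "(e', l', m') \<in> LTri C"
    and match: "Src C l = Src C f" "Tgt C l' = Tgt C l" "Tgt C m' = Tgt C f"
    and m'l_eq: "m' \<cdot> l = f"
  shows "Omega_monic C (Ome C) (m \<cdot> l')"
proof (rule Omega_monicI)
  note arrs = left_triangle_arr[OF efg] left_triangle_arr[OF klm] left_triangle_arr[OF elm'] match
  show "m \<cdot> l' \<in> Arr C" using arrs by simp
  fix W a assume a_hom: "a \<in> Hom C W (Src C (m \<cdot> l'))"
    and mla: "(m \<cdot> l') \<cdot> a = Zer C W (Tgt C (m \<cdot> l'))"
  have a_hom: "a \<in> Hom C W (Src C l')" using a_hom arrs by simp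
  have "l' \<cdot> a \<in> Hom C W (Src C m)" "m \<cdot> (l' \<cdot> a) = Zer C W (Tgt C m)" using a_hom mla arrs by auto
  then obtain b where b_spec: "b \<in> Hom C W (Src C f)" "l \<cdot> b = l' \<cdot> a"
    using weak_kernel[OF klm] match(1) by auto
  have "f \<cdot> b = m' \<cdot> (l \<cdot> b)" using arrs b_spec(1) comp_assoc_arr[of b l m'] by (simp add: m'l_eq)
  also have "\<dots> = Zer C W (Tgt C f)"
    using arrs a_hom Hom_objD[OF a_hom]
    by (simp add: b_spec(2) left_triangle_comp_zero(1)[OF elm', THEN comp_reassoc])
  finally obtain c where c_spec: "c \<in> Hom C W (\<Omega>\<^sub>0 (Tgt C g))" "e \<cdot> c = b"
    using weak_kernel_second[OF efg b_spec(1)] by blast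
  have "m' \<cdot> (l \<cdot> e) = Zer C (\<Omega>\<^sub>0 (Tgt C g)) (Tgt C m')"
    using arrs left_triangle_comp_zero(2)[OF efg] by (simp add: m'l_eq[THEN comp_reassoc])
  then obtain z where z_spec: "z \<in> Hom C (\<Omega>\<^sub>0 (Tgt C g)) (Src C l')" "l' \<cdot> z = l \<cdot> e"
    using weak_kernel[OF elm', of "l \<cdot> e" "\<Omega>\<^sub>0 (Tgt C g)"] arrs by auto
  have "l' \<cdot> (a \<boxplus> \<boxminus> (z \<cdot> c)) = Zer C W (Tgt C l')"
    using arrs a_hom z_spec(1) c_spec b_spec(1)
    by (simp add: z_spec(2)[THEN comp_reassoc] b_spec(2)[symmetric])
  then obtain d where d_spec: "d \<in> Hom C W (\<Omega>\<^sub>0 (Tgt C m'))" "e' \<cdot> d = a \<boxplus> \<boxminus> (z \<cdot> c)"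
    using weak_kernel_second[OF elm', of "a \<boxplus> \<boxminus> (z \<cdot> c)" W] arrs a_hom z_spec(1) c_spec(1) by auto
  have "a = z \<cdot> c \<boxplus> e' \<cdot> d"
    using a_hom z_spec(1) c_spec(1) d_spec arrs
    by (intro eq_Plus_if_diff_eq[of _ W "Src C l'"]) auto
  moreover have "null_arrow C (Ome C) (z \<cdot> c \<boxplus> e' \<cdot> d)"
    using arrs z_spec(1) c_spec(1) d_spec(1) null_arrowI[of "Tgt C g" c W "Ome C" z "Src C l'"]
      null_arrowI[of "Tgt C m'" d W "Ome C" e' "Src C l'"]
    by (intro null_arrow_Plus[OF Omega_additive]) simp_all
  ultimately show "null_arrow C (Ome C) a" by simp
qed

lemma extension_octahedral:
  assumes fgh: "(f, g, h) \<in> extensions C" and lmn: "(l, m, n) \<in> extensions C"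
    and lmn': "(l', m', n') \<in> extensions C"
    and match: "Src C l = Src C f" "Tgt C l' = Tgt C l" "Tgt C m' = Tgt C f" "m' \<cdot> l = f"
  shows "octahedral C (Sig C) (extensions C) (f, g, h) (l, m, n) (l', m', n')"
proof -
  obtain g' h' where "g' \<in> Hom C (Tgt C m) (Tgt C g)" "h' \<in> Hom C (Tgt C g) (\<Sigma>\<^sub>0 (Src C l'))"
    "h' \<cdot> g = n'" "h \<cdot> g' = n" "g' \<cdot> m = g \<cdot> m'"
    "\<Sigma>\<^sub>1 l \<cdot> h \<boxplus> \<Sigma>\<^sub>1 l' \<cdot> h' = Zer C (Tgt C g) (\<Sigma>\<^sub>0 (Tgt C l))" "(m \<cdot> l', g', h') \<in> RTri C"
    using RTR4[OF fgh[THEN extension_triangle] lmn[THEN extension_triangle]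
        lmn'[THEN extension_triangle] match]
    by blast
  moreover have "Omega_monic C (Ome C) (m \<cdot> l')"
    using fgh lmn lmn' Omega_monic_octahedron[OF _ _ _ match]
    unfolding extensions_iff extension_def by blast
  ultimately show ?thesis
    by (intro octahedralI[where g' = g' and h' = h']) (auto simp: extensions_iff_Omega_monic)
qed

text \<open>A substitute for the push-out of \<open>(i, j, k)\<close> along \<open>f\<close>.\<close>

lemma extension_cobase_change:
  assumes ijk: "(i, j, k) \<in> extensions C" and f_hom: "f \<in> Hom C (Src C i) Y"
    and P_biproduct: "biproduct_arrows C (Tgt C i) Y P u v r s"
    and lmn: "(v \<cdot> f \<boxplus> u \<cdot> i, m, n) \<in> extensions C"
  obtains g where "g \<in> Hom C (Tgt C m) (Tgt C j)" "g \<cdot> m = j \<cdot> r" "k \<cdot> g = n"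
    "(m \<cdot> v, g, \<boxminus> (\<Sigma>\<^sub>1 f \<cdot> k)) \<in> extensions C"
proof -
  let ?l = "v \<cdot> f \<boxplus> u \<cdot> i"
  note arrs = extension_arr[OF ijk] extension_arr[OF lmn] biproduct_arrows_arr[OF P_biproduct]
    and comps = biproduct_arrows_comp[OF P_biproduct]
  have l_hom: "?l \<in> Hom C (Src C i) P" using f_hom arrs by simp
  have rl_eq: "r \<cdot> ?l = i" and sl_eq: "s \<cdot> ?l = f" using f_hom arrs by (simp_all add: comps)
  have vr_extension: "(v, r, Zer C (Tgt C i) (\<Sigma>\<^sub>0 Y)) \<in> extensions C"
    using biproduct_extension[OF biproduct_arrows_swap[OF P_biproduct]] .
  have match: "Src C ?l = Src C i" "Tgt C v = Tgt C ?l" "Tgt C r = Tgt C i" using arrs l_hom by auto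
  obtain g h' where g_spec: "g \<in> Hom C (Tgt C m) (Tgt C j)" "k \<cdot> g = n" "g \<cdot> m = j \<cdot> r"
    and h'_hom: "h' \<in> Hom C (Tgt C j) (\<Sigma>\<^sub>0 (Src C v))"
    and sum: "\<Sigma>\<^sub>1 ?l \<cdot> k \<boxplus> \<Sigma>\<^sub>1 v \<cdot> h' = Zer C (Tgt C j) (\<Sigma>\<^sub>0 (Tgt C ?l))"
    and mv_extension: "(m \<cdot> v, g, h') \<in> extensions C"
    using octahedralE[OF extension_octahedral[OF ijk lmn vr_extension match rl_eq]] by blast
  have h'_hom: "h' \<in> Hom C (Tgt C j) (\<Sigma>\<^sub>0 Y)" using h'_hom arrs by simp
  have "\<Sigma>\<^sub>1 f \<cdot> k \<boxplus> h' = \<Sigma>\<^sub>1 s \<cdot> (\<Sigma>\<^sub>1 ?l \<cdot> k \<boxplus> \<Sigma>\<^sub>1 v \<cdot> h')"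
    using arrs l_hom h'_hom Susp.FAr_comp_eq[OF sl_eq] Susp.FAr_comp_eq[OF comps(2)]
    by (simp add: comp_reassoc[of "\<Sigma>\<^sub>1 s"] del: Susp.FAr_Plus comp_Plus(2))
  also have "\<dots> = Zer C (Tgt C j) (\<Sigma>\<^sub>0 Y)" unfolding sum using arrs l_hom by simp
  finally have "h' = \<boxminus> (\<Sigma>\<^sub>1 f \<cdot> k)" using arrs f_hom h'_hom by (intro Neg_unique) auto
  then show thesis using that[of g] g_spec mv_extension by simp
qed

text \<open>Adds the split sequence \<open>0 \<rightarrow> I \<rightarrow> I\<close> to an extension, twisted by an automorphism of the
  middle term.\<close>

lemma extension_add_split:
  assumes fgh: "(f, g, h) \<in> extensions C"
    and P_biproduct: "biproduct_arrows C I (Tgt C f) P i j p q"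
    and R_biproduct: "biproduct_arrows C I (Tgt C g) R u v r s"
    and l_spec: "l \<in> Hom C (Src C f) P" "q \<cdot> l = f"
    and t_spec: "t \<in> Hom C P I" "t \<cdot> i = Idn C I" "t \<cdot> l = Zer C (Src C f) I"
  shows "(l, u \<cdot> t \<boxplus> v \<cdot> g \<cdot> q, h \<cdot> s) \<in> extensions C"
proof -
  note arrs = extension_arr[OF fgh] biproduct_arrows_arr[OF P_biproduct]
    biproduct_arrows_arr[OF R_biproduct]
  obtain m n where lmn: "(l, m, n) \<in> extensions C"
    using extension_of_factor[OF fgh l_spec(2,1)] arrs by auto
  note arrs = arrs extension_arr[OF lmn] l_spec(1) t_spec(1)
  have match: "Src C l = Src C f" "Tgt C i = Tgt C l" "Tgt C q = Tgt C f" using arrs by auto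
  obtain g' h' where g'_spec: "g' \<in> Hom C (Tgt C m) (Tgt C g)" "h \<cdot> g' = n" "g' \<cdot> m = g \<cdot> q"
    and mi_extension: "(m \<cdot> i, g', h') \<in> extensions C"
    using octahedralE[OF extension_octahedral[OF fgh lmn biproduct_extension[OF P_biproduct] match
          l_spec(2)]] by blast
  obtain t' where t'_spec: "t' \<in> Hom C (Tgt C m) I" "t' \<cdot> m = t"
    using weak_cokernel[OF extension_triangle[OF lmn], of t I] t_spec l_spec(1) by auto
  have "t' \<cdot> (m \<cdot> i) = Idn C I"
    using arrs t'_spec(1) by (simp add: t'_spec(2)[THEN comp_reassoc] t_spec(2))
  then obtain k where middle_biproduct: "biproduct_arrows C I (Tgt C g) (Tgt C m) (m \<cdot> i) k t' g'"
    using biproduct_if_split_mono[OF extension_triangle[OF mi_extension], of t'] t'_spec(1) arrs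
      g'_spec(1) by auto
  let ?c = "u \<cdot> t' \<boxplus> v \<cdot> g'"
  have c_hom: "?c \<in> Hom C (Tgt C m) R" using t'_spec(1) g'_spec(1) arrs by simp
  have "?c \<cdot> m = u \<cdot> t \<boxplus> v \<cdot> g \<cdot> q"
    using t'_spec(1) g'_spec(1) arrs by (simp add: t'_spec(2) g'_spec(3))
  moreover have "s \<cdot> ?c = g'"
    using t'_spec(1) g'_spec(1) arrs by (simp add: biproduct_arrows_comp[OF R_biproduct])
  then have "(h \<cdot> s) \<cdot> ?c = n" using arrs c_hom g'_spec(2) by (simp del: comp_Plus)
  ultimately show ?thesis
    using arrs c_hom biproduct_iso[OF middle_biproduct R_biproduct]
    by (intro extension_isoI[OF lmn, of "Idn C P" P ?c R]) (simp_all del: comp_Plus)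
qed

text \<open>The square \<open>q g = \<beta> p\<close> with \<open>q = k v\<close> is homotopy cartesian.\<close>

lemma extension_mapping_cone:
  assumes fgh: "(f, g, h) \<in> extensions C"
    and \<alpha>\<beta>\<gamma>_extension: "(\<alpha>, \<beta>, \<gamma>) \<in> extensions C" "Src C \<alpha> = Src C f"
    and p_spec: "p \<in> Hom C (Tgt C f) (Tgt C \<alpha>)" "p \<cdot> f = \<alpha>"
    and R_biproduct: "biproduct_arrows C (Tgt C \<alpha>) (Tgt C g) R u v r s"
  obtains k where "(v \<cdot> g \<boxplus> \<boxminus> (u \<cdot> p), k, \<boxminus> (\<Sigma>\<^sub>1 f \<cdot> \<gamma>)) \<in> extensions C"
    "k \<in> Hom C R (Tgt C \<beta>)" "k \<cdot> u = \<beta>"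
    "rmorphism C (Sig C) (Idn C (Src C f), p, k \<cdot> v) (f, g, h) (\<alpha>, \<beta>, \<gamma>)"
proof -
  note arrs = extension_arr[OF fgh] extension_arr[OF \<alpha>\<beta>\<gamma>_extension(1)] \<alpha>\<beta>\<gamma>_extension(2)
    biproduct_arrows_arr[OF R_biproduct] p_spec(1)
  obtain P i j pI q where P_biproduct: "biproduct_arrows C (Tgt C \<alpha>) (Tgt C f) P i j pI q"
    using ex_biproduct[of "Tgt C \<alpha>" "Tgt C f"] arrs unfolding biproduct_iff by auto
  note arrs = arrs biproduct_arrows_arr[OF P_biproduct]
    and comps = biproduct_arrows_comp[OF P_biproduct]
  define l where "l = j \<cdot> f \<boxplus> i \<cdot> \<alpha>"
  define t where "t = pI \<boxplus> \<boxminus> (p \<cdot> q)"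
  define m where "m = u \<cdot> t \<boxplus> v \<cdot> g \<cdot> q"
  have l_spec: "l \<in> Hom C (Src C f) P" "q \<cdot> l = f" "pI \<cdot> l = \<alpha>"
    using arrs by (simp_all add: l_def comps)
  have t_left_inverse: "t \<in> Hom C P (Tgt C \<alpha>)" "t \<cdot> i = Idn C (Tgt C \<alpha>)"
    using arrs by (simp_all add: t_def comps)
  have "t \<cdot> l = Zer C (Src C f) (Tgt C \<alpha>)" using arrs l_spec p_spec(2) by (simp add: t_def)
  then have lm_extension: "(l, m, h \<cdot> s) \<in> extensions C"
    unfolding m_def
    using extension_add_split[OF fgh P_biproduct R_biproduct l_spec(1,2) t_left_inverse] by blast
  have m_hom: "m \<in> Hom C P R" and mi_eq: "m \<cdot> i = u" and mj_eq: "m \<cdot> j = v \<cdot> g \<boxplus> \<boxminus> (u \<cdot> p)"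
    using arrs t_left_inverse(1) Plus_comm[of "v \<cdot> g" "\<boxminus> (u \<cdot> p)"]
    by (simp_all add: m_def t_def comps)
  have f_hom: "f \<in> Hom C (Src C \<alpha>) (Tgt C f)" using arrs by simp
  obtain k where k_spec: "k \<in> Hom C (Tgt C m) (Tgt C \<beta>)" "k \<cdot> m = \<beta> \<cdot> pI" "\<gamma> \<cdot> k = h \<cdot> s"
    and cone: "(m \<cdot> j, k, \<boxminus> (\<Sigma>\<^sub>1 f \<cdot> \<gamma>)) \<in> extensions C"
    using extension_cobase_change[OF \<alpha>\<beta>\<gamma>_extension(1) f_hom P_biproduct, of m "h \<cdot> s"] lm_extension
    unfolding l_def by blast
  have k_arr: "k \<in> Hom C R (Tgt C \<beta>)" using k_spec(1) m_hom by simp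
  have ku_eq: "k \<cdot> u = \<beta>"
    using arrs m_hom k_arr by (simp add: mi_eq[symmetric] k_spec(2)[THEN comp_reassoc] comps)
  have "k \<cdot> m \<cdot> j = Zer C (Tgt C f) (Tgt C \<beta>)"
    using arrs m_hom k_arr by (simp add: k_spec(2)[THEN comp_reassoc] comps)
  then have "k \<cdot> v \<cdot> g \<boxplus> \<boxminus> (\<beta> \<cdot> p) = Zer C (Tgt C f) (Tgt C \<beta>)"
    unfolding mj_eq using arrs k_arr by (simp add: ku_eq[THEN comp_reassoc])
  then have "k \<cdot> v \<cdot> g = \<beta> \<cdot> p"
    using arrs k_arr by - (rule eq_if_diff_Zer[of _ "Tgt C f" "Tgt C \<beta>"], auto)
  moreover have "\<gamma> \<cdot> k \<cdot> v = h"
    using arrs k_arr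
    by (simp add: k_spec(3)[THEN comp_reassoc] biproduct_arrows_comp[OF R_biproduct])
  ultimately have "rmorphism C (Sig C) (Idn C (Src C f), p, k \<cdot> v) (f, g, h) (\<alpha>, \<beta>, \<gamma>)"
    using arrs k_arr p_spec(2) by (simp add: rmorphism_def)
  then show thesis using that[of k] cone k_arr ku_eq unfolding mj_eq by blast
qed

lemma extension_of_Sigma_epic:
  assumes g_Sigma_epic: "Sigma_epic C (Sig C) g"
  obtains f h where "(f, g, h) \<in> extensions C"
proof -
  interpret dual: pseudo_triangulated "dual_category C" by (rule dual_pseudo_triangulated)
  have "g \<in> Arr C" using g_Sigma_epic by (simp add: Sigma_epic_def)
  then obtain e f where "(e, f, g) \<in> LTri C" using LTR1_ex by blast
  then obtain h where "extension C e f g h"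
    using dual.extension_of_Omega_monic[of g f e] g_Sigma_epic dual_extension by auto
  then show thesis using that unfolding extensions_iff by blast
qed

lemma Sigma_epic_comp:
  assumes fgh: "(f, g, h) \<in> RTri C" and lmn: "(l, m, n) \<in> RTri C" and match: "Tgt C m = Tgt C f"
    and h'_spec: "h' \<in> Hom C (Tgt C g) (\<Sigma>\<^sub>0 (Src C l))" "h' \<cdot> g = n"
  shows "Sigma_epic C (Sig C) (g \<cdot> m)"
proof -
  note arrs = triangle_arr[OF fgh] triangle_arr[OF lmn] match
  have "null_arrow C (Sig C) b"
    if b_zero: "b \<in> Hom C (Tgt C g) W" "b \<cdot> (g \<cdot> m) = Zer C (Tgt C l) W" for b W
  proof -
    have "b \<cdot> g \<in> Hom C (Tgt C m) W" "(b \<cdot> g) \<cdot> m = Zer C (Tgt C l) W" using arrs b_zero by auto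
    then obtain c where c_spec: "c \<in> Hom C (\<Sigma>\<^sub>0 (Src C l)) W" "c \<cdot> n = b \<cdot> g"
      using weak_cokernel_second[OF lmn] by blast
    have "(b \<boxplus> \<boxminus> (c \<cdot> h')) \<cdot> g = Zer C (Tgt C f) W"
      using arrs b_zero(1) c_spec(1) h'_spec(1) by (simp add: h'_spec(2) c_spec(2))
    then obtain d where d_spec: "d \<in> Hom C (\<Sigma>\<^sub>0 (Src C f)) W" "d \<cdot> h = b \<boxplus> \<boxminus> (c \<cdot> h')"
      using weak_cokernel_second[OF fgh, of "b \<boxplus> \<boxminus> (c \<cdot> h')" W] arrs b_zero(1) c_spec(1) h'_spec(1)
      by auto
    have "b = c \<cdot> h' \<boxplus> d \<cdot> h"
      using b_zero(1) c_spec(1) d_spec h'_spec(1) arrs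
      by (intro eq_Plus_if_diff_eq[of _ "Tgt C g" W]) auto
    moreover have "null_arrow C (Sig C) (c \<cdot> h' \<boxplus> d \<cdot> h)"
      using arrs c_spec(1) h'_spec(1) d_spec(1) null_arrowI[of "Src C l" h' "Tgt C g" "Sig C" c W]
        null_arrowI[of "Src C f" h "Tgt C g" "Sig C" d W]
      by (intro null_arrow_Plus[OF Sigma_additive]) simp_all
    ultimately show ?thesis by simp
  qed
  then show ?thesis unfolding Sigma_epic_def using arrs by auto
qed

lemma AC1_lift:
  assumes AC1: "AC1 C" and g_Sigma_epic: "Sigma_epic C (Sig C) g"
    and \<alpha>\<beta>\<gamma>_extension: "(\<alpha>, \<beta>, \<gamma>) \<in> extensions C"
    and c_hom: "c \<in> Hom C (Tgt C g) (Tgt C \<beta>)" and t_hom: "t \<in> Hom C (Tgt C g) (Src C \<beta>)"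
    and c_comp: "\<gamma> \<cdot> c = Zer C (Tgt C g) (Tgt C \<gamma>)" "c \<cdot> g = \<beta> \<cdot> (t \<cdot> g)"
  obtains d where "d \<in> Hom C (Tgt C g) (Src C \<beta>)" "c = \<beta> \<cdot> d"
proof -
  obtain f h where fgh: "(f, g, h) \<in> extensions C"
    using extension_of_Sigma_epic[OF g_Sigma_epic] .
  note arrs = extension_arr[OF fgh] extension_arr[OF \<alpha>\<beta>\<gamma>_extension] c_hom t_hom
  let ?c = "c \<boxplus> \<boxminus> (\<beta> \<cdot> t)"
  have "?c \<in> Hom C (Tgt C g) (Tgt C \<beta>)" "?c \<cdot> g = Zer C (Src C g) (Tgt C \<beta>)"
    using arrs by (simp_all add: c_comp(2))
  moreover have "\<gamma> \<cdot> ?c = Zer C (Tgt C g) (Tgt C \<gamma>)"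
    using arrs comp_zero_second[OF extension_triangle[OF \<alpha>\<beta>\<gamma>_extension]]
    by (simp add: c_comp(1) comp_reassoc)
  ultimately obtain d where d_spec: "d \<in> Hom C (Tgt C g) (Src C \<beta>)" "?c = \<beta> \<cdot> d"
    using AC1 fgh \<alpha>\<beta>\<gamma>_extension unfolding extensions_iff AC1_def by blast
  have "c = \<beta> \<cdot> t \<boxplus> \<beta> \<cdot> d"
    using arrs d_spec by (intro eq_Plus_if_diff_eq[of _ "Tgt C g" "Tgt C \<beta>"]) auto
  then show thesis using that[of "t \<boxplus> d"] arrs d_spec by simp
qed

lemma Sigma_epic_if_right_triangle:
  assumes fgh: "(f, g, h) \<in> RTri C"
  shows "Sigma_epic C (Sig C) g"
proof -
  interpret dual: pseudo_triangulated "dual_category C" by (rule dual_pseudo_triangulated)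
  show ?thesis using dual.Omega_monic_if_left_triangle[of h g f] fgh by simp
qed

lemma extension_null_homotopy:
  assumes AC1: "AC1 C" and fgh: "(f, g, h) \<in> extensions C" and fgh': "(f', g', h') \<in> extensions C"
    and abc: "rmorphism C (Sig C) (a, b, c) (f, g, h) (f', g', h')"
    and a'_spec: "a' \<in> Hom C (Tgt C f) (Src C f')" "a = a' \<cdot> f"
  obtains t where "t \<in> Hom C (Tgt C g) (Src C g')" "c = g' \<cdot> t"
proof -
  note arrs = extension_arr[OF fgh] extension_arr[OF fgh']
    and tri = extension_triangle[OF fgh] extension_triangle[OF fgh']
  from abc have b_hom: "b \<in> Hom C (Tgt C f) (Tgt C f')" and c_hom: "c \<in> Hom C (Tgt C g) (Tgt C g')"
    and squares: "b \<cdot> f = f' \<cdot> a" "c \<cdot> g = g' \<cdot> b" "\<Sigma>\<^sub>1 a \<cdot> h = h' \<cdot> c"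
    by (auto simp: rmorphism_def)
  have "(b \<boxplus> \<boxminus> (f' \<cdot> a')) \<cdot> f = Zer C (Src C f) (Tgt C f')"
    using arrs b_hom a'_spec squares(1) by simp
  then obtain t where t_spec: "t \<in> Hom C (Tgt C g) (Tgt C f')" "t \<cdot> g = b \<boxplus> \<boxminus> (f' \<cdot> a')"
    using weak_cokernel[OF tri(1), of "b \<boxplus> \<boxminus> (f' \<cdot> a')" "Tgt C f'"] arrs b_hom a'_spec by auto
  have "c \<cdot> g = g' \<cdot> (t \<cdot> g)"
    using arrs b_hom a'_spec(1)
    by (simp add: t_spec(2) squares(2) comp_zero_first[OF tri(2), THEN comp_reassoc])
  moreover have "h' \<cdot> c = Zer C (Tgt C g) (Tgt C h')"
    using arrs a'_spec(1) comp_zero_third[OF tri(1)] by (simp add: squares(3)[symmetric] a'_spec(2))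
  ultimately show thesis
    using AC1_lift[OF AC1 Sigma_epic_if_right_triangle[OF tri(1)] fgh', of c t] that c_hom t_spec(1)
      arrs by auto
qed

text \<open>The relation \<open>\<Sigma>l h + \<Sigma>l' h' = 0\<close> of (RTR4), transported along \<open>\<alpha> : M \<rightarrow> I\<close>.\<close>

lemma octahedron_induced_arrows_cancel:
  assumes AC1: "AC1 C" and fgh: "(f, g, h) \<in> extensions C" and lmn: "(l, m, n) \<in> extensions C"
    and lmn': "(l', m', n') \<in> extensions C"
    and match: "Src C l = Src C f" "Tgt C l' = Tgt C l" "Tgt C m' = Tgt C f"
    and m'l_eq: "m' \<cdot> l = f"
    and g'_spec: "g' \<in> Hom C (Tgt C m) (Tgt C g)" "g' \<cdot> m = g \<cdot> m'"
    and h'_spec: "h' \<in> Hom C (Tgt C g) (\<Sigma>\<^sub>0 (Src C l'))" "h' \<cdot> g = n'"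
    and sum: "\<Sigma>\<^sub>1 l \<cdot> h \<boxplus> \<Sigma>\<^sub>1 l' \<cdot> h' = Zer C (Tgt C g) (\<Sigma>\<^sub>0 (Tgt C l))"
    and \<alpha>\<beta>\<gamma>_extension: "(\<alpha>, \<beta>, \<gamma>) \<in> extensions C"
    and lbc: "rmorphism C (Sig C) (l, b, c) (f, g, h) (\<alpha>, \<beta>, \<gamma>)"
    and lbc': "rmorphism C (Sig C) (l', b', c') (m \<cdot> l', g', h') (\<alpha>, \<beta>, \<gamma>)"
  obtains t where "t \<in> Hom C (Tgt C g) (Src C \<beta>)" "c \<boxplus> c' = \<beta> \<cdot> t"
proof -
  let ?M = "Tgt C l" and ?I = "Tgt C \<alpha>" and ?S = "Tgt C \<beta>" and ?D = "Tgt C g"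
  note tri = extension_triangle[OF fgh] extension_triangle[OF lmn] extension_triangle[OF lmn']
    extension_triangle[OF \<alpha>\<beta>\<gamma>_extension]
  note arrs = extension_arr[OF fgh] extension_arr[OF lmn] extension_arr[OF lmn']
    extension_arr[OF \<alpha>\<beta>\<gamma>_extension] match
  have b_hom: "b \<in> Hom C (Tgt C f) ?I" and c_hom: "c \<in> Hom C ?D ?S" and src_\<alpha>: "Src C \<alpha> = ?M"
    and squares: "b \<cdot> f = \<alpha> \<cdot> l" "c \<cdot> g = \<beta> \<cdot> b" "\<Sigma>\<^sub>1 l \<cdot> h = \<gamma> \<cdot> c"
    using lbc arrs by (auto simp: rmorphism_def)
  have b'_hom: "b' \<in> Hom C (Tgt C m) ?I" and c'_hom: "c' \<in> Hom C ?D ?S"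
    and squares': "b' \<cdot> (m \<cdot> l') = \<alpha> \<cdot> l'" "c' \<cdot> g' = \<beta> \<cdot> b'" "\<Sigma>\<^sub>1 l' \<cdot> h' = \<gamma> \<cdot> c'"
    using lbc' arrs g'_spec(1) by (auto simp: rmorphism_def)
  note arrs = arrs b_hom c_hom src_\<alpha> b'_hom c'_hom g'_spec(1) h'_spec(1)
  define k where "k = b \<cdot> m' \<boxplus> b' \<cdot> m"
  have k_hom: "k \<in> Hom C ?M ?I" using arrs by (simp add: k_def)
  have kl_eq: "k \<cdot> l = \<alpha> \<cdot> l"
    using arrs comp_zero_first[OF tri(2)] by (simp add: k_def m'l_eq squares(1))
  have kl'_eq: "k \<cdot> l' = \<alpha> \<cdot> l'"
    using arrs comp_zero_first[OF tri(3)] by (simp add: k_def squares'(1))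
  obtain t where t_spec: "t \<in> Hom C ?D ?I" "t \<cdot> g \<cdot> m' = k \<boxplus> \<boxminus> \<alpha>"
    using weak_cokernel_comp[OF tri(1,3), of l "k \<boxplus> \<boxminus> \<alpha>" ?I] arrs k_hom m'l_eq kl_eq kl'_eq by auto
  have "c \<cdot> (g \<cdot> m') = \<beta> \<cdot> b \<cdot> m'" using arrs by (simp add: squares(2)[THEN comp_reassoc])
  moreover have "c' \<cdot> (g \<cdot> m') = \<beta> \<cdot> b' \<cdot> m"
    using arrs by (simp add: g'_spec(2)[symmetric] squares'(2)[THEN comp_reassoc])
  ultimately have "(c \<boxplus> c') \<cdot> (g \<cdot> m') = \<beta> \<cdot> k" using arrs by (simp add: k_def)
  also have "\<dots> = \<beta> \<cdot> (t \<cdot> (g \<cdot> m'))"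
    using arrs t_spec k_hom comp_zero_first[OF tri(4)] by simp
  finally have "(c \<boxplus> c') \<cdot> (g \<cdot> m') = \<beta> \<cdot> (t \<cdot> (g \<cdot> m'))" .
  moreover have "\<gamma> \<cdot> (c \<boxplus> c') = Zer C ?D (Tgt C \<gamma>)"
    using arrs sum by (simp add: squares(3)[symmetric] squares'(3)[symmetric])
  ultimately show thesis
    using AC1_lift[OF AC1 Sigma_epic_comp[OF tri(1,3) match(3) h'_spec] \<alpha>\<beta>\<gamma>_extension,
        of "c \<boxplus> c'" t] that t_spec(1) arrs by auto
qed

end

section \<open>The quotient of an additive subcategory by an ideal\<close>

locale ideal_quotient = additive_category C
  for C :: "('o, 'm, 'b) cat_scheme" (structure) +
  fixes Z J :: "'o set"
  assumes Z_additive: "additive_subcategory C Z"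
    and J_subset: "J \<subseteq> Z"
    and J_nonempty: "J \<noteq> {}"
    and J_biproduct: "X \<in> J \<Longrightarrow> Y \<in> J \<Longrightarrow> \<exists>P \<in> J. biproduct C X Y P"
begin

abbreviation "\<pi> \<equiv> arrow_class C J"
abbreviation "Q \<equiv> quotient_category C Z J"

lemma Z_obj [simp]: "A \<in> Z \<Longrightarrow> A \<in> Obj C"
  using Z_additive by (auto simp: additive_subcategory_def)

lemma J_Z [simp]: "A \<in> J \<Longrightarrow> A \<in> Z"
  using J_subset by blast

lemma Z_biproduct:
  assumes "A \<in> Z" "B \<in> Z"
  obtains P i j p q where "P \<in> Z" "biproduct_arrows C A B P i j p q"
  using Z_additive assms unfolding additive_subcategory_def biproduct_iff by metis

lemma factors_through_J_Plus:
  assumes "factors_through C J f" "factors_through C J g" "Src C g = Src C f" "Tgt C g = Tgt C f"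
  shows "factors_through C J (f \<boxplus> g)"
  using factors_through_Plus[OF J_biproduct] assms by blast

lemma factors_through_J_Zer:
  assumes "A \<in> Obj C" "B \<in> Obj C"
  shows "factors_through C J (Zer C A B)"
proof -
  obtain X where X_in_J: "X \<in> J" using J_nonempty by blast
  then have "X \<in> Obj C" by simp
  then show ?thesis
    using X_in_J assms by (intro factors_throughI[of X _ "Zer C A X" A "Zer C X B"]) auto
qed

lemma mem_proj: "f \<in> Arr C \<Longrightarrow> f \<in> \<pi> f"
  by (simp add: arrow_class_def factors_through_J_Zer)

lemma proj_eq_iff:
  assumes f_hom: "f \<in> Hom C A B" and g_hom: "g \<in> Hom C A B"
  shows "\<pi> f = \<pi> g \<longleftrightarrow> factors_through C J (f \<boxplus> \<boxminus> g)"
proof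
  have "f \<in> \<pi> f" using f_hom mem_proj by simp
  moreover assume "\<pi> f = \<pi> g"
  ultimately have "f \<in> \<pi> g" by simp
  then show "factors_through C J (f \<boxplus> \<boxminus> g)" by (simp add: arrow_class_def)
next
  assume diff: "factors_through C J (f \<boxplus> \<boxminus> g)"
  have subset: "\<pi> f' \<subseteq> \<pi> g'"
    if f'_hom: "f' \<in> Hom C A B" and g'_hom: "g' \<in> Hom C A B"
      and diff': "factors_through C J (f' \<boxplus> \<boxminus> g')" for f' g'
  proof
    fix k assume "k \<in> \<pi> f'"
    then have k_spec: "k \<in> Hom C A B" "factors_through C J (k \<boxplus> \<boxminus> f')"
      using f'_hom by (auto simp: arrow_class_def)
    have "factors_through C J ((k \<boxplus> \<boxminus> f') \<boxplus> (f' \<boxplus> \<boxminus> g'))"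
      using k_spec f'_hom g'_hom diff' by - (rule factors_through_J_Plus, auto)
    then show "k \<in> \<pi> g'" using k_spec(1) f'_hom g'_hom by (simp add: arrow_class_def)
  qed
  have "\<boxminus> (f \<boxplus> \<boxminus> g) = g \<boxplus> \<boxminus> f" using f_hom g_hom Plus_comm[of "\<boxminus> f" g] by simp
  then have "factors_through C J (g \<boxplus> \<boxminus> f)" using factors_through_Neg[OF diff] by simp
  then show "\<pi> f = \<pi> g" using subset f_hom g_hom diff by blast
qed

lemma proj_eqI:
  assumes "f \<in> Hom C A B" "g \<in> Hom C A B" "X \<in> J" "u \<in> Hom C A X" "v \<in> Hom C X B" "f \<boxplus> \<boxminus> g = v \<cdot> u"
  shows "\<pi> f = \<pi> g"
  using proj_eq_iff[OF assms(1,2)] factors_throughI[OF assms(3-)] by blast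

lemma proj_eqE:
  assumes \<pi>_eq: "\<pi> f = \<pi> g" and f_hom: "f \<in> Hom C A B" and g_hom: "g \<in> Hom C A B"
  obtains X u v where "X \<in> J" "u \<in> Hom C A X" "v \<in> Hom C X B" "f \<boxplus> \<boxminus> g = v \<cdot> u"
proof -
  have "factors_through C J (f \<boxplus> \<boxminus> g)" using proj_eq_iff[OF f_hom g_hom] \<pi>_eq by simp
  then show thesis using that f_hom g_hom by (elim factors_throughE[of _ _ A B]) auto
qed

lemma proj_eq_Zer_if_factors:
  assumes "X \<in> J" "u \<in> Hom C A X" "v \<in> Hom C X B"
  shows "\<pi> (v \<cdot> u) = \<pi> (Zer C A B)"
  using assms Hom_objD[OF assms(2)] Hom_objD[OF assms(3)]
  by (intro proj_eqI[of _ A B _ X u v]) auto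

lemma proj_Plus_factoring:
  assumes "f \<in> Hom C A B" "X \<in> J" "u \<in> Hom C A X" "v \<in> Hom C X B"
  shows "\<pi> (f \<boxplus> v \<cdot> u) = \<pi> f"
proof -
  have "(f \<boxplus> v \<cdot> u) \<boxplus> \<boxminus> f = v \<cdot> u"
    using assms Plus_comm[of "v \<cdot> u" "\<boxminus> f"] by simp
  then show ?thesis using assms by (intro proj_eqI[of _ A B f X u v]) auto
qed

lemma mem_projD:
  assumes k_in_class: "k \<in> \<pi> f" and f_hom: "f \<in> Arr C"
  shows "k \<in> Hom C (Src C f) (Tgt C f)" "\<pi> k = \<pi> f"
proof -
  show "k \<in> Hom C (Src C f) (Tgt C f)" using k_in_class by (auto simp: arrow_class_def)
  then show "\<pi> k = \<pi> f"
    using k_in_class f_hom proj_eq_iff[of k "Src C f" "Tgt C f" f] by (simp add: arrow_class_def)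
qed

lemma UN_proj_eq_const:
  assumes "f \<in> Arr C" "\<And>k. k \<in> \<pi> f \<Longrightarrow> F k = c"
  shows "(\<Union>k\<in>\<pi> f. F k) = c"
  using assms mem_proj by blast

lemma proj_comp_cong:
  assumes f_spec: "f \<in> Hom C A B" "f' \<in> Hom C A B" "\<pi> f = \<pi> f'"
    and g_spec: "g \<in> Hom C B D" "g' \<in> Hom C B D" "\<pi> g = \<pi> g'"
  shows "\<pi> (g \<cdot> f) = \<pi> (g' \<cdot> f')"
proof -
  have "factors_through C J ((g \<boxplus> \<boxminus> g') \<cdot> f)"
    using f_spec g_spec proj_eq_iff[of g B D g'] by (intro factors_through_comp(2)) auto
  moreover have "factors_through C J (g' \<cdot> (f \<boxplus> \<boxminus> f'))"
    using f_spec g_spec proj_eq_iff[of f A B f'] by (intro factors_through_comp(1)) auto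
  ultimately have "factors_through C J ((g \<boxplus> \<boxminus> g') \<cdot> f \<boxplus> g' \<cdot> (f \<boxplus> \<boxminus> f'))"
    using f_spec g_spec by (intro factors_through_J_Plus) auto
  moreover have "(g \<boxplus> \<boxminus> g') \<cdot> f \<boxplus> g' \<cdot> (f \<boxplus> \<boxminus> f') = g \<cdot> f \<boxplus> \<boxminus> (g' \<cdot> f')"
    using f_spec(1,2) g_spec(1,2) by simp
  ultimately show ?thesis using f_spec g_spec proj_eq_iff[of "g \<cdot> f" A D "g' \<cdot> f'"] by simp
qed

lemma proj_Plus_cong:
  assumes f_spec: "f \<in> Hom C A B" "f' \<in> Hom C A B" "\<pi> f = \<pi> f'"
    and g_spec: "g \<in> Hom C A B" "g' \<in> Hom C A B" "\<pi> g = \<pi> g'"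
  shows "\<pi> (f \<boxplus> g) = \<pi> (f' \<boxplus> g')"
proof -
  have "factors_through C J ((f \<boxplus> \<boxminus> f') \<boxplus> (g \<boxplus> \<boxminus> g'))"
    using f_spec g_spec proj_eq_iff[of g A B g'] proj_eq_iff[of f A B f']
    by - (rule factors_through_J_Plus, auto)
  moreover have "(f \<boxplus> \<boxminus> f') \<boxplus> (g \<boxplus> \<boxminus> g') = (f \<boxplus> g) \<boxplus> \<boxminus> (f' \<boxplus> g')"
    using f_spec(1,2) g_spec(1,2) by (simp add: Plus_left_comm[of "\<boxminus> f'" g])
  ultimately show ?thesis using f_spec g_spec proj_eq_iff[of "f \<boxplus> g" A B "f' \<boxplus> g'"] by simp
qed

lemma quotient_Obj [simp]: "Obj Q = Z"
  by (simp add: quotient_category_def)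

lemma quotient_Idn [simp]: "Idn Q A = \<pi> (Idn C A)"
  by (simp add: quotient_category_def)

lemma quotient_Zer [simp]: "Zer Q A B = \<pi> (Zer C A B)"
  by (simp add: quotient_category_def)

lemma quotient_Arr [simp]: "f \<in> Arr C \<Longrightarrow> Src C f \<in> Z \<Longrightarrow> Tgt C f \<in> Z \<Longrightarrow> \<pi> f \<in> Arr Q"
  by (simp add: quotient_category_def)

lemma quotient_Src [simp]:
  assumes f_hom: "f \<in> Arr C"
  shows "Src Q (\<pi> f) = Src C f"
proof -
  have "Src C k = Src C f" if "k \<in> \<pi> f" for k using mem_projD(1)[OF that f_hom] by simp
  then have "the_elem (Src C ` \<pi> f) = Src C f"
    using mem_proj[OF f_hom] by (intro the_elem_image_unique) blast+
  then show ?thesis by (simp add: quotient_category_def)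
qed

lemma quotient_Tgt [simp]:
  assumes f_hom: "f \<in> Arr C"
  shows "Tgt Q (\<pi> f) = Tgt C f"
proof -
  have "Tgt C k = Tgt C f" if "k \<in> \<pi> f" for k using mem_projD(1)[OF that f_hom] by simp
  then have "the_elem (Tgt C ` \<pi> f) = Tgt C f"
    using mem_proj[OF f_hom] by (intro the_elem_image_unique) blast+
  then show ?thesis by (simp add: quotient_category_def)
qed

lemma quotient_ArrE:
  assumes "F \<in> Arr Q"
  obtains f where "f \<in> Arr C" "Src C f \<in> Z" "Tgt C f \<in> Z" "F = \<pi> f"
  using assms by (auto simp: quotient_category_def)

lemma quotient_HomE:
  assumes F_hom: "F \<in> Hom Q A B"
  obtains f where "f \<in> Hom C A B" "A \<in> Z" "B \<in> Z" "F = \<pi> f"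
proof -
  have "F \<in> Arr Q" using F_hom by (simp add: Hom_def)
  then obtain f where "f \<in> Arr C" "Src C f \<in> Z" "Tgt C f \<in> Z" "F = \<pi> f" by (rule quotient_ArrE)
  then show thesis using F_hom that[of f] by (auto simp: Hom_def[of Q])
qed

lemma quotient_HomI: "f \<in> Hom C A B \<Longrightarrow> A \<in> Z \<Longrightarrow> B \<in> Z \<Longrightarrow> \<pi> f \<in> Hom Q A B"
  by (auto simp: Hom_def[of Q])

lemma quotient_Comp [simp]:
  assumes f_hom: "f \<in> Arr C" and g_hom: "g \<in> Arr C" and "Src C g = Tgt C f"
  shows "\<pi> g \<cdot>\<^bsub>Q\<^esub> \<pi> f = \<pi> (g \<cdot> f)"
proof -
  have "\<pi> (g' \<cdot> f') = \<pi> (g \<cdot> f)" if g'_in_class: "g' \<in> \<pi> g" and f'_in_class: "f' \<in> \<pi> f" for g' f'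
    using mem_projD[OF g'_in_class g_hom] mem_projD[OF f'_in_class f_hom] assms
    by (intro proj_comp_cong[of f' "Src C f" "Tgt C f" f g' "Tgt C g" g]) auto
  then have "(\<Union>g'\<in>\<pi> g. \<Union>f'\<in>\<pi> f. \<pi> (g' \<cdot> f')) = \<pi> (g \<cdot> f)"
    by (intro UN_proj_eq_const f_hom g_hom) blast
  then show ?thesis by (simp add: quotient_category_def)
qed

lemma quotient_Plus [simp]:
  assumes f_hom: "f \<in> Arr C" and g_hom: "g \<in> Arr C" and "Src C g = Src C f" "Tgt C g = Tgt C f"
  shows "\<pi> f \<boxplus>\<^bsub>Q\<^esub> \<pi> g = \<pi> (f \<boxplus> g)"
proof -
  have "\<pi> (f' \<boxplus> g') = \<pi> (f \<boxplus> g)" if f'_in_class: "f' \<in> \<pi> f" and g'_in_class: "g' \<in> \<pi> g" for f' g'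
    using mem_projD[OF g'_in_class g_hom] mem_projD[OF f'_in_class f_hom] assms
    by (intro proj_Plus_cong[of f' "Src C f" "Tgt C f" f g' g]) auto
  then have "(\<Union>f'\<in>\<pi> f. \<Union>g'\<in>\<pi> g. \<pi> (f' \<boxplus> g')) = \<pi> (f \<boxplus> g)"
    by (intro UN_proj_eq_const f_hom g_hom) blast
  then show ?thesis by (simp add: quotient_category_def)
qed

lemma category_quotient: "category Q"
proof
  fix F assume "F \<in> Arr Q"
  then show "Src Q F \<in> Obj Q" "Tgt Q F \<in> Obj Q" by (auto elim: quotient_ArrE)
next
  fix A assume "A \<in> Obj Q"
  then show "Idn Q A \<in> Hom Q A A" by (auto intro!: quotient_HomI)
next
  fix F G A B D assume "F \<in> Hom Q A B" "G \<in> Hom Q B D"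
  then show "G \<cdot>\<^bsub>Q\<^esub> F \<in> Hom Q A D" by (elim quotient_HomE) (auto intro!: quotient_HomI)
next
  fix F A B assume "F \<in> Hom Q A B"
  then show "F \<cdot>\<^bsub>Q\<^esub> Idn Q A = F" "Idn Q B \<cdot>\<^bsub>Q\<^esub> F = F" by (auto elim!: quotient_HomE)
next
  fix F G H A B D E assume "F \<in> Hom Q A B" "G \<in> Hom Q B D" "H \<in> Hom Q D E"
  then show "(H \<cdot>\<^bsub>Q\<^esub> G) \<cdot>\<^bsub>Q\<^esub> F = H \<cdot>\<^bsub>Q\<^esub> (G \<cdot>\<^bsub>Q\<^esub> F)" by (elim quotient_HomE) simp
qed

lemma comm_group_quotient_hom:
  assumes A_in_Z: "A \<in> Z" and B_in_Z: "B \<in> Z"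
  shows "comm_group (hom_group Q A B)"
proof (rule comm_groupI; simp only: hom_group_def monoid.simps partial_object.simps)
  show "Zer Q A B \<in> Hom Q A B" using A_in_Z B_in_Z by (auto intro!: quotient_HomI)
  show "F \<boxplus>\<^bsub>Q\<^esub> G \<in> Hom Q A B" if "F \<in> Hom Q A B" "G \<in> Hom Q A B" for F G
    using that by (elim quotient_HomE) (auto intro!: quotient_HomI)
  show "(F \<boxplus>\<^bsub>Q\<^esub> G) \<boxplus>\<^bsub>Q\<^esub> H = F \<boxplus>\<^bsub>Q\<^esub> (G \<boxplus>\<^bsub>Q\<^esub> H)"
    if "F \<in> Hom Q A B" "G \<in> Hom Q A B" "H \<in> Hom Q A B" for F G H
    using that by (elim quotient_HomE) simp
  show "F \<boxplus>\<^bsub>Q\<^esub> G = G \<boxplus>\<^bsub>Q\<^esub> F" if "F \<in> Hom Q A B" "G \<in> Hom Q A B" for F G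
    using that by (elim quotient_HomE) (simp, metis Plus_comm)
  show "Zer Q A B \<boxplus>\<^bsub>Q\<^esub> F = F" if "F \<in> Hom Q A B" for F
    using that by (elim quotient_HomE) simp
  show "\<exists>G \<in> Hom Q A B. G \<boxplus>\<^bsub>Q\<^esub> F = Zer Q A B" if F_hom: "F \<in> Hom Q A B" for F
  proof -
    obtain f where f_repr: "f \<in> Hom C A B" "F = \<pi> f" using quotient_HomE[OF F_hom] by blast
    then show ?thesis using A_in_Z B_in_Z by (intro bexI[of _ "\<pi> (\<boxminus> f)"] quotient_HomI) auto
  qed
qed

sublocale Q: preadditive_category Q
proof (intro preadditive_category.intro category_quotient preadditive_category_axioms.intro)
  show "comm_group (hom_group Q A B)" if "A \<in> Obj Q" "B \<in> Obj Q" for A B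
    using comm_group_quotient_hom that by simp
  fix F F' G G' A B D
  show "G \<cdot>\<^bsub>Q\<^esub> (F \<boxplus>\<^bsub>Q\<^esub> F') = G \<cdot>\<^bsub>Q\<^esub> F \<boxplus>\<^bsub>Q\<^esub> G \<cdot>\<^bsub>Q\<^esub> F'"
    if "F \<in> Hom Q A B" "F' \<in> Hom Q A B" "G \<in> Hom Q B D"
    using that by (elim quotient_HomE) simp
  show "(G \<boxplus>\<^bsub>Q\<^esub> G') \<cdot>\<^bsub>Q\<^esub> F = G \<cdot>\<^bsub>Q\<^esub> F \<boxplus>\<^bsub>Q\<^esub> G' \<cdot>\<^bsub>Q\<^esub> F"
    if "F \<in> Hom Q A B" "G \<in> Hom Q B D" "G' \<in> Hom Q B D"
    using that by (elim quotient_HomE) simp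
qed

lemma quotient_Neg [simp]:
  assumes "f \<in> Arr C" "Src C f \<in> Z" "Tgt C f \<in> Z"
  shows "\<boxminus>\<^bsub>Q\<^esub> \<pi> f = \<pi> (\<boxminus> f)"
  using assms by (intro Q.Neg_unique[symmetric]) auto

lemma quotient_biproduct:
  assumes P_biproduct: "biproduct_arrows C A B P i j p q" and "A \<in> Z" "B \<in> Z" "P \<in> Z"
  shows "biproduct_arrows Q A B P (\<pi> i) (\<pi> j) (\<pi> p) (\<pi> q)"
  using biproduct_arrows_arr[OF P_biproduct] biproduct_arrows_sum[OF P_biproduct]
    biproduct_arrows_comp[OF P_biproduct] assms(2-)
  by (simp add: biproduct_arrows_def)

lemma quotient_zero_object: "zero_object C N \<Longrightarrow> N \<in> Z \<Longrightarrow> zero_object Q N"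
  unfolding Q.zero_object_iff zero_object_iff by simp

sublocale Q: additive_category Q
proof unfold_locales
  show "\<exists>N. zero_object Q N"
    using Z_additive quotient_zero_object unfolding additive_subcategory_def by blast
  show "\<exists>P. biproduct Q A B P" if "A \<in> Obj Q" "B \<in> Obj Q" for A B
  proof -
    have A_in_Z: "A \<in> Z" and B_in_Z: "B \<in> Z" using that by simp_all
    obtain P i j p q where "P \<in> Z" "biproduct_arrows C A B P i j p q"
      using Z_biproduct[OF A_in_Z B_in_Z] .
    then have "biproduct_arrows Q A B P (\<pi> i) (\<pi> j) (\<pi> p) (\<pi> q)"
      using quotient_biproduct A_in_Z B_in_Z by simp
    then show ?thesis unfolding Q.biproduct_iff by blast
  qed
qed

lemma iso_arrow_proj_injection:
  assumes P_biproduct: "biproduct_arrows C I A P i j p q" and "I \<in> J" "A \<in> Z" "P \<in> Z"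
  shows "iso_arrow Q (\<pi> j)"
proof (rule Q.iso_arrowI[of _ A P "\<pi> q"])
  note arrs = biproduct_arrows_arr[OF P_biproduct]
  show "\<pi> j \<in> Hom Q A P" "\<pi> q \<in> Hom Q P A" using arrs assms(2-) by auto
  show "\<pi> q \<cdot>\<^bsub>Q\<^esub> \<pi> j = Idn Q A" using arrs by (simp add: biproduct_arrows_comp[OF P_biproduct])
  have "\<pi> (j \<cdot> q) = \<pi> (j \<cdot> q \<boxplus> i \<cdot> p)"
    using arrs assms(2) by (intro proj_Plus_factoring[of _ P P, symmetric]) auto
  also have "j \<cdot> q \<boxplus> i \<cdot> p = Idn C P"
    using arrs Plus_comm[of "j \<cdot> q" "i \<cdot> p"] by (simp add: biproduct_arrows_sum[OF P_biproduct])
  finally show "\<pi> j \<cdot>\<^bsub>Q\<^esub> \<pi> q = Idn Q P" using arrs by simp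
qed

end

section \<open>Conflations in a Frobenius subcategory\<close>

definition conflations :: "('o, 'm, 'b) pt_cat_scheme \<Rightarrow> 'o set \<Rightarrow> ('m \<times> 'm \<times> 'm) set" where
  "conflations C Z = {(f, g, h). \<exists>e. conflation C Z e f g h}"

lemma conflations_iff: "(f, g, h) \<in> conflations C Z \<longleftrightarrow> (\<exists>e. conflation C Z e f g h)"
  by (simp add: conflations_def)

lemma dual_arrow_class [simp]: "arrow_class (dual_category C) J = arrow_class C J"
  by (simp add: arrow_class_def fun_eq_iff)

context pseudo_triangulated
begin

lemma conflations_iff_extensions:
  "(f, g, h) \<in> conflations C Z \<longleftrightarrow> (f, g, h) \<in> extensions C \<and> Src C f \<in> Z \<and> Tgt C f \<in> Z \<and> Tgt C g \<in> Z"
  by (auto simp: conflations_iff extensions_iff conflation_def)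

lemma conflation_extension: "(f, g, h) \<in> conflations C Z \<Longrightarrow> (f, g, h) \<in> extensions C"
  by (simp add: conflations_iff_extensions)

lemma conflation_triangle: "(f, g, h) \<in> conflations C Z \<Longrightarrow> (f, g, h) \<in> RTri C"
  using extension_triangle conflation_extension by blast

lemma conflation_diagram: "(f, g, h) \<in> conflations C Z \<Longrightarrow> rdiagram C (Sig C) f g h"
  using triangle_diagram conflation_triangle by blast

lemma conflation_arr:
  assumes "(f, g, h) \<in> conflations C Z"
  shows "f \<in> Arr C" "g \<in> Arr C" "h \<in> Arr C" "Src C g = Tgt C f" "Src C h = Tgt C g"
    "Tgt C h = \<Sigma>\<^sub>0 (Src C f)" "Src C f \<in> Z" "Tgt C f \<in> Z" "Tgt C g \<in> Z"
  using assms triangle_arr[OF conflation_triangle[OF assms]]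
  by (simp_all add: conflations_iff_extensions)

lemma dual_conflation: "conflation (dual_category C) Z h g f e \<longleftrightarrow> conflation C Z e f g h"
  using extension_arr unfolding conflation_def dual_extension dual_category_select extensions_iff
  by metis

lemma dual_inflation: "inflation (dual_category C) Z = deflation C Z"
  unfolding inflation_def deflation_def fun_eq_iff dual_conflation by blast

lemma dual_deflation: "deflation (dual_category C) Z = inflation C Z"
  unfolding inflation_def deflation_def fun_eq_iff dual_conflation by blast

lemma dual_injectives: "injectives (dual_category C) Z D = projectives C Z D"
  by (simp add: injectives_def projectives_def dual_inflation)

lemma dual_projectives: "projectives (dual_category C) Z D = injectives C Z D"
  by (simp add: injectives_def projectives_def dual_deflation)

lemma dual_frobenius: "frobenius (dual_category C) Z D \<longleftrightarrow> frobenius C Z D"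
  unfolding frobenius_def enough_injectives_def enough_projectives_def
  by (auto simp: dual_injectives dual_projectives dual_inflation dual_deflation)

lemma dual_extension_closed: "extension_closed (dual_category C) Z \<longleftrightarrow> extension_closed C Z"
proof -
  have "Src C g = Tgt C f" if "extension C e f g h" for e f g h
    using extension_arr that unfolding extensions_iff by blast
  then show ?thesis
    unfolding extension_closed_def by (metis dual_extension dual_category_select(3,4))
qed

lemma dual_additive_subcategory:
  "additive_subcategory (dual_category C) Z \<longleftrightarrow> additive_subcategory C Z"
proof -
  have "isomorphic C A B \<longleftrightarrow> isomorphic C B A" for A B using isomorphic_sym by blast
  then show ?thesis by (simp add: additive_subcategory_def)
qed

lemma dual_AC1: "AC1 (dual_category C) \<longleftrightarrow> AC2 C"
  unfolding AC1_def AC2_def dual_extension dual_category_select dual_Hom by blast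

lemma dual_AC2: "AC2 (dual_category C) \<longleftrightarrow> AC1 C"
  unfolding AC1_def AC2_def dual_extension dual_category_select dual_Hom by blast

end

locale frobenius_subcategory = pseudo_triangulated C
  for C :: "('o, 'm, 'b) pt_cat_scheme" (structure) +
  fixes Z D :: "'o set"
  assumes ac1: "AC1 C" and ac2: "AC2 C"
    and Z_subcategory: "additive_subcategory C Z" and Z_extension_closed: "extension_closed C Z"
    and D_subcategory: "additive_subcategory C D" and D_subset: "D \<subseteq> Z"
    and frob: "frobenius C Z D"
begin

abbreviation "J \<equiv> injectives C Z D"

lemma dual_frobenius_subcategory: "frobenius_subcategory (dual_category C) Z D"
  by (intro frobenius_subcategory.intro dual_pseudo_triangulated frobenius_subcategory_axioms.intro)
    (simp_all add: dual_AC1 dual_AC2 dual_additive_subcategory dual_extension_closed dual_frobenius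
      ac1 ac2 Z_subcategory Z_extension_closed D_subcategory D_subset frob)

lemma dual_J: "injectives (dual_category C) Z D = J"
  using frob by (simp add: dual_injectives frobenius_def)

lemma conflationI:
  assumes "(f, g, h) \<in> extensions C" "Src C f \<in> Z" "Tgt C g \<in> Z"
  shows "(f, g, h) \<in> conflations C Z"
  using assms Z_extension_closed
  unfolding conflations_iff_extensions extension_closed_def extensions_iff by blast

lemma injective_extend:
  assumes fgh: "(f, g, h) \<in> conflations C Z" and I_in_J: "I \<in> J" and y_hom: "y \<in> Hom C (Src C f) I"
  obtains y' where "y' \<in> Hom C (Tgt C f) I" "y' \<cdot> f = y"
proof -
  have "(\<lambda>y. y \<cdot> f) ` Hom C (Tgt C f) I = Hom C (Src C f) I"
    using fgh I_in_J unfolding injectives_def inflation_def conflations_iff by blast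
  then show thesis using that y_hom by (metis imageE)
qed

lemma injectiveI:
  assumes I_in_D: "I \<in> D"
    and extend: "\<And>f g h y. (f, g, h) \<in> conflations C Z \<Longrightarrow> y \<in> Hom C (Src C f) I \<Longrightarrow>
      \<exists>y' \<in> Hom C (Tgt C f) I. y' \<cdot> f = y"
  shows "I \<in> J"
proof -
  have "(\<lambda>y. y \<cdot> f) ` Hom C (Tgt C f) I = Hom C (Src C f) I" if f_inflation: "inflation C Z f" for f
  proof
    obtain g h where fgh: "(f, g, h) \<in> conflations C Z"
      using f_inflation unfolding inflation_def conflations_iff by blast
    show "(\<lambda>y. y \<cdot> f) ` Hom C (Tgt C f) I \<subseteq> Hom C (Src C f) I"
      using conflation_arr[OF fgh] by auto
    show "Hom C (Src C f) I \<subseteq> (\<lambda>y. y \<cdot> f) ` Hom C (Tgt C f) I"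
      using extend[OF fgh] by blast
  qed
  then show ?thesis using I_in_D by (simp add: injectives_def)
qed

lemma injectives_biproduct:
  assumes X_in_J: "X \<in> J" and Y_in_J: "Y \<in> J"
  shows "\<exists>P \<in> J. biproduct C X Y P"
proof -
  have "X \<in> D" "Y \<in> D" using X_in_J Y_in_J by (auto simp: injectives_def)
  then obtain P where P_in_D: "P \<in> D" "biproduct C X Y P"
    using D_subcategory unfolding additive_subcategory_def by blast
  then obtain i j p q where P_biproduct: "biproduct_arrows C X Y P i j p q"
    unfolding biproduct_iff by blast
  note ij_arr = biproduct_arrows_arr[OF P_biproduct]
  have "P \<in> J"
  proof (rule injectiveI[OF P_in_D(1)])
    fix f g h y assume fgh: "(f, g, h) \<in> conflations C Z" and y_hom: "y \<in> Hom C (Src C f) P"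
    obtain u where u_spec: "u \<in> Hom C (Tgt C f) X" "u \<cdot> f = p \<cdot> y"
      using injective_extend[OF fgh X_in_J, of "p \<cdot> y"] y_hom ij_arr by auto
    obtain v where v_spec: "v \<in> Hom C (Tgt C f) Y" "v \<cdot> f = q \<cdot> y"
      using injective_extend[OF fgh Y_in_J, of "q \<cdot> y"] y_hom ij_arr by auto
    have "(i \<cdot> u \<boxplus> j \<cdot> v) \<cdot> f = (i \<cdot> p \<boxplus> j \<cdot> q) \<cdot> y"
      using conflation_arr[OF fgh] u_spec v_spec y_hom ij_arr by simp
    then have "(i \<cdot> u \<boxplus> j \<cdot> v) \<cdot> f = y" using biproduct_arrows_sum[OF P_biproduct] y_hom by simp
    moreover have "i \<cdot> u \<boxplus> j \<cdot> v \<in> Hom C (Tgt C f) P" using u_spec v_spec ij_arr by simp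
    ultimately show "\<exists>y' \<in> Hom C (Tgt C f) P. y' \<cdot> f = y" by blast
  qed
  then show ?thesis using P_in_D(2) by blast
qed

lemma enough_injectivesE:
  assumes "X \<in> Z"
  obtains f g h where "(f, g, h) \<in> conflations C Z" "Src C f = X" "Tgt C f \<in> J"
  using frob assms unfolding frobenius_def enough_injectives_def inflation_def conflations_iff
  by blast

lemma enough_projectivesE:
  assumes "X \<in> Z"
  obtains f g h where "(f, g, h) \<in> conflations C Z" "Tgt C g = X" "Tgt C f \<in> J"
proof -
  obtain g where g_deflation: "deflation C Z g" "Tgt C g = X" "Src C g \<in> J"
    using frob assms unfolding frobenius_def enough_projectives_def by blast
  then obtain f h where fgh: "(f, g, h) \<in> conflations C Z"
    unfolding deflation_def conflations_iff by blast
  then show thesis using that[OF fgh] g_deflation conflation_arr(4)[OF fgh] by simp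
qed

sublocale ideal_quotient C Z "injectives C Z D"
proof unfold_locales
  obtain N where "N \<in> Z" using Z_subcategory by (auto simp: additive_subcategory_def)
  then show "J \<noteq> {}" using enough_injectivesE by blast
  show "J \<subseteq> Z" using D_subset by (auto simp: injectives_def)
qed (fact Z_subcategory injectives_biproduct)+

lemma conflation_morphism_of_first:
  assumes fgh: "(f, g, h) \<in> conflations C Z" and fgh': "(f', g', h') \<in> conflations C Z"
    and injective: "Tgt C f' \<in> J" and a_hom: "a \<in> Hom C (Src C f) (Src C f')"
  obtains b c where "rmorphism C (Sig C) (a, b, c) (f, g, h) (f', g', h')"
proof -
  obtain b where b_spec: "b \<in> Hom C (Tgt C f) (Tgt C f')" "b \<cdot> f = f' \<cdot> a"
    using injective_extend[OF fgh injective, of "f' \<cdot> a"] a_hom conflation_arr[OF fgh'] by auto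
  then show thesis
    using triangle_completion[OF conflation_triangle[OF fgh] conflation_triangle[OF fgh'] a_hom]
      that by blast
qed

lemma conflation_morphism_third_unique:
  assumes fgh: "(f, g, h) \<in> conflations C Z" and fgh': "(f', g', h') \<in> conflations C Z"
    and injective: "Tgt C f' \<in> J"
    and abc: "rmorphism C (Sig C) (a, b, c) (f, g, h) (f', g', h')"
    and xyz: "rmorphism C (Sig C) (x, y, z) (f, g, h) (f', g', h')"
    and \<pi>_eq: "\<pi> a = \<pi> x"
  shows "\<pi> c = \<pi> z"
proof -
  note arrs = conflation_arr[OF fgh] conflation_arr[OF fgh']
  have a_hom: "a \<in> Hom C (Src C f) (Src C f')" and x_hom: "x \<in> Hom C (Src C f) (Src C f')"
    and c_hom: "c \<in> Hom C (Tgt C g) (Tgt C g')" and z_hom: "z \<in> Hom C (Tgt C g) (Tgt C g')"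
    using abc xyz by (auto simp: rmorphism_def)
  obtain W u v where W_in_J: "W \<in> J" and u_hom: "u \<in> Hom C (Src C f) W"
    and v_hom: "v \<in> Hom C W (Src C f')"
    and diff: "a \<boxplus> \<boxminus> x = v \<cdot> u"
    using proj_eqE[OF \<pi>_eq a_hom x_hom] by blast
  obtain u' where u'_spec: "u' \<in> Hom C (Tgt C f) W" "u' \<cdot> f = u"
    using injective_extend[OF fgh W_in_J u_hom] by blast
  have "v \<cdot> u' \<in> Hom C (Tgt C f) (Src C f')" "a \<boxplus> \<boxminus> x = (v \<cdot> u') \<cdot> f"
    using arrs v_hom diff u'_spec by auto
  then obtain t where t_spec: "t \<in> Hom C (Tgt C g) (Src C g')" "c \<boxplus> \<boxminus> z = g' \<cdot> t"
    using extension_null_homotopy[OF ac1 conflation_extension[OF fgh] conflation_extension[OF fgh']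
        Susp.rmorphism_diff[OF conflation_diagram[OF fgh] conflation_diagram[OF fgh'] abc xyz]]
    by blast
  show ?thesis using arrs injective t_spec
    by (intro proj_eqI[OF c_hom z_hom injective, of t g']) auto
qed

lemma conflation_morphism_of_third:
  assumes fgh: "(f, g, h) \<in> conflations C Z" and fgh': "(f', g', h') \<in> conflations C Z"
    and projective: "Tgt C f \<in> J" and c_hom: "c \<in> Hom C (Tgt C g) (Tgt C g')"
  obtains a b where "rmorphism C (Sig C) (a, b, c) (f, g, h) (f', g', h')"
proof -
  obtain e e' where conflation: "conflation C Z e f g h"
    and conflation': "conflation C Z e' f' g' h'"
    using fgh fgh' unfolding conflations_iff by blast
  then have confl: "(g, f, e) \<in> conflations (dual_category C) Z"
    "(g', f', e') \<in> conflations (dual_category C) Z"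
    using dual_conflation unfolding conflations_iff by blast+
  have "Tgt (dual_category C) g \<in> injectives (dual_category C) Z D"
    "c \<in> Hom (dual_category C) (Src (dual_category C) g') (Src (dual_category C) g)"
    using projective c_hom conflation_arr[OF fgh] by (simp_all add: dual_J)
  then obtain b a where
    "rmorphism (dual_category C) (Sig (dual_category C)) (c, b, a) (g', f', e') (g, f, e)"
    using frobenius_subcategory.conflation_morphism_of_first[OF dual_frobenius_subcategory
        confl(2,1)]
    by blast
  then show thesis
    using that extension_rmorphism_iff_dual conflation conflation' unfolding conflation_def by blast
qed

lemma conflation_morphism_first_unique:
  assumes fgh: "(f, g, h) \<in> conflations C Z" and fgh': "(f', g', h') \<in> conflations C Z"
    and projective: "Tgt C f \<in> J"
    and abc: "rmorphism C (Sig C) (a, b, c) (f, g, h) (f', g', h')"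
    and xyz: "rmorphism C (Sig C) (x, y, z) (f, g, h) (f', g', h')"
    and \<pi>_eq: "\<pi> c = \<pi> z"
  shows "\<pi> a = \<pi> x"
proof -
  obtain e e' where conflation: "conflation C Z e f g h"
    and conflation': "conflation C Z e' f' g' h'"
    using fgh fgh' unfolding conflations_iff by blast
  then have confl: "(g, f, e) \<in> conflations (dual_category C) Z"
    "(g', f', e') \<in> conflations (dual_category C) Z"
    using dual_conflation unfolding conflations_iff by blast+
  have dual_abc_xyz:
    "rmorphism (dual_category C) (Sig (dual_category C)) (c, b, a) (g', f', e') (g, f, e)"
    "rmorphism (dual_category C) (Sig (dual_category C)) (z, y, x) (g', f', e') (g, f, e)"
    using abc xyz extension_rmorphism_iff_dual conflation conflation'
    unfolding conflation_def by blast+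
  have "Tgt (dual_category C) g \<in> injectives (dual_category C) Z D"
    using projective conflation_arr[OF fgh] by (simp add: dual_J)
  then show ?thesis
    using frobenius_subcategory.conflation_morphism_third_unique[OF dual_frobenius_subcategory
        confl(2,1) _ dual_abc_xyz] \<pi>_eq
    by (simp add: dual_J)
qed

lemma ex_shift_choice: "\<exists>s. shift_choice C Z D s"
proof -
  have "\<forall>X. \<exists>e f g h. X \<in> Z \<longrightarrow> conflation C Z e f g h \<and> Src C f = X \<and> Tgt C f \<in> J"
    using enough_injectivesE unfolding conflations_iff by metis
  then obtain \<delta> \<alpha> \<beta> \<gamma> where conflation:
    "\<And>X. X \<in> Z \<Longrightarrow> conflation C Z (\<delta> X) (\<alpha> X) (\<beta> X) (\<gamma> X) \<and> Src C (\<alpha> X) = X \<and> Tgt C (\<alpha> X) \<in> J"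
    by metis
  have "\<exists>b c. rmorphism C (Sig C) (f, b, c) (\<alpha> X, \<beta> X, \<gamma> X) (\<alpha> Y, \<beta> Y, \<gamma> Y)"
    if "X \<in> Z" "Y \<in> Z" "f \<in> Hom C X Y" for X Y f
    using conflation_morphism_of_first[of "\<alpha> X" "\<beta> X" "\<gamma> X" "\<alpha> Y" "\<beta> Y" "\<gamma> Y" f]
      conflation[OF that(1)] conflation[OF that(2)] that(3) unfolding conflations_iff by metis
  then have "\<forall>f. \<exists>b c. f \<in> Arr C \<and> Src C f \<in> Z \<and> Tgt C f \<in> Z \<longrightarrow> rmorphism C (Sig C) (f, b, c)
      (\<alpha> (Src C f), \<beta> (Src C f), \<gamma> (Src C f)) (\<alpha> (Tgt C f), \<beta> (Tgt C f), \<gamma> (Tgt C f))"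
    unfolding Hom_iff by blast
  then obtain \<iota> \<sigma> where morphism: "\<And>f. f \<in> Arr C \<Longrightarrow> Src C f \<in> Z \<Longrightarrow> Tgt C f \<in> Z \<Longrightarrow>
      rmorphism C (Sig C) (f, \<iota> f, \<sigma> f)
        (\<alpha> (Src C f), \<beta> (Src C f), \<gamma> (Src C f)) (\<alpha> (Tgt C f), \<beta> (Tgt C f), \<gamma> (Tgt C f))"
    by metis
  have "shift_choice C Z D
      \<lparr>sh_delta = \<delta>, sh_alpha = \<alpha>, sh_beta = \<beta>, sh_gamma = \<gamma>, sh_I = \<iota>, sh_S = \<sigma>\<rparr>"
    unfolding shift_choice_def shift_data.simps
  proof (intro conjI ballI)
    fix X assume "X \<in> Z"
    then show "conflation C Z (\<delta> X) (\<alpha> X) (\<beta> X) (\<gamma> X)" "Src C (\<alpha> X) = X" "Tgt C (\<alpha> X) \<in> J"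
      using conflation by blast+
  next
    fix X Y f assume "X \<in> Z" "Y \<in> Z" "f \<in> Hom C X Y"
    then show "rmorphism C (Sig C) (f, \<iota> f, \<sigma> f) (\<alpha> X, \<beta> X, \<gamma> X) (\<alpha> Y, \<beta> Y, \<gamma> Y)"
      using morphism[of f] by simp
  qed
  then show ?thesis by blast
qed

end

section \<open>The shift functor\<close>

locale frobenius_shift = frobenius_subcategory C Z D
  for C :: "('o, 'm, 'b) pt_cat_scheme" (structure) and Z D :: "'o set" +
  fixes s :: "('o, 'm) shift_data"
  assumes shift_choice: "shift_choice C Z D s"
begin

abbreviation "\<alpha> \<equiv> sh_alpha s"
abbreviation "\<beta> \<equiv> sh_beta s"
abbreviation "\<gamma> \<equiv> sh_gamma s"
abbreviation "\<I> X \<equiv> Tgt C (\<alpha> X)"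
abbreviation "\<S> X \<equiv> Tgt C (\<beta> X)"
abbreviation "Shift \<equiv> shift_functor C Z D s"

lemma shift_conflation: "X \<in> Z \<Longrightarrow> (\<alpha> X, \<beta> X, \<gamma> X) \<in> conflations C Z"
  using shift_choice unfolding shift_choice_def conflations_iff by blast

lemma shift_arr [simp]:
  assumes "X \<in> Z"
  shows "\<alpha> X \<in> Arr C" "Src C (\<alpha> X) = X" "\<beta> X \<in> Arr C" "Src C (\<beta> X) = \<I> X"
    "\<gamma> X \<in> Arr C" "Src C (\<gamma> X) = \<S> X" "Tgt C (\<gamma> X) = \<Sigma>\<^sub>0 X" "\<I> X \<in> J" "\<I> X \<in> Z" "\<S> X \<in> Z"
proof -
  show src: "Src C (\<alpha> X) = X" and "\<I> X \<in> J"
    using shift_choice assms by (auto simp: shift_choice_def)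
  then show "\<I> X \<in> Z" by simp
  show "\<alpha> X \<in> Arr C" "\<beta> X \<in> Arr C" "Src C (\<beta> X) = \<I> X"
    "\<gamma> X \<in> Arr C" "Src C (\<gamma> X) = \<S> X" "Tgt C (\<gamma> X) = \<Sigma>\<^sub>0 X" "\<S> X \<in> Z"
    using conflation_arr[OF shift_conflation[OF assms]] src by auto
qed

lemma shift_diagram: "X \<in> Z \<Longrightarrow> rdiagram C (Sig C) (\<alpha> X) (\<beta> X) (\<gamma> X)"
  using conflation_diagram shift_conflation by blast

lemma shift_morphism:
  assumes "f \<in> Hom C X Y" "X \<in> Z" "Y \<in> Z"
  shows "rmorphism C (Sig C) (f, sh_I s f, sh_S s f) (\<alpha> X, \<beta> X, \<gamma> X) (\<alpha> Y, \<beta> Y, \<gamma> Y)"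
  using shift_choice assms unfolding shift_choice_def by blast

lemma sh_S_hom: "f \<in> Hom C X Y \<Longrightarrow> X \<in> Z \<Longrightarrow> Y \<in> Z \<Longrightarrow> sh_S s f \<in> Hom C (\<S> X) (\<S> Y)"
  using shift_morphism[of f X Y] unfolding rmorphism_def by simp

lemma Shift_Ob [simp]: "FOb Shift X = \<S> X"
  by (simp add: shift_functor_def)

lemma Shift_proj:
  assumes X_in_Z: "X \<in> Z" and Y_in_Z: "Y \<in> Z"
    and abc: "rmorphism C (Sig C) (a, b, c) (\<alpha> X, \<beta> X, \<gamma> X) (\<alpha> Y, \<beta> Y, \<gamma> Y)"
  shows "FAr Shift (\<pi> a) = \<pi> c"
proof -
  have a_hom: "a \<in> Hom C X Y" using abc X_in_Z Y_in_Z by (simp add: rmorphism_def)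
  have "\<pi> (sh_S s f) = \<pi> c" if "f \<in> \<pi> a" for f
  proof -
    have f_spec: "f \<in> Hom C X Y" "\<pi> f = \<pi> a" using mem_projD[OF that] a_hom by auto
    show ?thesis
      using conflation_morphism_third_unique[OF shift_conflation[OF X_in_Z]
          shift_conflation[OF Y_in_Z] _
          shift_morphism[OF f_spec(1) X_in_Z Y_in_Z] abc f_spec(2)] Y_in_Z by simp
  qed
  then have "(\<Union>f\<in>\<pi> a. \<pi> (sh_S s f)) = \<pi> c" using UN_proj_eq_const[of a _ "\<pi> c"] a_hom by auto
  then show ?thesis by (simp add: shift_functor_def)
qed

lemma Shift_proj_sh_S: "f \<in> Hom C X Y \<Longrightarrow> X \<in> Z \<Longrightarrow> Y \<in> Z \<Longrightarrow> FAr Shift (\<pi> f) = \<pi> (sh_S s f)"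
  using Shift_proj shift_morphism by blast

lemma Shift_proj_comp:
  assumes f_hom: "f \<in> Hom C X Y" and g_hom: "g \<in> Hom C Y W" and objs_in_Z: "X \<in> Z" "Y \<in> Z" "W \<in> Z"
  shows "FAr Shift (\<pi> (g \<cdot> f)) = FAr Shift (\<pi> g) \<cdot>\<^bsub>Q\<^esub> FAr Shift (\<pi> f)"
proof -
  have "rmorphism C (Sig C) (g \<cdot> f, sh_I s g \<cdot> sh_I s f, sh_S s g \<cdot> sh_S s f)
      (\<alpha> X, \<beta> X, \<gamma> X) (\<alpha> W, \<beta> W, \<gamma> W)"
    using Susp.rmorphism_comp[OF shift_diagram shift_diagram shift_diagram
        shift_morphism[OF f_hom objs_in_Z(1,2)] shift_morphism[OF g_hom objs_in_Z(2,3)]] objs_in_Z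
    by blast
  then have "FAr Shift (\<pi> (g \<cdot> f)) = \<pi> (sh_S s g \<cdot> sh_S s f)" using Shift_proj objs_in_Z by blast
  then show ?thesis
    using sh_S_hom[OF f_hom objs_in_Z(1,2)] sh_S_hom[OF g_hom objs_in_Z(2,3)]
    by (simp add: Shift_proj_sh_S[OF f_hom objs_in_Z(1,2)] Shift_proj_sh_S[OF g_hom objs_in_Z(2,3)])
qed

lemma Shift_proj_Plus:
  assumes f_hom: "f \<in> Hom C X Y" and g_hom: "g \<in> Hom C X Y" and objs_in_Z: "X \<in> Z" "Y \<in> Z"
  shows "FAr Shift (\<pi> (f \<boxplus> g)) = FAr Shift (\<pi> f) \<boxplus>\<^bsub>Q\<^esub> FAr Shift (\<pi> g)"
proof -
  have "rmorphism C (Sig C) (f \<boxplus> g, sh_I s f \<boxplus> sh_I s g, sh_S s f \<boxplus> sh_S s g)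
      (\<alpha> X, \<beta> X, \<gamma> X) (\<alpha> Y, \<beta> Y, \<gamma> Y)"
    using Susp.rmorphism_Plus[OF shift_diagram shift_diagram shift_morphism[OF f_hom objs_in_Z]
        shift_morphism[OF g_hom objs_in_Z]] objs_in_Z
    by blast
  then have "FAr Shift (\<pi> (f \<boxplus> g)) = \<pi> (sh_S s f \<boxplus> sh_S s g)" using Shift_proj objs_in_Z by blast
  then show ?thesis
    using sh_S_hom[OF f_hom objs_in_Z] sh_S_hom[OF g_hom objs_in_Z]
    by (simp add: Shift_proj_sh_S[OF f_hom objs_in_Z] Shift_proj_sh_S[OF g_hom objs_in_Z])
qed

lemma Shift_proj_Idn:
  assumes X_in_Z: "X \<in> Z"
  shows "FAr Shift (\<pi> (Idn C X)) = \<pi> (Idn C (\<S> X))"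
  using Shift_proj[OF X_in_Z X_in_Z] Susp.rmorphism_Idn[OF shift_diagram[OF X_in_Z]] X_in_Z by simp

lemma Shift_additive: "additive_endofunctor Q Shift"
  unfolding additive_endofunctor_def endofunctor_def
proof (intro conjI ballI impI)
  fix A assume "A \<in> Obj Q"
  then have A_in_Z: "A \<in> Z" by simp
  then show "FOb Shift A \<in> Obj Q" by simp
  show "FAr Shift (Idn Q A) = Idn Q (FOb Shift A)" using Shift_proj_Idn[OF A_in_Z] by simp
next
  fix F assume "F \<in> Arr Q"
  then obtain f where f_repr: "f \<in> Hom C (Src C f) (Tgt C f)" "Src C f \<in> Z" "Tgt C f \<in> Z" "F = \<pi> f"
    by (auto elim: quotient_ArrE)
  then show "FAr Shift F \<in> Hom Q (FOb Shift (Src Q F)) (FOb Shift (Tgt Q F))"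
    using Shift_proj_sh_S[OF f_repr(1-3)] sh_S_hom[OF f_repr(1-3)] by simp
  fix G assume "G \<in> Arr Q" "Src Q G = Tgt Q F"
  then obtain g where g_repr: "g \<in> Hom C (Tgt C f) (Tgt C g)" "Tgt C g \<in> Z" "G = \<pi> g"
    using f_repr by (auto elim!: quotient_ArrE)
  then show "FAr Shift (G \<cdot>\<^bsub>Q\<^esub> F) = FAr Shift G \<cdot>\<^bsub>Q\<^esub> FAr Shift F"
    using f_repr Shift_proj_comp[OF f_repr(1) g_repr(1) f_repr(2,3) g_repr(2)] by simp
next
  fix A B F G assume "A \<in> Obj Q" "B \<in> Obj Q" "F \<in> Hom Q A B" "G \<in> Hom Q A B"
  then obtain f g where f_repr: "f \<in> Hom C A B" "F = \<pi> f" and g_repr: "g \<in> Hom C A B" "G = \<pi> g"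
    and objs_in_Z: "A \<in> Z" "B \<in> Z"
    by (auto elim!: quotient_HomE simp del: Hom_iff Q.Hom_iff)
  then show "FAr Shift (F \<boxplus>\<^bsub>Q\<^esub> G) = FAr Shift F \<boxplus>\<^bsub>Q\<^esub> FAr Shift G"
    using Shift_proj_Plus[OF f_repr(1) g_repr(1) objs_in_Z] by simp
qed

sublocale Shift: shifted_category Q Shift
  by unfold_locales (rule Shift_additive)

lemma Shift_full:
  assumes A_in_Z: "A \<in> Z" and B_in_Z: "B \<in> Z" and K_hom: "K \<in> Hom Q (\<S> A) (\<S> B)"
  shows "\<exists>F \<in> Hom Q A B. FAr Shift F = K"
proof -
  obtain c where c_repr: "c \<in> Hom C (\<S> A) (\<S> B)" "K = \<pi> c" using quotient_HomE[OF K_hom] by blast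
  obtain a b where abc: "rmorphism C (Sig C) (a, b, c) (\<alpha> A, \<beta> A, \<gamma> A) (\<alpha> B, \<beta> B, \<gamma> B)"
    using conflation_morphism_of_third[OF shift_conflation[OF A_in_Z] shift_conflation[OF B_in_Z] _
        c_repr(1)] A_in_Z by auto
  then have "a \<in> Hom C A B" using A_in_Z B_in_Z by (simp add: rmorphism_def)
  then show ?thesis using Shift_proj[OF A_in_Z B_in_Z abc] c_repr(2) quotient_HomI A_in_Z B_in_Z
    by blast
qed

lemma Shift_faithful:
  assumes F_hom: "F \<in> Hom Q A B" and G_hom: "G \<in> Hom Q A B"
    and Shift_eq: "FAr Shift F = FAr Shift G"
  shows "F = G"
proof -
  obtain f where f_repr: "f \<in> Hom C A B" "F = \<pi> f" and objs_in_Z: "A \<in> Z" "B \<in> Z"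
    using quotient_HomE[OF F_hom] by blast
  obtain g where g_repr: "g \<in> Hom C A B" "G = \<pi> g" using quotient_HomE[OF G_hom] by blast
  have "\<pi> (sh_S s f) = \<pi> (sh_S s g)"
    using Shift_eq f_repr g_repr objs_in_Z by (simp add: Shift_proj_sh_S[of _ A B])
  then show ?thesis
    using conflation_morphism_first_unique[OF shift_conflation[OF objs_in_Z(1)]
        shift_conflation[OF objs_in_Z(2)] _
        shift_morphism[OF f_repr(1) objs_in_Z] shift_morphism[OF g_repr(1) objs_in_Z]] objs_in_Z
        f_repr g_repr by simp
qed

text \<open>If \<open>P\<close> is projective, hence injective, then \<open>A \<rightarrow> P \<rightarrow> B\<close> may serve to compute \<open>\<S> A\<close>.\<close>

lemma Shift_essentially_surjective:
  assumes B_in_Z: "B \<in> Z"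
  shows "\<exists>A \<in> Z. isomorphic Q (\<S> A) B"
proof -
  obtain f g h where fgh: "(f, g, h) \<in> conflations C Z" and tgt_g: "Tgt C g = B"
    and middle: "Tgt C f \<in> J"
    using enough_projectivesE[OF B_in_Z] .
  let ?A = "Src C f"
  have A_in_Z: "?A \<in> Z" using conflation_arr[OF fgh] by simp
  note shift = shift_conflation[OF A_in_Z]
    and diagrams = conflation_diagram[OF fgh] shift_diagram[OF A_in_Z]
  obtain b c where bc_morphism: "rmorphism C (Sig C) (Idn C ?A, b, c) (f, g, h) (\<alpha> ?A, \<beta> ?A, \<gamma> ?A)"
    using conflation_morphism_of_first[OF fgh shift, of "Idn C ?A"] A_in_Z by auto
  obtain b' c' where bc'_morphism:
    "rmorphism C (Sig C) (Idn C ?A, b', c') (\<alpha> ?A, \<beta> ?A, \<gamma> ?A) (f, g, h)"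
    using conflation_morphism_of_first[OF shift fgh middle, of "Idn C ?A"] A_in_Z by auto
  have c_hom: "c \<in> Hom C B (\<S> ?A)" "c' \<in> Hom C (\<S> ?A) B"
    using bc_morphism bc'_morphism tgt_g by (auto simp: rmorphism_def)
  have "\<pi> (c' \<cdot> c) = \<pi> (Idn C B)"
    using conflation_morphism_third_unique[OF fgh fgh middle
        Susp.rmorphism_comp[OF diagrams(1,2,1) bc_morphism bc'_morphism]
          Susp.rmorphism_Idn[OF diagrams(1)]] A_in_Z tgt_g by simp
  moreover have "\<pi> (c \<cdot> c') = \<pi> (Idn C (\<S> ?A))"
    using conflation_morphism_third_unique[OF shift shift _
        Susp.rmorphism_comp[OF diagrams(2,1,2) bc'_morphism bc_morphism]
          Susp.rmorphism_Idn[OF diagrams(2)]] A_in_Z by simp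
  ultimately have "iso_arrow Q (\<pi> c')" "\<pi> c' \<in> Hom Q (\<S> ?A) B"
    using c_hom A_in_Z B_in_Z by (auto intro!: Q.iso_arrowI[of "\<pi> c'" "\<S> ?A" B "\<pi> c"])
  then show ?thesis using A_in_Z unfolding isomorphic_def by blast
qed

end

section \<open>The right triangulation of the quotient\<close>

context frobenius_shift
begin

abbreviation "\<T> \<equiv> distinguished_triangles C Z D s"

definition connecting :: "'m \<Rightarrow> 'm \<Rightarrow> 'm \<Rightarrow> 'm \<Rightarrow> bool" where
  "connecting f g h q \<longleftrightarrow> (f, g, h) \<in> conflations C Z \<and>
     (\<exists>p. rmorphism C (Sig C) (Idn C (Src C f), p, q) (f, g, h)
        (\<alpha> (Src C f), \<beta> (Src C f), \<gamma> (Src C f)))"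

lemma connecting_ex:
  assumes fgh: "(f, g, h) \<in> conflations C Z"
  obtains q where "connecting f g h q"
proof -
  have "Src C f \<in> Z" using conflation_arr[OF fgh] by simp
  then show thesis
    using conflation_morphism_of_first[OF fgh shift_conflation, of "Src C f" "Idn C (Src C f)"] that
      fgh
    unfolding connecting_def by auto
qed

lemma connectingE:
  assumes "connecting f g h q"
  obtains p where "rmorphism C (Sig C) (Idn C (Src C f), p, q) (f, g, h)
    (\<alpha> (Src C f), \<beta> (Src C f), \<gamma> (Src C f))"
  using assms unfolding connecting_def by blast

lemma connecting_conflation: "connecting f g h q \<Longrightarrow> (f, g, h) \<in> conflations C Z"
  by (simp add: connecting_def)

lemmas connecting_arr = conflation_arr[OF connecting_conflation]

lemma connecting_hom: "connecting f g h q \<Longrightarrow> q \<in> Hom C (Tgt C g) (\<S> (Src C f))"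
  unfolding connecting_def rmorphism_def by auto

lemma connecting_unique:
  assumes fghq: "connecting f g h q"
    and pq'_morphism: "rmorphism C (Sig C) (Idn C (Src C f), p', q') (f, g, h)
      (\<alpha> (Src C f), \<beta> (Src C f), \<gamma> (Src C f))"
  shows "\<pi> q' = \<pi> q"
proof -
  obtain p where pq_morphism: "rmorphism C (Sig C) (Idn C (Src C f), p, q) (f, g, h)
      (\<alpha> (Src C f), \<beta> (Src C f), \<gamma> (Src C f))"
    using connectingE[OF fghq] .
  have src_in_Z: "Src C f \<in> Z" using connecting_arr[OF fghq] by simp
  show ?thesis
    using conflation_morphism_third_unique[OF connecting_conflation[OF fghq]
        shift_conflation[OF src_in_Z] _ pq'_morphism pq_morphism]
      src_in_Z by simp
qed

lemma connecting_shift_morphism: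
  assumes fghq: "connecting f g h q" and a_hom: "a \<in> Hom C (Src C f) Y" and Y_in_Z: "Y \<in> Z"
  obtains b where "rmorphism C (Sig C) (a, b, sh_S s a \<cdot> q) (f, g, h) (\<alpha> Y, \<beta> Y, \<gamma> Y)"
proof -
  have src_in_Z: "Src C f \<in> Z" using connecting_arr[OF fghq] by simp
  obtain p where "rmorphism C (Sig C) (Idn C (Src C f), p, q) (f, g, h)
      (\<alpha> (Src C f), \<beta> (Src C f), \<gamma> (Src C f))"
    using connectingE[OF fghq] .
  then have "rmorphism C (Sig C) (a \<cdot> Idn C (Src C f), sh_I s a \<cdot> p, sh_S s a \<cdot> q) (f, g, h)
      (\<alpha> Y, \<beta> Y, \<gamma> Y)"
    using Susp.rmorphism_comp[OF conflation_diagram[OF connecting_conflation[OF fghq]]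
        shift_diagram[OF src_in_Z]
        shift_diagram[OF Y_in_Z]] shift_morphism[OF a_hom src_in_Z Y_in_Z] by blast
  then show thesis using that a_hom by simp
qed

lemma Shift_proj_connecting:
  assumes fghq: "connecting f g h q" and X_in_Z: "X \<in> Z"
    and abc: "rmorphism C (Sig C) (a, b, c) (\<alpha> X, \<beta> X, \<gamma> X) (f, g, h)"
  shows "FAr Shift (\<pi> a) = \<pi> (q \<cdot> c)"
proof -
  have src_in_Z: "Src C f \<in> Z" using connecting_arr[OF fghq] by simp
  have a_hom: "a \<in> Hom C X (Src C f)" using abc X_in_Z by (simp add: rmorphism_def)
  obtain p where pq_morphism: "rmorphism C (Sig C) (Idn C (Src C f), p, q) (f, g, h)
      (\<alpha> (Src C f), \<beta> (Src C f), \<gamma> (Src C f))"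
    using connectingE[OF fghq] .
  have "rmorphism C (Sig C) (a, p \<cdot> b, q \<cdot> c) (\<alpha> X, \<beta> X, \<gamma> X)
      (\<alpha> (Src C f), \<beta> (Src C f), \<gamma> (Src C f))"
    using Susp.rmorphism_comp[OF shift_diagram[OF X_in_Z]
        conflation_diagram[OF connecting_conflation[OF fghq]] shift_diagram[OF src_in_Z] abc
          pq_morphism] a_hom by simp
  then show ?thesis using Shift_proj[OF X_in_Z src_in_Z] by blast
qed

lemma standard_triangles_eq:
  "standard_triangles C Z D s = {(\<pi> f, \<pi> g, \<pi> q) | f g h q. connecting f g h q}"
proof (intro equalityI subsetI)
  fix t assume "t \<in> standard_triangles C Z D s"
  then obtain f g h p q where fgh: "(f, g, h) \<in> conflations C Z" and t_eq: "t = (\<pi> f, \<pi> g, \<pi> q)"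
    and p_spec: "p \<in> Hom C (Tgt C f) (\<I> (Src C f))" "p \<cdot> f = \<alpha> (Src C f)"
    and q_spec: "q \<in> Hom C (Tgt C g) (\<S> (Src C f))" "q \<cdot> g = \<beta> (Src C f) \<cdot> p" "\<gamma> (Src C f) \<cdot> q = h"
    unfolding standard_triangles_def conflations_iff by blast
  have "connecting f g h q"
    unfolding connecting_def rmorphism_def using p_spec q_spec fgh conflation_arr[OF fgh]
    by (auto intro!: exI[of _ p])
  then show "t \<in> {(\<pi> f, \<pi> g, \<pi> q) | f g h q. connecting f g h q}" using t_eq by blast
next
  fix t assume "t \<in> {(\<pi> f, \<pi> g, \<pi> q) | f g h q. connecting f g h q}"
  then obtain f g h q where fghq: "connecting f g h q" and t_eq: "t = (\<pi> f, \<pi> g, \<pi> q)" by blast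
  obtain e where conflation: "conflation C Z e f g h"
    using connecting_conflation[OF fghq] unfolding conflations_iff by blast
  obtain p where "rmorphism C (Sig C) (Idn C (Src C f), p, q) (f, g, h)
      (\<alpha> (Src C f), \<beta> (Src C f), \<gamma> (Src C f))"
    using connectingE[OF fghq] .
  then have "p \<in> Hom C (Tgt C f) (\<I> (Src C f))" "q \<in> Hom C (Tgt C g) (\<S> (Src C f))"
    "p \<cdot> f = \<alpha> (Src C f)" "q \<cdot> g = \<beta> (Src C f) \<cdot> p" "\<gamma> (Src C f) \<cdot> q = h"
    using connecting_arr[OF fghq] by (auto simp: rmorphism_def)
  then show "t \<in> standard_triangles C Z D s"
    unfolding standard_triangles_def t_eq using conflation by blast
qed

lemma standard_diagram: "connecting f g h q \<Longrightarrow> rdiagram Q Shift (\<pi> f) (\<pi> g) (\<pi> q)"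
  using connecting_arr[of f g h q] connecting_hom[of f g h q] by (simp add: rdiagram_def)

lemma distinguished_iff:
  "(u, v, w) \<in> \<T> \<longleftrightarrow> rdiagram Q Shift u v w \<and>
     (\<exists>f g h q. connecting f g h q \<and> risomorphic Q Shift (u, v, w) (\<pi> f, \<pi> g, \<pi> q))"
  unfolding distinguished_triangles_def standard_triangles_eq by blast

lemma standard_distinguished: "connecting f g h q \<Longrightarrow> (\<pi> f, \<pi> g, \<pi> q) \<in> \<T>"
  unfolding distinguished_iff using standard_diagram Shift.risomorphic_refl by blast

lemma distinguished_diagram: "(u, v, w) \<in> \<T> \<Longrightarrow> rdiagram Q Shift u v w"
  by (simp add: distinguished_iff)

lemma distinguishedE:
  assumes "(u, v, w) \<in> \<T>"
  obtains f g h q a b c where "connecting f g h q"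
    "rmorphism Q Shift (a, b, c) (u, v, w) (\<pi> f, \<pi> g, \<pi> q)"
    "iso_arrow Q a" "iso_arrow Q b" "iso_arrow Q c"
  using assms unfolding distinguished_iff risomorphic_def by blast

lemma distinguishedI:
  assumes "connecting f g h q" "rdiagram Q Shift u v w"
    and "rmorphism Q Shift (a, b, c) (u, v, w) (\<pi> f, \<pi> g, \<pi> q)"
    and "iso_arrow Q a" "iso_arrow Q b" "iso_arrow Q c"
  shows "(u, v, w) \<in> \<T>"
  using assms unfolding distinguished_iff risomorphic_def by blast

lemma distinguished_iso_closed:
  assumes uvw: "(u, v, w) \<in> \<T>" and diagram': "rdiagram Q Shift u' v' w'"
    and iso: "risomorphic Q Shift (u, v, w) (u', v', w')"
  shows "(u', v', w') \<in> \<T>"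
proof -
  obtain f g h q where fghq: "connecting f g h q"
    and standard: "risomorphic Q Shift (u, v, w) (\<pi> f, \<pi> g, \<pi> q)"
    using uvw unfolding distinguished_iff by blast
  note diagram = distinguished_diagram[OF uvw]
  have "risomorphic Q Shift (u', v', w') (\<pi> f, \<pi> g, \<pi> q)"
    using Shift.risomorphic_trans[OF diagram' diagram standard_diagram[OF fghq]
        Shift.risomorphic_sym[OF diagram diagram' iso]
        standard] .
  then show ?thesis unfolding distinguished_iff using diagram' fghq by blast
qed

lemma standard_morphism:
  assumes fghq: "connecting f g h q" and fghq': "connecting f' g' h' q'"
    and abc: "rmorphism C (Sig C) (a, b, c) (f, g, h) (f', g', h')"
  shows "rmorphism Q Shift (\<pi> a, \<pi> b, \<pi> c) (\<pi> f, \<pi> g, \<pi> q) (\<pi> f', \<pi> g', \<pi> q')"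
proof -
  let ?A = "Src C f" and ?A' = "Src C f'"
  note arrs = connecting_arr[OF fghq] connecting_arr[OF fghq'] connecting_hom[OF fghq]
    connecting_hom[OF fghq']
  have objs_in_Z: "?A \<in> Z" "?A' \<in> Z" using arrs by auto
  note diagrams = conflation_diagram[OF connecting_conflation[OF fghq]]
    conflation_diagram[OF connecting_conflation[OF fghq']] shift_diagram[OF objs_in_Z(2)]
  have abc_hom: "a \<in> Hom C ?A ?A'" "b \<in> Hom C (Tgt C f) (Tgt C f')" "c \<in> Hom C (Tgt C g) (Tgt C g')"
    and squares: "b \<cdot> f = f' \<cdot> a" "c \<cdot> g = g' \<cdot> b"
    using abc by (auto simp: rmorphism_def)
  note a_hom = abc_hom(1)
  obtain p' where pq'_morphism:
    "rmorphism C (Sig C) (Idn C ?A', p', q') (f', g', h') (\<alpha> ?A', \<beta> ?A', \<gamma> ?A')"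
    using connectingE[OF fghq'] .
  have via_target: "rmorphism C (Sig C) (a, p' \<cdot> b, q' \<cdot> c) (f, g, h) (\<alpha> ?A', \<beta> ?A', \<gamma> ?A')"
    using Susp.rmorphism_comp[OF diagrams abc pq'_morphism] a_hom by simp
  obtain b' where via_source:
    "rmorphism C (Sig C) (a, b', sh_S s a \<cdot> q) (f, g, h) (\<alpha> ?A', \<beta> ?A', \<gamma> ?A')"
    using connecting_shift_morphism[OF fghq a_hom objs_in_Z(2)] .
  have "\<pi> (sh_S s a \<cdot> q) = \<pi> (q' \<cdot> c)"
    using conflation_morphism_third_unique[OF connecting_conflation[OF fghq]
        shift_conflation[OF objs_in_Z(2)]
        _ via_source via_target refl] objs_in_Z by simp
  then show ?thesis
    using arrs abc_hom squares sh_S_hom[OF a_hom objs_in_Z]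
    by (simp add: rmorphism_def Shift_proj_sh_S[OF a_hom objs_in_Z])
qed

lemma cone_conflation:
  assumes f_hom: "f \<in> Hom C X Y" and objs_in_Z: "X \<in> Z" "Y \<in> Z"
    and P_biproduct: "biproduct_arrows C (\<I> X) Y P u v r s'"
  obtains m n where "(v \<cdot> f \<boxplus> u \<cdot> \<alpha> X, m, n) \<in> conflations C Z"
proof -
  let ?l = "v \<cdot> f \<boxplus> u \<cdot> \<alpha> X"
  note arrs = biproduct_arrows_arr[OF P_biproduct] shift_arr[OF objs_in_Z(1)]
    and shift = conflation_extension[OF shift_conflation[OF objs_in_Z(1)]]
  have l_hom: "?l \<in> Hom C X P" using f_hom arrs by simp
  have "r \<cdot> ?l = \<alpha> X" "r \<in> Hom C P (\<I> X)"
    using f_hom arrs by (simp_all add: biproduct_arrows_comp[OF P_biproduct])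
  then obtain m n where lmn: "(?l, m, n) \<in> extensions C"
    using extension_of_factor[OF shift _ l_hom] by blast
  have "f \<in> Hom C (Src C (\<alpha> X)) Y" using f_hom arrs by simp
  then obtain g where g_spec: "g \<in> Hom C (Tgt C m) (\<S> X)"
    "(m \<cdot> v, g, \<boxminus> (\<Sigma>\<^sub>1 f \<cdot> \<gamma> X)) \<in> extensions C"
    using extension_cobase_change[OF shift _ P_biproduct lmn] by blast
  note arrs = arrs extension_arr[OF lmn]
  have "(m \<cdot> v, g, \<boxminus> (\<Sigma>\<^sub>1 f \<cdot> \<gamma> X)) \<in> conflations C Z"
    using g_spec arrs l_hom objs_in_Z by (intro conflationI) auto
  then have "Tgt C m \<in> Z" using conflation_arr(8) arrs l_hom by fastforce
  then have "(?l, m, n) \<in> conflations C Z" using lmn l_hom objs_in_Z(1) by (intro conflationI) auto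
  then show thesis by (rule that)
qed

lemma distinguished_ex:
  assumes F_hom: "F \<in> Arr Q"
  shows "\<exists>G H. (F, G, H) \<in> \<T>"
proof -
  obtain f where f_repr: "f \<in> Arr C" "F = \<pi> f" and objs_in_Z: "Src C f \<in> Z" "Tgt C f \<in> Z"
    using quotient_ArrE[OF F_hom] by blast
  let ?X = "Src C f" and ?Y = "Tgt C f"
  obtain P u v r s' where P_in_Z: "P \<in> Z" and P_biproduct: "biproduct_arrows C (\<I> ?X) ?Y P u v r s'"
    using Z_biproduct[OF shift_arr(9)[OF objs_in_Z(1)] objs_in_Z(2)] .
  let ?l = "v \<cdot> f \<boxplus> u \<cdot> \<alpha> ?X"
  obtain m n where lmn: "(?l, m, n) \<in> conflations C Z"
    using cone_conflation[OF _ objs_in_Z P_biproduct, of f] f_repr(1) by auto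
  obtain q where lmnq: "connecting ?l m n q" using connecting_ex[OF lmn] .
  have l_hom: "?l \<in> Hom C ?X P" using f_repr objs_in_Z biproduct_arrows_arr[OF P_biproduct] by simp
  note arrs = f_repr(1) l_hom biproduct_arrows_arr[OF P_biproduct] connecting_arr[OF lmnq]
    connecting_hom[OF lmnq]
  have "(\<pi> f, \<pi> (m \<cdot> v), \<pi> q) \<in> \<T>"
  proof (rule distinguishedI[OF lmnq])
    show "rdiagram Q Shift (\<pi> f) (\<pi> (m \<cdot> v)) (\<pi> q)" using arrs objs_in_Z by (simp add: rdiagram_def)
    have "\<pi> ?l = \<pi> (v \<cdot> f)"
      using proj_Plus_factoring[of "v \<cdot> f" ?X P "\<I> ?X" "\<alpha> ?X" u] arrs objs_in_Z by simp
    then show "rmorphism Q Shift (Idn Q ?X, \<pi> v, Idn Q (Tgt C m))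
        (\<pi> f, \<pi> (m \<cdot> v), \<pi> q) (\<pi> ?l, \<pi> m, \<pi> q)"
      using arrs objs_in_Z P_in_Z Shift_proj_Idn[OF objs_in_Z(1)]
      by (simp add: rmorphism_def del: comp_Plus Plus_arr)
    show "iso_arrow Q (\<pi> v)" using iso_arrow_proj_injection[OF P_biproduct] objs_in_Z P_in_Z by simp
  qed (use arrs objs_in_Z Q.iso_arrow_Idn[of ?X] Q.iso_arrow_Idn[of "Tgt C m"] in simp_all)
  then show ?thesis using f_repr(2) by blast
qed

lemma distinguished_zero:
  assumes N_zero: "zero_object Q N" and A_obj: "A \<in> Obj Q"
  shows "(Zer Q N A, Idn Q A, Zer Q A (FOb Shift N)) \<in> \<T>"
proof -
  obtain N\<^sub>0 where N\<^sub>0_zero: "N\<^sub>0 \<in> Z" "zero_object C N\<^sub>0"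
    using Z_subcategory unfolding additive_subcategory_def by blast
  have objs_in_Z: "A \<in> Z" "N \<in> Z" using A_obj N_zero by (auto simp: Q.zero_object_iff)
  have "(Zer C N\<^sub>0 A, Idn C A, Zer C A (\<Sigma>\<^sub>0 N\<^sub>0)) \<in> conflations C Z"
    using zero_extension[OF N\<^sub>0_zero(2), of A] N\<^sub>0_zero objs_in_Z by (intro conflationI) auto
  then obtain q where conn: "connecting (Zer C N\<^sub>0 A) (Idn C A) (Zer C A (\<Sigma>\<^sub>0 N\<^sub>0)) q"
    by (rule connecting_ex)
  have q_hom: "q \<in> Hom C A (\<S> N\<^sub>0)" using connecting_hom[OF conn] objs_in_Z N\<^sub>0_zero by simp
  have zero: "zero_object Q N\<^sub>0" using quotient_zero_object N\<^sub>0_zero by blast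
  have \<pi>q_eq: "\<pi> q = Zer Q A (\<S> N\<^sub>0)"
    using Q.arrow_to_zero_object[OF Shift.FOb_zero_object[OF zero], of "\<pi> q"] q_hom objs_in_Z
      N\<^sub>0_zero by simp
  show ?thesis
  proof (rule distinguishedI[OF conn])
    show "rdiagram Q Shift (Zer Q N A) (Idn Q A) (Zer Q A (FOb Shift N))"
      using objs_in_Z by (simp add: rdiagram_def)
    show "rmorphism Q Shift (Zer Q N N\<^sub>0, Idn Q A, Idn Q A)
        (Zer Q N A, Idn Q A, Zer Q A (FOb Shift N)) (\<pi> (Zer C N\<^sub>0 A), \<pi> (Idn C A), \<pi> q)"
      using objs_in_Z N\<^sub>0_zero \<pi>q_eq q_hom Shift.FAr_Zer[of N N\<^sub>0] by (simp add: rmorphism_def)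
    show "iso_arrow Q (Zer Q N N\<^sub>0)" using Q.iso_arrow_zero_objects[OF N_zero zero] .
  qed (use Q.iso_arrow_Idn[OF A_obj] in simp_all)
qed

lemma connecting_rotate:
  assumes fghq: "connecting f g h q"
    and R_biproduct: "biproduct_arrows C (\<I> (Src C f)) (Tgt C g) R u v r s'"
  obtains c k h' q' where "connecting c k h' q'" "c \<in> Hom C (Tgt C f) R" "k \<in> Hom C R (\<S> (Src C f))"
    "\<pi> c = \<pi> (v \<cdot> g)" "\<pi> (k \<cdot> v) = \<pi> q" "FAr Shift (\<pi> f) = \<pi> (\<boxminus> q')"
proof -
  let ?X = "Src C f" and ?Y = "Tgt C f"
  note fgh = connecting_conflation[OF fghq]
  have X_in_Z: "?X \<in> Z" using connecting_arr[OF fghq] by simp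
  obtain p where p_spec: "p \<in> Hom C ?Y (\<I> ?X)" "p \<cdot> f = \<alpha> ?X"
    using injective_extend[OF fgh, of "\<I> ?X" "\<alpha> ?X"] X_in_Z by auto
  define c where "c = v \<cdot> g \<boxplus> \<boxminus> (u \<cdot> p)"
  let ?h' = "\<boxminus> (\<Sigma>\<^sub>1 f \<cdot> \<gamma> ?X)"
  obtain k where ckh: "(c, k, ?h') \<in> extensions C" and k_spec: "k \<in> Hom C R (\<S> ?X)" "k \<cdot> u = \<beta> ?X"
    and pkv: "rmorphism C (Sig C) (Idn C ?X, p, k \<cdot> v) (f, g, h) (\<alpha> ?X, \<beta> ?X, \<gamma> ?X)"
    using extension_mapping_cone[OF conflation_extension[OF fgh]
        conflation_extension[OF shift_conflation[OF X_in_Z]] _ p_spec R_biproduct] X_in_Z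
    unfolding c_def by auto
  note arrs = connecting_arr[OF fghq] biproduct_arrows_arr[OF R_biproduct] p_spec(1) k_spec(1)
    shift_arr[OF X_in_Z]
  have c_hom: "c \<in> Hom C ?Y R" using arrs by (simp add: c_def)
  have "(c, k, ?h') \<in> conflations C Z" using ckh arrs c_hom by (intro conflationI) auto
  then obtain q' where ckq: "connecting c k ?h' q'" by (rule connecting_ex)
  have "c \<cdot> f = \<boxminus> (u \<cdot> \<alpha> ?X)"
    using arrs p_spec(2) comp_zero_first[OF conflation_triangle[OF fgh]] by (simp add: c_def)
  then have "rmorphism C (Sig C) (f, \<boxminus> u, \<boxminus> Idn C (\<S> ?X)) (\<alpha> ?X, \<beta> ?X, \<gamma> ?X) (c, k, ?h')"
    using arrs c_hom k_spec(2) by (simp add: rmorphism_def)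
  then have "FAr Shift (\<pi> f) = \<pi> (q' \<cdot> \<boxminus> Idn C (\<S> ?X))"
    by (rule Shift_proj_connecting[OF ckq X_in_Z])
  then have "FAr Shift (\<pi> f) = \<pi> (\<boxminus> q')" using connecting_hom[OF ckq] c_hom arrs by simp
  moreover have "\<pi> c = \<pi> (v \<cdot> g)"
    using proj_Plus_factoring[of "v \<cdot> g" ?Y R "\<I> ?X" "\<boxminus> p" u] arrs by (simp add: c_def)
  ultimately show thesis using that[OF ckq c_hom k_spec(1)] connecting_unique[OF fghq pkv] by blast
qed

lemma standard_rotate:
  assumes fghq: "connecting f g h q"
  shows "(\<pi> g, \<pi> q, \<boxminus>\<^bsub>Q\<^esub> FAr Shift (\<pi> f)) \<in> \<T>"
proof -
  let ?X = "Src C f" and ?Y = "Tgt C f" and ?W = "Tgt C g"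
  have X_in_Z: "?X \<in> Z" and W_in_Z: "?W \<in> Z" using connecting_arr[OF fghq] by auto
  obtain R u v r s' where R_in_Z: "R \<in> Z" and R_biproduct: "biproduct_arrows C (\<I> ?X) ?W R u v r s'"
    using Z_biproduct[OF shift_arr(9)[OF X_in_Z] W_in_Z] .
  obtain c k h' q' where ckq: "connecting c k h' q'" and c_hom: "c \<in> Hom C ?Y R"
    and k_hom: "k \<in> Hom C R (\<S> ?X)"
    and cv_eq: "\<pi> c = \<pi> (v \<cdot> g)" and kv_eq: "\<pi> (k \<cdot> v) = \<pi> q"
    and Sf_eq: "FAr Shift (\<pi> f) = \<pi> (\<boxminus> q')"
    using connecting_rotate[OF fghq R_biproduct] .
  have q'_hom: "q' \<in> Hom C (\<S> ?X) (\<S> ?Y)" using connecting_hom[OF ckq] c_hom k_hom by simp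
  note arrs = connecting_arr[OF fghq] connecting_hom[OF fghq] biproduct_arrows_arr[OF R_biproduct]
    c_hom k_hom q'_hom
    shift_arr[OF X_in_Z]
  show ?thesis
  proof (rule distinguishedI[OF ckq])
    show "rdiagram Q Shift (\<pi> g) (\<pi> q) (\<boxminus>\<^bsub>Q\<^esub> FAr Shift (\<pi> f))"
      unfolding Sf_eq using arrs by (simp add: rdiagram_def)
    show "rmorphism Q Shift (Idn Q ?Y, \<pi> v, Idn Q (\<S> ?X))
        (\<pi> g, \<pi> q, \<boxminus>\<^bsub>Q\<^esub> FAr Shift (\<pi> f)) (\<pi> c, \<pi> k, \<pi> q')"
      unfolding Shift.rmorphism_iff Sf_eq
      using arrs R_in_Z kv_eq cv_eq Shift_proj_Idn[of ?Y] by (simp del: comp_assoc_arr)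
    show "iso_arrow Q (\<pi> v)"
      using iso_arrow_proj_injection[OF R_biproduct] W_in_Z X_in_Z R_in_Z by simp
  qed (use arrs Q.iso_arrow_Idn[of ?Y] Q.iso_arrow_Idn[of "\<S> ?X"] in simp_all)
qed

lemma distinguished_rotate:
  assumes uvw: "(u, v, w) \<in> \<T>"
  shows "(v, w, \<boxminus>\<^bsub>Q\<^esub> FAr Shift u) \<in> \<T>"
proof -
  obtain f g h q a b c where fghq: "connecting f g h q"
    and abc: "rmorphism Q Shift (a, b, c) (u, v, w) (\<pi> f, \<pi> g, \<pi> q)"
    and iso: "iso_arrow Q a" "iso_arrow Q b" "iso_arrow Q c"
    using distinguishedE[OF uvw] .
  note diagrams = distinguished_diagram[OF uvw] standard_diagram[OF fghq]
    and d_rotated = distinguished_diagram[OF standard_rotate[OF fghq]]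
  have diagram': "rdiagram Q Shift v w (\<boxminus>\<^bsub>Q\<^esub> FAr Shift u)"
    using diagrams(1) by (simp add: rdiagram_def)
  have "iso_arrow Q (FAr Shift a)"
    using Shift.FAr_iso_arrow[OF _ iso(1)] abc unfolding Shift.rmorphism_iff by blast
  then have "risomorphic Q Shift (v, w, \<boxminus>\<^bsub>Q\<^esub> FAr Shift u) (\<pi> g, \<pi> q, \<boxminus>\<^bsub>Q\<^esub> FAr Shift (\<pi> f))"
    using Shift.rmorphism_rotate[OF diagrams abc] iso unfolding risomorphic_def by blast
  then show ?thesis
    using distinguished_iso_closed[OF standard_rotate[OF fghq] diagram']
      Shift.risomorphic_sym[OF diagram' d_rotated]
    by blast
qed

text \<open>A square that commutes modulo injectives is corrected to a commuting one by extending
  the error term along the inflation \<open>f\<close>.\<close>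

lemma standard_completion:
  assumes fghq: "connecting f g h q" and fghq': "connecting f' g' h' q'"
    and a_hom: "a \<in> Hom Q (Src C f) (Src C f')" and b_hom: "b \<in> Hom Q (Tgt C f) (Tgt C f')"
    and square: "b \<cdot>\<^bsub>Q\<^esub> \<pi> f = \<pi> f' \<cdot>\<^bsub>Q\<^esub> a"
  shows "\<exists>c. rmorphism Q Shift (a, b, c) (\<pi> f, \<pi> g, \<pi> q) (\<pi> f', \<pi> g', \<pi> q')"
proof -
  note arrs = connecting_arr[OF fghq] connecting_arr[OF fghq']
  note fgh = connecting_conflation[OF fghq] and fgh' = connecting_conflation[OF fghq']
  obtain a\<^sub>0 where a\<^sub>0_repr: "a\<^sub>0 \<in> Hom C (Src C f) (Src C f')" "a = \<pi> a\<^sub>0"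
    using quotient_HomE[OF a_hom] by blast
  obtain b\<^sub>0 where b\<^sub>0_repr: "b\<^sub>0 \<in> Hom C (Tgt C f) (Tgt C f')" "b = \<pi> b\<^sub>0"
    using quotient_HomE[OF b_hom] by blast
  have "\<pi> (b\<^sub>0 \<cdot> f) = \<pi> (f' \<cdot> a\<^sub>0)" using square a\<^sub>0_repr b\<^sub>0_repr arrs by simp
  then obtain W u v where W_in_J: "W \<in> J" and u_hom: "u \<in> Hom C (Src C f) W"
    and v_hom: "v \<in> Hom C W (Tgt C f')"
    and diff: "b\<^sub>0 \<cdot> f \<boxplus> \<boxminus> (f' \<cdot> a\<^sub>0) = v \<cdot> u"
    by (rule proj_eqE[where A = "Src C f" and B = "Tgt C f'"]) (use a\<^sub>0_repr b\<^sub>0_repr arrs in auto)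
  obtain u' where u'_spec: "u' \<in> Hom C (Tgt C f) W" "u' \<cdot> f = u"
    using injective_extend[OF fgh W_in_J u_hom] .
  let ?b = "b\<^sub>0 \<boxplus> v \<cdot> \<boxminus> u'"
  have b_hom: "?b \<in> Hom C (Tgt C f) (Tgt C f')" using b\<^sub>0_repr v_hom u'_spec by simp
  have b_proj: "\<pi> ?b = \<pi> b\<^sub>0"
    using proj_Plus_factoring[of b\<^sub>0 "Tgt C f" "Tgt C f'" W "\<boxminus> u'" v] b\<^sub>0_repr W_in_J v_hom u'_spec
    by simp
  have "b\<^sub>0 \<cdot> f = f' \<cdot> a\<^sub>0 \<boxplus> v \<cdot> u"
    using a\<^sub>0_repr b\<^sub>0_repr arrs u_hom v_hom diff
    by (intro eq_Plus_if_diff_eq[of _ "Src C f" "Tgt C f'"]) auto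
  then have "?b \<cdot> f = f' \<cdot> a\<^sub>0"
    using a\<^sub>0_repr(1) b\<^sub>0_repr(1) u_hom v_hom u'_spec arrs by simp
  then obtain c where "rmorphism C (Sig C) (a\<^sub>0, ?b, c) (f, g, h) (f', g', h')"
    using triangle_completion[OF conflation_triangle[OF fgh] conflation_triangle[OF fgh'] a\<^sub>0_repr(1)
        b_hom]
    by blast
  then show ?thesis using standard_morphism[OF fghq fghq'] b_proj a\<^sub>0_repr(2) b\<^sub>0_repr(2) by metis
qed

lemma distinguished_completion:
  assumes fgh: "(f, g, h) \<in> \<T>" and fgh': "(f', g', h') \<in> \<T>"
    and a_hom: "a \<in> Hom Q (Src Q f) (Src Q f')" and b_hom: "b \<in> Hom Q (Tgt Q f) (Tgt Q f')"
    and square: "b \<cdot>\<^bsub>Q\<^esub> f = f' \<cdot>\<^bsub>Q\<^esub> a"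
  shows "\<exists>c. rmorphism Q Shift (a, b, c) (f, g, h) (f', g', h')"
proof -
  obtain k l m q x y z where klmq: "connecting k l m q"
    and xyz: "rmorphism Q Shift (x, y, z) (f, g, h) (\<pi> k, \<pi> l, \<pi> q)"
      "iso_arrow Q x" "iso_arrow Q y" "iso_arrow Q z"
    using distinguishedE[OF fgh] .
  obtain k' l' m' q' x' y' z' where klmq': "connecting k' l' m' q'"
    and xyz': "rmorphism Q Shift (x', y', z') (f', g', h') (\<pi> k', \<pi> l', \<pi> q')"
      "iso_arrow Q x'" "iso_arrow Q y'" "iso_arrow Q z'"
    using distinguishedE[OF fgh'] .
  show ?thesis
  proof (rule Shift.rmorphism_completion_transfer[OF distinguished_diagram[OF fgh]
        standard_diagram[OF klmq]
        distinguished_diagram[OF fgh'] standard_diagram[OF klmq'] xyz xyz' a_hom b_hom square])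
    fix a b assume "a \<in> Hom Q (Src Q (\<pi> k)) (Src Q (\<pi> k'))" "b \<in> Hom Q (Tgt Q (\<pi> k)) (Tgt Q (\<pi> k'))"
      and "b \<cdot>\<^bsub>Q\<^esub> \<pi> k = \<pi> k' \<cdot>\<^bsub>Q\<^esub> a"
    then show "\<exists>c. rmorphism Q Shift (a, b, c) (\<pi> k, \<pi> l, \<pi> q) (\<pi> k', \<pi> l', \<pi> q')"
      using standard_completion[OF klmq klmq'] connecting_arr[OF klmq] connecting_arr[OF klmq']
      by simp
  qed
qed

sublocale Triangles: pre_right_triangulation Q Shift \<T>
  by unfold_locales (fact Shift_additive distinguished_diagram distinguished_iso_closed
      distinguished_zero
      distinguished_ex distinguished_rotate distinguished_completion)+

section \<open>The octahedral axiom in the quotient\<close>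

lemma standard_morphism_third:
  assumes "connecting f g h q" "connecting f' g' h' q'" "Src C f' = Src C f"
    and "rmorphism C (Sig C) (Idn C (Src C f), b, c) (f, g, h) (f', g', h')"
  shows "\<pi> q' \<cdot>\<^bsub>Q\<^esub> \<pi> c = \<pi> q"
proof -
  note arrs = connecting_arr[OF assms(1)] connecting_hom[OF assms(1)] connecting_hom[OF assms(2)]
  have c_hom: "c \<in> Hom C (Tgt C g) (Tgt C g')" using assms(4) by (simp add: rmorphism_def)
  have "FAr Shift (\<pi> (Idn C (Src C f))) \<cdot>\<^bsub>Q\<^esub> \<pi> q = \<pi> q' \<cdot>\<^bsub>Q\<^esub> \<pi> c"
    using standard_morphism[OF assms(1,2,4)] unfolding Shift.rmorphism_iff by blast
  then show ?thesis using arrs c_hom Shift_proj_Idn[of "Src C f"] by simp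
qed

lemma standard_octahedron_sum:
  assumes fgh: "connecting f g h q\<^sub>f" and lmn: "connecting l m n q\<^sub>l"
    and lmn': "connecting l' m' n' q\<^sub>l'" and mgh: "connecting (m \<cdot> l') g' h' q"
    and match: "Src C l = Src C f" "Tgt C l' = Tgt C l" "Tgt C m' = Tgt C f" "m' \<cdot> l = f"
    and g'_spec: "g' \<in> Hom C (Tgt C m) (Tgt C g)" "g' \<cdot> m = g \<cdot> m'"
    and h'_spec: "h' \<in> Hom C (Tgt C g) (\<Sigma>\<^sub>0 (Src C l'))" "h' \<cdot> g = n'"
    and sum: "\<Sigma>\<^sub>1 l \<cdot> h \<boxplus> \<Sigma>\<^sub>1 l' \<cdot> h' = Zer C (Tgt C g) (\<Sigma>\<^sub>0 (Tgt C l))"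
  shows "FAr Shift (\<pi> l) \<cdot>\<^bsub>Q\<^esub> \<pi> q\<^sub>f \<boxplus>\<^bsub>Q\<^esub> FAr Shift (\<pi> l') \<cdot>\<^bsub>Q\<^esub> \<pi> q = \<pi> (Zer C (Tgt C g) (\<S> (Tgt C l)))"
proof -
  let ?M = "Tgt C l"
  note ext = connecting_conflation[THEN conflation_extension]
  note arrs = connecting_arr[OF fgh] connecting_arr[OF lmn] connecting_arr[OF lmn'] match(1-3)
    connecting_hom[OF fgh] connecting_hom[OF mgh]
  have M_in_Z: "?M \<in> Z" and l_hom: "l \<in> Hom C (Src C f) ?M"
    and l'_hom: "l' \<in> Hom C (Src C (m \<cdot> l')) ?M"
    using arrs by auto
  obtain b where lbc: "rmorphism C (Sig C) (l, b, sh_S s l \<cdot> q\<^sub>f) (f, g, h) (\<alpha> ?M, \<beta> ?M, \<gamma> ?M)"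
    using connecting_shift_morphism[OF fgh l_hom M_in_Z] .
  obtain b' where lbc':
    "rmorphism C (Sig C) (l', b', sh_S s l' \<cdot> q) (m \<cdot> l', g', h') (\<alpha> ?M, \<beta> ?M, \<gamma> ?M)"
    using connecting_shift_morphism[OF mgh l'_hom M_in_Z] .
  obtain t where t_spec: "t \<in> Hom C (Tgt C g) (Src C (\<beta> ?M))"
    "sh_S s l \<cdot> q\<^sub>f \<boxplus> sh_S s l' \<cdot> q = \<beta> ?M \<cdot> t"
    using octahedron_induced_arrows_cancel[OF ac1 ext[OF fgh] ext[OF lmn] ext[OF lmn'] match
        g'_spec h'_spec sum conflation_extension[OF shift_conflation[OF M_in_Z]] lbc lbc'] .
  have "\<pi> (sh_S s l \<cdot> q\<^sub>f \<boxplus> sh_S s l' \<cdot> q) = \<pi> (Zer C (Tgt C g) (\<S> ?M))"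
    unfolding t_spec(2) using t_spec(1) M_in_Z by (intro proj_eq_Zer_if_factors[of "\<I> ?M"]) auto
  then show ?thesis
    using arrs g'_spec(1) M_in_Z sh_S_hom[of l "Src C f" ?M] sh_S_hom[of l' "Src C l'" ?M]
    by (simp add: Shift_proj_sh_S[of _ _ ?M])
qed

lemma standard_octahedral:
  assumes fgh: "connecting f g h q\<^sub>f" and lmn: "connecting l m n q\<^sub>l"
    and lmn': "connecting l' m' n' q\<^sub>l'"
    and match: "Src C l = Src C f" "Tgt C l' = Tgt C l" "Tgt C m' = Tgt C f" "m' \<cdot> l = f"
  shows "octahedral Q Shift \<T> (\<pi> f, \<pi> g, \<pi> q\<^sub>f) (\<pi> l, \<pi> m, \<pi> q\<^sub>l) (\<pi> l', \<pi> m', \<pi> q\<^sub>l')"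
proof -
  let ?M = "Tgt C l"
  note ext = connecting_conflation[THEN conflation_extension]
  note arrs = connecting_arr[OF fgh] connecting_arr[OF lmn] connecting_arr[OF lmn'] match(1-3)
    connecting_hom[OF fgh] connecting_hom[OF lmn] connecting_hom[OF lmn']
  obtain g' h' where g'_hom: "g' \<in> Hom C (Tgt C m) (Tgt C g)"
    and h'_hom: "h' \<in> Hom C (Tgt C g) (\<Sigma>\<^sub>0 (Src C l'))"
    and h'g_eq: "h' \<cdot> g = n'" and hg'_eq: "h \<cdot> g' = n" and g'm_eq: "g' \<cdot> m = g \<cdot> m'"
    and sum: "\<Sigma>\<^sub>1 l \<cdot> h \<boxplus> \<Sigma>\<^sub>1 l' \<cdot> h' = Zer C (Tgt C g) (\<Sigma>\<^sub>0 ?M)"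
    and "(m \<cdot> l', g', h') \<in> extensions C"
    by (rule octahedralE[OF extension_octahedral[OF ext[OF fgh] ext[OF lmn] ext[OF lmn'] match]])
  then have "(m \<cdot> l', g', h') \<in> conflations C Z" using arrs by (intro conflationI) auto
  then obtain q where mgh: "connecting (m \<cdot> l') g' h' q" by (rule connecting_ex)
  have q_hom: "q \<in> Hom C (Tgt C g) (\<S> (Src C l'))" using connecting_hom[OF mgh] arrs g'_hom by simp
  have "rmorphism C (Sig C) (Idn C (Src C l'), m, g) (l', m', n') (m \<cdot> l', g', h')"
    using arrs g'_hom h'g_eq g'm_eq by (simp add: rmorphism_def)
  then have qg_eq: "\<pi> q \<cdot>\<^bsub>Q\<^esub> \<pi> g = \<pi> q\<^sub>l'"
    using arrs by (intro standard_morphism_third[OF lmn' mgh]) auto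
  have "rmorphism C (Sig C) (Idn C (Src C l), m', g') (l, m, n) (f, g, h)"
    using arrs g'_hom hg'_eq g'm_eq match(4) by (simp add: rmorphism_def)
  then have qg'_eq: "\<pi> q\<^sub>f \<cdot>\<^bsub>Q\<^esub> \<pi> g' = \<pi> q\<^sub>l"
    using arrs by (intro standard_morphism_third[OF lmn fgh]) auto
  note standard_octahedron_sum[OF fgh lmn lmn' mgh match g'_hom g'm_eq h'_hom h'g_eq sum]
  then show ?thesis
    using arrs g'_hom q_hom qg_eq qg'_eq g'm_eq standard_distinguished[OF mgh]
    by (intro octahedralI[where g' = "\<pi> g'" and h' = "\<pi> q"]) simp_all
qed

text \<open>An arrow \<open>k\<close> into the middle term of a conflation \<open>(l, m, n)\<close> and its composite with \<open>m\<close>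
  become inflations after adding an injective to the middle and the last term.\<close>

lemma standard_octahedron_model:
  assumes lmn: "connecting l m n q" and k_hom: "k \<in> Hom C A (Tgt C l)" and A_in_Z: "A \<in> Z"
  obtains f g h q\<^sub>f k\<^sub>1 g' h' q\<^sub>k l\<^sub>1 m\<^sub>1 n\<^sub>1 q\<^sub>1 v w
  where "connecting f g h q\<^sub>f" "connecting k\<^sub>1 g' h' q\<^sub>k" "connecting l\<^sub>1 m\<^sub>1 n\<^sub>1 q\<^sub>1"
    and "Src C f = A" "Src C k\<^sub>1 = A" "Tgt C l\<^sub>1 = Tgt C k\<^sub>1" "Tgt C m\<^sub>1 = Tgt C f" "m\<^sub>1 \<cdot> k\<^sub>1 = f"
    and "\<pi> k\<^sub>1 = \<pi> (v \<cdot> k)" "iso_arrow Q (\<pi> v)" "iso_arrow Q (\<pi> w)"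
    and "rmorphism C (Sig C) (Idn C (Src C l), v, w) (l, m, n) (l\<^sub>1, m\<^sub>1, n\<^sub>1)"
proof -
  let ?M = "Tgt C l" and ?B = "Tgt C m"
  note lmn_arr = connecting_arr[OF lmn]
  obtain P u v r t where P_in_Z: "P \<in> Z" and P_biproduct: "biproduct_arrows C (\<I> A) ?M P u v r t"
    using Z_biproduct[OF shift_arr(9)[OF A_in_Z]] lmn_arr(8) by blast
  obtain R x w y z where R_in_Z: "R \<in> Z" and R_biproduct: "biproduct_arrows C (\<I> A) ?B R x w y z"
    using Z_biproduct[OF shift_arr(9)[OF A_in_Z]] lmn_arr(9) by blast
  note arrs = lmn_arr biproduct_arrows_arr[OF P_biproduct] biproduct_arrows_arr[OF R_biproduct]
    shift_arr[OF A_in_Z] k_hom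
    and comps = biproduct_arrows_comp[OF P_biproduct] biproduct_arrows_comp[OF R_biproduct]
  define k\<^sub>1 where "k\<^sub>1 = v \<cdot> k \<boxplus> u \<cdot> \<alpha> A"
  define f where "f = w \<cdot> m \<cdot> k \<boxplus> x \<cdot> \<alpha> A"
  define m\<^sub>1 where "m\<^sub>1 = x \<cdot> r \<boxplus> w \<cdot> m \<cdot> t"
  have hom: "k\<^sub>1 \<in> Hom C A P" "f \<in> Hom C A R" "m\<^sub>1 \<in> Hom C P R" "v \<cdot> l \<in> Hom C (Src C l) P"
    using arrs by (simp_all add: k\<^sub>1_def f_def m\<^sub>1_def)
  have "m \<cdot> k \<in> Hom C A ?B" using arrs by simp
  then obtain g h where "(f, g, h) \<in> conflations C Z"
    unfolding f_def using cone_conflation[OF _ A_in_Z _ R_biproduct] lmn_arr(9) by blast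
  then obtain q\<^sub>f where f_connecting: "connecting f g h q\<^sub>f" by (rule connecting_ex)
  obtain g' h' where "(k\<^sub>1, g', h') \<in> conflations C Z"
    unfolding k\<^sub>1_def using cone_conflation[OF k_hom A_in_Z _ P_biproduct] lmn_arr(8) by blast
  then obtain q\<^sub>k where k\<^sub>1_connecting: "connecting k\<^sub>1 g' h' q\<^sub>k" by (rule connecting_ex)
  have "(v \<cdot> l, m\<^sub>1, n \<cdot> z) \<in> extensions C"
    unfolding m\<^sub>1_def using arrs hom(4)
    by (intro extension_add_split[OF conflation_extension[OF connecting_conflation[OF lmn]]
          P_biproduct R_biproduct])
      (simp_all add: comps)
  then have "(v \<cdot> l, m\<^sub>1, n \<cdot> z) \<in> conflations C Z"
    using arrs hom(3) R_in_Z by (intro conflationI) auto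
  then obtain q\<^sub>1 where l\<^sub>1_connecting: "connecting (v \<cdot> l) m\<^sub>1 (n \<cdot> z) q\<^sub>1" by (rule connecting_ex)
  show thesis
  proof (rule that[OF f_connecting k\<^sub>1_connecting l\<^sub>1_connecting])
    show "m\<^sub>1 \<cdot> k\<^sub>1 = f"
      using arrs A_in_Z Plus_comm[of "x \<cdot> \<alpha> A" "w \<cdot> m \<cdot> k"] by (simp add: m\<^sub>1_def k\<^sub>1_def f_def comps)
    show "\<pi> k\<^sub>1 = \<pi> (v \<cdot> k)"
      unfolding k\<^sub>1_def using arrs by (intro proj_Plus_factoring[of _ A P "\<I> A"]) auto
    show "iso_arrow Q (\<pi> v)" "iso_arrow Q (\<pi> w)"
      using iso_arrow_proj_injection[OF P_biproduct] iso_arrow_proj_injection[OF R_biproduct] arrs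
        P_in_Z R_in_Z by auto
    show "rmorphism C (Sig C) (Idn C (Src C l), v, w) (l, m, n) (v \<cdot> l, m\<^sub>1, n \<cdot> z)"
      using arrs hom(3) unfolding Susp.rmorphism_iff by (simp add: m\<^sub>1_def comps)
  qed (use arrs hom in auto)
qed

lemma octahedral_if_third_standard:
  assumes fgh: "(f, g, h) \<in> \<T>" and lmn: "(l, m, n) \<in> \<T>" and lmn': "connecting l' m' n' q"
    and match: "Src Q l = Src Q f" "Tgt Q l = Tgt C l'" "Tgt Q f = Tgt C m'" "\<pi> m' \<cdot>\<^bsub>Q\<^esub> l = f"
  shows "octahedral Q Shift \<T> (f, g, h) (l, m, n) (\<pi> l', \<pi> m', \<pi> q)"
proof -
  let ?A = "Src Q f"
  note arrs = Triangles.triangle_arr[OF fgh] Triangles.triangle_arr[OF lmn] match(1-3)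
    connecting_arr[OF lmn']
  have A_in_Z: "?A \<in> Z" using arrs Q.arr_obj(1)[of f] by simp
  have "l \<in> Hom Q ?A (Tgt C l')" using arrs by simp
  then obtain k where k_hom: "k \<in> Hom C ?A (Tgt C l')" and l_eq: "l = \<pi> k" by (rule quotient_HomE)
  obtain f\<^sub>1 g\<^sub>1 h\<^sub>1 q\<^sub>f k\<^sub>1 m\<^sub>1 n\<^sub>1 q\<^sub>k l'\<^sub>1 m'\<^sub>1 n'\<^sub>1 q\<^sub>l v w
    where model: "connecting f\<^sub>1 g\<^sub>1 h\<^sub>1 q\<^sub>f" "connecting k\<^sub>1 m\<^sub>1 n\<^sub>1 q\<^sub>k" "connecting l'\<^sub>1 m'\<^sub>1 n'\<^sub>1 q\<^sub>l"
    and match\<^sub>1: "Src C f\<^sub>1 = ?A" "Src C k\<^sub>1 = ?A" "Tgt C l'\<^sub>1 = Tgt C k\<^sub>1" "Tgt C m'\<^sub>1 = Tgt C f\<^sub>1"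
      "m'\<^sub>1 \<cdot> k\<^sub>1 = f\<^sub>1"
    and vk_eq: "\<pi> k\<^sub>1 = \<pi> (v \<cdot> k)" and iso: "iso_arrow Q (\<pi> v)" "iso_arrow Q (\<pi> w)"
    and vw_morphism: "rmorphism C (Sig C) (Idn C (Src C l'), v, w) (l', m', n') (l'\<^sub>1, m'\<^sub>1, n'\<^sub>1)"
    by (rule standard_octahedron_model[OF lmn' k_hom A_in_Z])
  note arrs\<^sub>1 = connecting_arr[OF model(1)] connecting_arr[OF model(2)] connecting_arr[OF model(3)]
    match\<^sub>1(1-4)
  have v_hom: "v \<in> Hom C (Tgt C l') (Tgt C k\<^sub>1)" using vw_morphism arrs\<^sub>1 by (simp add: rmorphism_def)
  note standard = standard_distinguished[OF model(1)] standard_distinguished[OF model(2)]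
    standard_distinguished[OF model(3)]
  show ?thesis
  proof (rule Triangles.octahedral_iso_closed[OF fgh lmn standard_distinguished[OF lmn'] _ _ _
        match(4) standard])
    show "rmorphism Q Shift (\<pi> (Idn C (Src C l')), \<pi> v, \<pi> w) (\<pi> l', \<pi> m', \<pi> q) (\<pi> l'\<^sub>1, \<pi> m'\<^sub>1, \<pi> q\<^sub>l)"
      by (rule standard_morphism[OF lmn' model(3) vw_morphism])
    show "octahedral Q Shift \<T> (\<pi> f\<^sub>1, \<pi> g\<^sub>1, \<pi> q\<^sub>f) (\<pi> k\<^sub>1, \<pi> m\<^sub>1, \<pi> q\<^sub>k) (\<pi> l'\<^sub>1, \<pi> m'\<^sub>1, \<pi> q\<^sub>l)"
      using match\<^sub>1 by (intro standard_octahedral[OF model]) auto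
    show "iso_arrow Q (Idn Q ?A)" "iso_arrow Q (\<pi> (Idn C (Src C l')))"
      using Q.iso_arrow_Idn[of ?A] Q.iso_arrow_Idn[of "Src C l'"] A_in_Z arrs by auto
    show "\<pi> v \<cdot>\<^bsub>Q\<^esub> l = \<pi> k\<^sub>1 \<cdot>\<^bsub>Q\<^esub> Idn Q ?A" using v_hom k_hom vk_eq arrs\<^sub>1 A_in_Z by (simp add: l_eq)
  qed (use arrs arrs\<^sub>1 v_hom A_in_Z match\<^sub>1(5) iso in auto)
qed

lemma distinguished_octahedral:
  assumes fgh: "(f, g, h) \<in> \<T>" and lmn: "(l, m, n) \<in> \<T>" and lmn': "(l', m', n') \<in> \<T>"
    and match: "Src Q l = Src Q f" "Tgt Q l' = Tgt Q l" "Tgt Q m' = Tgt Q f" "m' \<cdot>\<^bsub>Q\<^esub> l = f"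
  shows "octahedral Q Shift \<T> (f, g, h) (l, m, n) (l', m', n')"
proof -
  let ?A = "Src Q f"
  note arrs = Triangles.triangle_arr[OF fgh] Triangles.triangle_arr[OF lmn]
    Triangles.triangle_arr[OF lmn']
    match(1-3)
  obtain l'\<^sub>0 m'\<^sub>0 n'\<^sub>0 q a u b where lmn'\<^sub>0: "connecting l'\<^sub>0 m'\<^sub>0 n'\<^sub>0 q"
    and aub: "rmorphism Q Shift (a, u, b) (l', m', n') (\<pi> l'\<^sub>0, \<pi> m'\<^sub>0, \<pi> q)"
      "iso_arrow Q a" "iso_arrow Q u" "iso_arrow Q b"
    using distinguishedE[OF lmn'] .
  note arrs\<^sub>0 = connecting_arr[OF lmn'\<^sub>0]
  have u_hom: "u \<in> Hom Q (Tgt Q l) (Tgt C l'\<^sub>0)"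
    using aub(1) arrs arrs\<^sub>0 unfolding Shift.rmorphism_iff by auto
  let ?l = "u \<cdot>\<^bsub>Q\<^esub> l"
  let ?f = "\<pi> m'\<^sub>0 \<cdot>\<^bsub>Q\<^esub> ?l"
  have l_hom: "?l \<in> Hom Q ?A (Tgt C l'\<^sub>0)" using u_hom arrs by simp
  then have f_hom: "?f \<in> Hom Q ?A (Tgt C m'\<^sub>0)" using arrs\<^sub>0 by simp
  obtain m\<^sub>0 n\<^sub>0 where lmn\<^sub>0: "(?l, m\<^sub>0, n\<^sub>0) \<in> \<T>" using distinguished_ex[of ?l] l_hom by auto
  obtain g\<^sub>0 h\<^sub>0 where fgh\<^sub>0: "(?f, g\<^sub>0, h\<^sub>0) \<in> \<T>" using distinguished_ex[of ?f] f_hom by auto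
  have "octahedral Q Shift \<T> (?f, g\<^sub>0, h\<^sub>0) (?l, m\<^sub>0, n\<^sub>0) (\<pi> l'\<^sub>0, \<pi> m'\<^sub>0, \<pi> q)"
    using l_hom f_hom by (intro octahedral_if_third_standard[OF fgh\<^sub>0 lmn\<^sub>0 lmn'\<^sub>0]) auto
  moreover have "?l = ?l \<cdot>\<^bsub>Q\<^esub> Idn Q ?A" using Q.comp_Idn(1)[of ?l ?A] l_hom by simp
  moreover have "?A \<in> Z" using arrs Q.arr_obj(1)[of f] by simp
  ultimately show ?thesis
    using l_hom f_hom u_hom arrs arrs\<^sub>0 aub Q.iso_arrow_Idn[of ?A]
    by (intro Triangles.octahedral_iso_closed[OF fgh lmn lmn' match fgh\<^sub>0 lmn\<^sub>0
          standard_distinguished[OF lmn'\<^sub>0], of "Idn Q ?A" u a b]) simp_all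
qed

theorem quotient_triangulated: "triangulated_category Q Shift \<T>"
proof -
  interpret stable_right_triangulation Q Shift \<T>
  proof unfold_locales
    show "\<exists>A\<in>Obj Q. isomorphic Q (FOb Shift A) B" if "B \<in> Obj Q" for B
      using Shift_essentially_surjective that by simp
    show "\<exists>f\<in>Hom Q A B. FAr Shift f = k"
      if "A \<in> Obj Q" "B \<in> Obj Q" "k \<in> Hom Q (FOb Shift A) (FOb Shift B)" for A B k
      using Shift_full that by (simp del: Q.Hom_iff)
    show "\<exists>g'\<in>Hom Q (Tgt Q m) (Tgt Q g). \<exists>h'\<in>Hom Q (Tgt Q g) (FOb Shift (Src Q l')).
        h' \<cdot>\<^bsub>Q\<^esub> g = n' \<and> h \<cdot>\<^bsub>Q\<^esub> g' = n \<and> g' \<cdot>\<^bsub>Q\<^esub> m = g \<cdot>\<^bsub>Q\<^esub> m' \<and>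
        FAr Shift l \<cdot>\<^bsub>Q\<^esub> h \<boxplus>\<^bsub>Q\<^esub> FAr Shift l' \<cdot>\<^bsub>Q\<^esub> h' = Zer Q (Tgt Q g) (FOb Shift (Tgt Q l)) \<and>
        (m \<cdot>\<^bsub>Q\<^esub> l', g', h') \<in> \<T>"
      if "(f, g, h) \<in> \<T>" "(l, m, n) \<in> \<T>" "(l', m', n') \<in> \<T>" "Src Q l = Src Q f"
        "Tgt Q l' = Tgt Q l" "Tgt Q m' = Tgt Q f" "m' \<cdot>\<^bsub>Q\<^esub> l = f" for f g h l m n l' m' n'
      using distinguished_octahedral[OF that] unfolding octahedral_def prod.case .
  qed (fact Shift_additive distinguished_diagram distinguished_iso_closed distinguished_zero
      distinguished_ex distinguished_rotate distinguished_completion Shift_faithful)+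
  show ?thesis by (rule triangulated)
qed

end

theorem (in frobenius_subcategory) quotient_triangulated:
  "(\<exists>s. shift_choice C Z D s) \<and>
   (\<forall>s. shift_choice C Z D s \<longrightarrow>
      triangulated_category (quotient_category C Z J) (shift_functor C Z D s)
        (distinguished_triangles C Z D s))"
proof (intro conjI allI impI ex_shift_choice)
  fix s assume "shift_choice C Z D s"
  then interpret frobenius_shift C Z D s by unfold_locales
  show "triangulated_category (quotient_category C Z J) (shift_functor C Z D s)
      (distinguished_triangles C Z D s)"
    by (rule quotient_triangulated)
qed

theorem theorem6p17:
  fixes C :: "('o, 'm) pt_cat" and Z :: "'o set"
  assumes "pseudo_triangulated C"
    and "AC1 C" and "AC2 C"
    and "additive_subcategory C Z" and "extension_closed C Z"
  shows "(\<forall>D. additive_subcategory C D \<and> D \<subseteq> Z \<and> summand_closed C Z D \<and> frobenius C Z D \<longrightarrow>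
            (\<exists>s. shift_choice C Z D s) \<and>
            (\<forall>s. shift_choice C Z D s \<longrightarrow>
               triangulated_category (quotient_category C Z (injectives C Z D))
                 (shift_functor C Z D s) (distinguished_triangles C Z D s))) \<and>
         (frobenius C Z Z \<longrightarrow>
            (\<exists>s. shift_choice C Z Z s) \<and>
            (\<forall>s. shift_choice C Z Z s \<longrightarrow>
               triangulated_category (quotient_category C Z (injectives C Z Z))
                 (shift_functor C Z Z s) (distinguished_triangles C Z Z s)))"
proof -
  have frobenius: "frobenius_subcategory C Z D"
    if "additive_subcategory C D" "D \<subseteq> Z" "frobenius C Z D" for D
    using assms that by (intro frobenius_subcategory.intro frobenius_subcategory_axioms.intro)
  show ?thesis
    using frobenius_subcategory.quotient_triangulated[OF frobenius] assms(4) by blast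
qed

end
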